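(* Let $Q=\mathbb{C}[x_1,\dots,x_n]$, let $f\in Q$ be such that $\mathfrak m=(x_1,\dots,x_n)$ is the only critical point of $f:\mathbb{A}^n_{\mathbb C}\to\mathbb{A}^1_{\mathbb C}$, and let $Q_{\mathfrak m}$ be the localization at $\mathfrak m$. Consider the composition $$\begin{aligned}\mathsf H_f^{(0)}\times\mathsf H_f^{(0)}&\xrightarrow{\ \mathrm{id}\times(-1)^n\ }\mathsf H_f^{(0)}\times\mathsf H_{-f}^{(0)}\\&\xrightarrow{\ \cong\ }H_n(\Omega^\bullet_{Q_{\mathfrak m}/\mathbb C}[[u]],-df+ud)\times H_n(\Omega^\bullet_{Q_{\mathfrak m}/\mathbb C}[[u]],df+ud)\\&\xleftarrow{\ \cong\ }\mathbb H_nR\Gamma_{\mathfrak m}(\Omega^\bullet_{Q_{\mathfrak m}/\mathbb C}[[u]],-df+ud)\times\mathbb H_nR\Gamma_{\mathfrak m}(\Omega^\bullet_{Q_{\mathfrak m}/\mathbb C}[[u]],df+ud)\\&\xrightarrow{\ \wedge\circ\mathsf{kun}\ }\mathbb H_{2n}R\Gamma_{\mathfrak m}(\Omega^\bullet_{Q_{\mathfrak m}/\mathbb C}[[u]],ud)\xrightarrow{\ \mathrm{res}\ }\mathbb C[[u]].\end{aligned}$$ For $h,g\in\mathbb C[x_1,\dots,x_n]$ this composition sends $(h\,dx_1\cdots dx_n,\ g\,dx_1\cdots dx_n)$ to $$\frac12\sum_{i=0}^\infty\Big(\mathrm{res}\big((-1)^nb_{i,f}(h)\,g\,\alpha_1\cdots\alpha_n\,dx_1\cdots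 dx_n\big)+\mathrm{res}\big(b_{i,-f}(g)\,h\,\alpha_1\cdots\alpha_n\,dx_1\cdots dx_n\big)\Big)u^i,$$ and it is $\mathbb C[[u]]$-sesquilinear in general, where $$b_{k,f}(h)=(-1)^n\sum_{a_1+\cdots+a_n=k,\ a_i\ge0}\Big(\tfrac1{f_1}\tfrac{\partial}{\partial x_1}\Big)^{a_1}\tfrac1{f_1}\cdots\Big(\tfrac1{f_n}\tfrac{\partial}{\partial x_n}\Big)^{a_n}\tfrac{h}{f_n},\qquad f_i=\frac{\partial f}{\partial x_i}$$ (operators composed, the rightmost acting first), and $b_{k,-f}$ is obtained by replacing $f$ with $-f$.
   Context: $u$ is a formal variable of degree $2$. $\mathsf H_{\pm f}^{(0)}:=H_n(\Omega^\bullet_{Q/\mathbb C}[[u]],\mp df+ud)=\Omega^n_{Q/\mathbb C}[[u]]/(\mp df\wedge+ud)\Omega^{n-1}_{Q/\mathbb C}[[u]]$. The first map is the identity on the first factor and, on the second factor, multiplication of the form by $(-1)^n$ together with $u\mapsto-u$ (so the whole composition is sesquilinear: $u$ in the first slot comes out as $u$, in the second slot as $-u$). The second map is localization at $\mathfrak m$. The third arrow is the canonical map $R\Gamma_{\mathfrak m}M\to M$, which is an isomorphism here; $R\Gamma_{\mathfrak m}$ is the local cohomology functor and $\mathbb H_k$ is hypercohomology. $\wedge\circ\mathsf{kun}$ is induced by the canonical product $R\Gamma_{\mathfrak m}M\otimes R\Gamma_{\mathfrak m}N\to R\Gamma_{\mathfrak m}(M\otimes N)$ followed by exterior multiplication of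 forms. Local cohomology is computed by Čech complexes: for elements $s_1,\dots,s_n$ generating an $\mathfrak m$-primary ideal of $Q_{\mathfrak m}$, let $\mathcal C=\bigoplus_{j}\bigoplus_{i_1<\cdots<i_j}Q_{\mathfrak m}[\frac1{s_{i_1}\cdots s_{i_j}}]\alpha_{i_1}\cdots\alpha_{i_j}$, with $|\alpha_i|=1$, $\alpha_i^2=0$, $\alpha_i\alpha_j=-\alpha_j\alpha_i$, the $\alpha_i$ also anticommuting with the $dx_j$, and differential $\sum_i\alpha_i$; then $\mathbb H_kR\Gamma_{\mathfrak m}(\Omega^\bullet_{Q_{\mathfrak m}/\mathbb C}[[u]],\partial)$ is the degree-$k$ cohomology of $((\mathcal C\otimes_{Q_{\mathfrak m}}\Omega^\bullet_{Q_{\mathfrak m}/\mathbb C})[[u]],\partial+\sum_i\alpha_i)$. Elements with denominators in the $f_i$ are read in the Čech complex with $s_i=f_i$. $\mathrm{Res}^G:H^n_{\mathfrak m}(\Omega^n_{Q_{\mathfrak m}/\mathbb C})\to\mathbb C$ is Grothendieck's residue: $\mathrm{Res}^G\left[\frac{dx_1\cdots dx_n}{x_1^{a_1},\dots,x_n^{a_n}}\right]=1$ if all $a_i=1$, and $0$ otherwise. It vanishes on the image of $d\Omega^{n-1}$, and $\mathrm{res}$ is the composite $\mathbb H_{2n}R\Gamma_{\mathfrak m}(\Omega^\bullet_{Q_{\mathfrak m}/\mathbb C}[[u]],ud)\to H^n_{\mathfrak m}(\Omega^n_{Q_{\mathfrak m}/\mathbb C}/d\Omega^{n-1}_{Q_{\mathfrak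 m}/\mathbb C})[[u]]\xrightarrow{\mathrm{Res}^G}\mathbb C[[u]]$; thus $\mathrm{res}\big(\frac{\Psi}{f_1^{m_1}\cdots f_n^{m_n}}\alpha_1\cdots\alpha_n\,dx_1\cdots dx_n\big)=\mathrm{Res}^G\left[\frac{\Psi\,dx_1\cdots dx_n}{f_1^{m_1},\dots,f_n^{m_n}}\right]$. *)

theory Defs
  imports
    Complex_Main
    "HOL-Library.Cardinality"
    "HOL-Library.Poly_Mapping"
    "HOL-Library.Function_Algebras"
    "HOL-Computational_Algebra.Fraction_Field"
    "HOL-Computational_Algebra.Formal_Power_Series"
begin

section \<open>Polynomials, rational functions and the local ring\<close>

text \<open>
  The variables are indexed by a finite linearly ordered type \<open>'n\<close>, so \<open>n = CARD('n)\<close> is an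
  arbitrary positive number and \<open>x\<^sub>1, \<dots>, x\<^sub>n\<close> are the variables in increasing order of
  their index. All rings below are subrings of the field of rational functions.
\<close>

type_synonym 'n mpoly = "('n \<Rightarrow>\<^sub>0 nat) \<Rightarrow>\<^sub>0 complex"
type_synonym 'n ratfun = "'n mpoly fract"

abbreviation Var :: "'n \<Rightarrow> 'n mpoly" where
  "Var i \<equiv> Poly_Mapping.single (Poly_Mapping.single i 1) 1"

abbreviation emb :: "'n::linorder mpoly \<Rightarrow> 'n ratfun" where
  "emb p \<equiv> Fraction_Field.Fract p 1"

abbreviation cst :: "complex \<Rightarrow> 'n::linorder ratfun" where
  "cst c \<equiv> emb (Poly_Mapping.single 0 c)"

definition mpderiv :: "'n \<Rightarrow> 'n mpoly \<Rightarrow> 'n mpoly" where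
  "mpderiv i p = (\<Sum>m\<in>Poly_Mapping.keys p.
     Poly_Mapping.single (m - Poly_Mapping.single i 1)
       (of_nat (Poly_Mapping.lookup m i) * Poly_Mapping.lookup p m))"

lemma mpderiv_superset:
  assumes "finite S" "Poly_Mapping.keys p \<subseteq> S"
  shows "mpderiv i p = (\<Sum>m\<in>S.
     Poly_Mapping.single (m - Poly_Mapping.single i 1)
       (of_nat (Poly_Mapping.lookup m i) * Poly_Mapping.lookup p m))"
  unfolding mpderiv_def using assms
  by (intro sum.mono_neutral_left) (auto simp: in_keys_iff)

lemma mpderiv_add: "mpderiv i (p + q) = mpderiv i p + mpderiv i q"
proof -
  let ?S = "Poly_Mapping.keys p \<union> Poly_Mapping.keys q"
  have "Poly_Mapping.keys (p + q) \<subseteq> ?S" by (rule Poly_Mapping.keys_add)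
  then show ?thesis
    by (simp add: mpderiv_superset[of ?S] lookup_add algebra_simps single_add sum.distrib)
qed

lemma mpderiv_zero [simp]: "mpderiv i 0 = 0"
  by (simp add: mpderiv_def)

lemma mpderiv_sum: "mpderiv i (sum g A) = (\<Sum>x\<in>A. mpderiv i (g x))"
  by (induction A rule: infinite_finite_induct) (simp_all add: mpderiv_add)

lemma mpderiv_single:
  "mpderiv i (Poly_Mapping.single m c) =
     Poly_Mapping.single (m - Poly_Mapping.single i 1) (of_nat (Poly_Mapping.lookup m i) * c)"
  by (cases "c = 0") (simp_all add: mpderiv_def)

lemma single_minus_shift:
  fixes m m' :: "'n \<Rightarrow>\<^sub>0 nat"
  assumes "Poly_Mapping.lookup m i \<noteq> 0"
  shows "m + m' - Poly_Mapping.single i 1 = m - Poly_Mapping.single i 1 + m'"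
  using assms
  by (intro poly_mapping_eqI) (auto simp: lookup_add lookup_minus lookup_single when_def)

lemma mpderiv_mult_single:
  fixes m m' :: "'n \<Rightarrow>\<^sub>0 nat" and c c' :: complex
  shows "mpderiv i (Poly_Mapping.single m c * Poly_Mapping.single m' c') =
     mpderiv i (Poly_Mapping.single m c) * Poly_Mapping.single m' c' +
     Poly_Mapping.single m c * mpderiv i (Poly_Mapping.single m' c')"
proof -
  let ?e = "Poly_Mapping.single i (1::nat)"
  have 1: "mpderiv i (Poly_Mapping.single m c) * Poly_Mapping.single m' c' =
      Poly_Mapping.single (m + m' - ?e) (of_nat (Poly_Mapping.lookup m i) * c * c')"
    by (cases "Poly_Mapping.lookup m i = 0")
       (simp_all add: mpderiv_single mult_single single_minus_shift del: One_nat_def)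
  have 2: "Poly_Mapping.single m c * mpderiv i (Poly_Mapping.single m' c') =
      Poly_Mapping.single (m + m' - ?e) (of_nat (Poly_Mapping.lookup m' i) * c * c')"
    using single_minus_shift[of m' i m]
    by (cases "Poly_Mapping.lookup m' i = 0")
       (simp_all add: mpderiv_single mult_single ac_simps del: One_nat_def)
  show ?thesis
    unfolding 1 2 by (simp add: mult_single mpderiv_single lookup_add algebra_simps single_add)
qed

lemma mpoly_monom_sum:
  fixes p :: "'n mpoly"
  shows "p = (\<Sum>m\<in>Poly_Mapping.keys p. Poly_Mapping.single m (Poly_Mapping.lookup p m))"
proof (rule poly_mapping_eqI)
  fix k
  show "Poly_Mapping.lookup p k = Poly_Mapping.lookup
      (\<Sum>m\<in>Poly_Mapping.keys p. Poly_Mapping.single m (Poly_Mapping.lookup p m)) k"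
    by (cases "k \<in> Poly_Mapping.keys p")
       (auto simp: lookup_sum lookup_single when_def in_keys_iff)
qed

lemma mpderiv_mult: "mpderiv i (p * q) = mpderiv i p * q + p * mpderiv i q"
proof -
  have "mpderiv i ((\<Sum>m\<in>A. Poly_Mapping.single m (a m)) * (\<Sum>m\<in>B. Poly_Mapping.single m (b m))) =
     mpderiv i (\<Sum>m\<in>A. Poly_Mapping.single m (a m)) * (\<Sum>m\<in>B. Poly_Mapping.single m (b m)) +
     (\<Sum>m\<in>A. Poly_Mapping.single m (a m)) * mpderiv i (\<Sum>m\<in>B. Poly_Mapping.single m (b m))"
    for A B a b
    by (simp add: sum_product mpderiv_sum mpderiv_mult_single sum.distrib)
  from this[where A = "Poly_Mapping.keys p" and a = "Poly_Mapping.lookup p"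
      and B = "Poly_Mapping.keys q" and b = "Poly_Mapping.lookup q"]
  show ?thesis by (simp only: mpoly_monom_sum[symmetric])
qed

lemma quotient_rule_respects:
  fixes a b c d a' b' c' d' :: "'a::comm_ring_1"
  assumes "a * d = c * b" "a' * d + a * d' = c' * b + c * b'"
  shows "(a' * b - a * b') * (d * d) = (c' * d - c * d') * (b * b)"
proof -
  have "(a' * b - a * b') * (d * d) = (a' * d) * (b * d) - (a * d) * (b' * d)"
    by (simp add: algebra_simps)
  also have "a' * d = c' * b + c * b' - a * d'"
    using assms(2) by (simp only: eq_diff_eq)
  also have "(c' * b + c * b' - a * d') * (b * d) - (a * d) * (b' * d) =
      c' * b * (b * d) - (a * d) * (b * d') + (c * b - a * d) * (b' * d)"
    by (simp add: algebra_simps)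
  also have "\<dots> = (c' * d - c * d') * (b * b)"
    unfolding assms(1) by (simp add: algebra_simps)
  finally show ?thesis .
qed

lift_definition rat_deriv :: "'n \<Rightarrow> 'n::linorder ratfun \<Rightarrow> 'n ratfun"
  is "\<lambda>i (a, b). (mpderiv i a * b - a * mpderiv i b, b * b)"
proof (clarsimp simp: fractrel_def)
  fix i and a b c d :: "'n mpoly"
  assume eq: "a * d = c * b"
  have "mpderiv i a * d + a * mpderiv i d = mpderiv i c * b + c * mpderiv i b"
    using arg_cong[OF eq, of "mpderiv i"] by (simp only: mpderiv_mult)
  with eq show "(mpderiv i a * b - a * mpderiv i b) * (d * d) =
      (mpderiv i c * d - c * mpderiv i d) * (b * b)"
    by (rule quotient_rule_respects)
qed

lemma rat_deriv_Fract:
  "b \<noteq> 0 \<Longrightarrow> rat_deriv i (Fraction_Field.Fract a b) = Fraction_Field.Fract (mpderiv i a * b - a * mpderiv i b) (b * b)"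
  by (simp add: Fraction_Field.Fract.abs_eq rat_deriv.abs_eq eq_onp_def fractrel_def)

definition max_ideal :: "'n::finite mpoly set" where
  "max_ideal = {\<Sum>i\<in>UNIV. q i * Var i | q. True}"

definition prime_ideal :: "'a::comm_ring_1 set \<Rightarrow> bool" where
  "prime_ideal P \<longleftrightarrow> 0 \<in> P \<and> (\<forall>p\<in>P. \<forall>q\<in>P. p + q \<in> P) \<and> (\<forall>a. \<forall>p\<in>P. a * p \<in> P) \<and>
     1 \<notin> P \<and> (\<forall>a b. a * b \<in> P \<longrightarrow> a \<in> P \<or> b \<in> P)"

text \<open>The points of the scheme \<open>\<bbbA>\<^sup>n\<close> at which \<open>f\<close> is not smooth, i.e. \<open>df\<close> vanishes.\<close>

definition critical_points :: "'n mpoly \<Rightarrow> 'n mpoly set set" where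
  "critical_points f = {P. prime_ideal P \<and> (\<forall>i. mpderiv i f \<in> P)}"

definition Qm :: "'n::{finite,linorder} ratfun set" where
  "Qm = {Fraction_Field.Fract a b | a b. b \<notin> max_ideal}"

definition loc_at :: "('i \<Rightarrow> 'n mpoly) \<Rightarrow> 'i set \<Rightarrow> 'n::{finite,linorder} ratfun set" where
  "loc_at s A = {a / emb (\<Prod>i\<in>A. s i) ^ k | a k. a \<in> Qm}"

section \<open>Exterior algebras\<close>

text \<open>
  An element of the exterior algebra on ordered generators \<open>'g\<close> is its family of coefficients
  with respect to the basis \<open>g\<^sub>1 \<and> \<dots> \<and> g\<^sub>k\<close>, \<open>g\<^sub>1 < \<dots> < g\<^sub>k\<close>. The generators \<open>\<alpha>\<^sub>i\<close> and \<open>dx\<^sub>j\<close> of the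
  Cech-de Rham complexes are \<open>Inl i\<close> and \<open>Inr j\<close>; the \<open>\<alpha>\<close>'s precede the \<open>dx\<close>'s.
\<close>

instantiation sum :: (linorder, linorder) linorder
begin

definition less_eq_sum :: "'a + 'b \<Rightarrow> 'a + 'b \<Rightarrow> bool" where
  "x \<le> y \<longleftrightarrow> (case (x, y) of (Inl a, Inl b) \<Rightarrow> a \<le> b | (Inl a, Inr b) \<Rightarrow> True
     | (Inr a, Inl b) \<Rightarrow> False | (Inr a, Inr b) \<Rightarrow> a \<le> b)"

definition less_sum :: "'a + 'b \<Rightarrow> 'a + 'b \<Rightarrow> bool" where
  "x < y \<longleftrightarrow> x \<le> y \<and> \<not> y \<le> (x :: 'a + 'b)"

instance
  by standard (auto simp: less_eq_sum_def less_sum_def split: sum.splits)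

end

definition wedge :: "('g::{finite,linorder} set \<Rightarrow> 'a::comm_ring_1) \<Rightarrow> ('g set \<Rightarrow> 'a) \<Rightarrow> 'g set \<Rightarrow> 'a"
    (infixr \<open>\<^bold>\<and>\<close> 75) where
  "(\<omega> \<^bold>\<and> \<eta>) S = (\<Sum>A\<in>Pow S. (- 1) ^ card {(a, b). a \<in> A \<and> b \<in> S - A \<and> b < a} * \<omega> A * \<eta> (S - A))"

definition gen :: "'g \<Rightarrow> 'g set \<Rightarrow> 'a::zero_neq_one" where
  "gen g S = (if S = {g} then 1 else 0)"

definition top_form :: "'a::zero \<Rightarrow> 'g set \<Rightarrow> 'a" where
  "top_form a S = (if S = UNIV then a else 0)"

definition restr :: "('g \<Rightarrow> 'h) \<Rightarrow> ('h set \<Rightarrow> 'a) \<Rightarrow> 'g set \<Rightarrow> 'a" where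
  "restr e \<omega> S = \<omega> (e ` S)"

definition extend :: "('g \<Rightarrow> 'h) \<Rightarrow> ('g set \<Rightarrow> 'a::zero) \<Rightarrow> 'h set \<Rightarrow> 'a" where
  "extend e \<omega> T = (if T \<subseteq> range e then \<omega> (e -` T) else 0)"

text \<open>
  For an order embedding \<open>e\<close> of generators, \<open>extend e\<close> is the induced inclusion of exterior
  algebras, and \<open>restr e\<close> is the algebra retraction that kills the generators outside the
  range of \<open>e\<close>.
\<close>

section \<open>Complexes and their cohomology\<close>

type_synonym 'a cplx = "(nat \<Rightarrow> 'a set) \<times> ('a \<Rightarrow> 'a)"

definition cocycles :: "'a::ab_group_add cplx \<Rightarrow> nat \<Rightarrow> 'a set" where
  "cocycles C k = {z \<in> fst C k. snd C z = 0}"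

definition coboundaries :: "'a::ab_group_add cplx \<Rightarrow> nat \<Rightarrow> 'a set" where
  "coboundaries C k = (case k of 0 \<Rightarrow> {0} | Suc j \<Rightarrow> snd C ` fst C j)"

definition cohomologous :: "'a::ab_group_add cplx \<Rightarrow> nat \<Rightarrow> 'a rel" where
  "cohomologous C k =
     {(z, w). z \<in> cocycles C k \<and> w \<in> cocycles C k \<and> z - w \<in> coboundaries C k}"

definition cohomology :: "'a::ab_group_add cplx \<Rightarrow> nat \<Rightarrow> 'a set set" where
  "cohomology C k = cocycles C k // cohomologous C k"

definition cls :: "'a::ab_group_add cplx \<Rightarrow> nat \<Rightarrow> 'a \<Rightarrow> 'a set" where
  "cls C k z = cohomologous C k `` {z}"

definition hmap :: "'b::ab_group_add cplx \<Rightarrow> nat \<Rightarrow> ('a \<Rightarrow> 'b) \<Rightarrow> 'a set \<Rightarrow> 'b set" where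
  "hmap D k \<phi> c = (\<Union>z\<in>c. cls D k (\<phi> z))"

section \<open>Twisted de Rham and Cech-de Rham complexes\<close>

text \<open>
  The degree is the number of generators (form degree plus Cech degree); \<open>u = fps_X\<close> does not
  contribute, so that \<open>d\<phi> \<and> _ + u d\<close> has degree one. The map \<open>\<iota>\<close> tells which generators are the \<open>dx\<^sub>j\<close>.
\<close>

definition twisted_d :: "('n \<Rightarrow> 'g) \<Rightarrow> 'n mpoly \<Rightarrow>
    ('g::{finite,linorder} set \<Rightarrow> 'n::{finite,linorder} ratfun fps) \<Rightarrow> 'g set \<Rightarrow> 'n ratfun fps" where
  "twisted_d \<iota> \<phi> \<omega> = (\<Sum>j\<in>UNIV. gen (\<iota> j) \<^bold>\<and>
     (\<lambda>S. fps_const (emb (mpderiv j \<phi>)) * \<omega> S + fps_X * Abs_fps (\<lambda>k. rat_deriv j (fps_nth (\<omega> S) k))))"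

definition deRham :: "'n ratfun set \<Rightarrow> 'n mpoly \<Rightarrow>
    ('n::{finite,linorder} set \<Rightarrow> 'n ratfun fps) cplx" where
  "deRham R \<phi> =
     (\<lambda>k. {\<omega>. (\<forall>S j. fps_nth (\<omega> S) j \<in> R) \<and> (\<forall>S. \<omega> S \<noteq> 0 \<longrightarrow> card S = k)}, twisted_d id \<phi>)"

definition cech :: "('i \<Rightarrow> 'n mpoly) \<Rightarrow> 'n mpoly \<Rightarrow>
    (('i::{finite,linorder} + 'n::{finite,linorder}) set \<Rightarrow> 'n ratfun fps) cplx" where
  "cech s \<phi> =
     (\<lambda>k. {\<omega>. (\<forall>A B j. fps_nth (\<omega> (A <+> B)) j \<in> loc_at s A) \<and> (\<forall>S. \<omega> S \<noteq> 0 \<longrightarrow> card S = k)},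
      \<lambda>\<omega>. twisted_d Inr \<phi> \<omega> + (\<Sum>i\<in>UNIV. gen (Inl i) \<^bold>\<and> \<omega>))"

text \<open>
  In these terms \<open>cohomology (cech s \<phi>) k\<close> is the Cech model, for the family \<open>s\<close>, of the \<open>k\<close>-th local
  hypercohomology of \<open>(\<Omega>[[u]], d\<phi> + u d)\<close> over the local ring, and \<open>H_poly (- f)\<close> is the
  module \<open>H\<^sub>f\<close> attached to \<open>f\<close>.
\<close>

abbreviation H_poly :: "'n mpoly \<Rightarrow> ('n::{finite,linorder} set \<Rightarrow> 'n ratfun fps) set set" where
  "H_poly \<phi> \<equiv> cohomology (deRham (range emb) \<phi>) CARD('n)"

abbreviation H_loc :: "'n mpoly \<Rightarrow> ('n::{finite,linorder} set \<Rightarrow> 'n ratfun fps) set set" where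
  "H_loc \<phi> \<equiv> cohomology (deRham Qm \<phi>) CARD('n)"

abbreviation H_supp :: "('i \<Rightarrow> 'n mpoly) \<Rightarrow> 'n mpoly \<Rightarrow>
    (('i::{finite,linorder} + 'n::{finite,linorder}) set \<Rightarrow> 'n ratfun fps) set set" where
  "H_supp s \<phi> \<equiv> cohomology (cech s \<phi>) CARD('n)"

definition grad :: "'n mpoly \<Rightarrow> 'n \<Rightarrow> 'n mpoly" where
  "grad f i = mpderiv i f"

definition cls_poly :: "'n mpoly \<Rightarrow> ('n::{finite,linorder} set \<Rightarrow> 'n ratfun fps) \<Rightarrow>
    ('n set \<Rightarrow> 'n ratfun fps) set" where
  "cls_poly \<phi> \<omega> = cls (deRham (range emb) \<phi>) CARD('n) \<omega>"

section \<open>The maps of the composition\<close>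

definition conj_form :: "('n::{finite,linorder} set \<Rightarrow> 'n ratfun fps) \<Rightarrow> 'n set \<Rightarrow> 'n ratfun fps" where
  "conj_form \<omega> S = (- 1) ^ CARD('n) * (\<omega> S oo (- fps_X))"

definition conj_map :: "'n mpoly \<Rightarrow> ('n::{finite,linorder} set \<Rightarrow> 'n ratfun fps) set \<Rightarrow>
    ('n set \<Rightarrow> 'n ratfun fps) set" where
  "conj_map f = hmap (deRham (range emb) f) CARD('n) conj_form"

definition localize_map :: "'n mpoly \<Rightarrow> ('n::{finite,linorder} set \<Rightarrow> 'n ratfun fps) set \<Rightarrow>
    ('n set \<Rightarrow> 'n ratfun fps) set" where
  "localize_map \<phi> = hmap (deRham Qm \<phi>) CARD('n) (\<lambda>\<omega>. \<omega>)"

definition can_map :: "'n mpoly \<Rightarrow>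
    (('i::{finite,linorder} + 'n::{finite,linorder}) set \<Rightarrow> 'n ratfun fps) set \<Rightarrow>
    ('n set \<Rightarrow> 'n ratfun fps) set" where
  "can_map \<phi> = hmap (deRham Qm \<phi>) CARD('n) (restr Inr)"

text \<open>
  The Kuenneth product. The tensor product of the Cech complexes of \<open>s\<close> and \<open>t\<close> is the Cech
  complex of the concatenated family \<open>case_sum s t\<close>, and the canonical product
  \<open>R\<Gamma> M \<otimes> R\<Gamma> N \<rightarrow> R\<Gamma> (M \<otimes> N)\<close> is the identification of these two complexes, \<open>R\<Gamma> (M \<otimes> N)\<close> being
  computed with the concatenated family. Since the \<open>\<alpha>\<close>'s anticommute with the \<open>dx\<close>'s, the product in
  the exterior algebra also carries the Koszul sign. For \<open>s = t\<close> one must not identify the two copies of the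
  \<open>\<alpha>\<close>'s and multiply in one exterior algebra: left multiplication by \<open>\<Sum> \<alpha>\<^sub>i\<close> is not a derivation, so
  this would not be a chain map.
\<close>

definition kun_wedge :: "('i \<Rightarrow> 'n mpoly) \<Rightarrow> ('j \<Rightarrow> 'n mpoly) \<Rightarrow>
    (('i + 'n) set \<Rightarrow> 'n ratfun fps) set \<Rightarrow> (('j + 'n) set \<Rightarrow> 'n ratfun fps) set \<Rightarrow>
    ((('i::{finite,linorder} + 'j::{finite,linorder}) + 'n::{finite,linorder}) set \<Rightarrow> 'n ratfun fps) set"
  where
  "kun_wedge s t c c' = (\<Union>z\<in>c. \<Union>w\<in>c'. cls (cech (case_sum s t) 0) (2 * CARD('n))
     (extend (map_sum Inl id) z \<^bold>\<and> extend (map_sum Inr id) w))"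

text \<open>
  The canonical isomorphism between the Cech models for two families \<open>s\<close> and \<open>t\<close>: both restrictions
  from the Cech complex of the concatenated family are quasi-isomorphisms.
\<close>

definition change_cech :: "('i \<Rightarrow> 'n mpoly) \<Rightarrow> ('j \<Rightarrow> 'n mpoly) \<Rightarrow>
    (('i::{finite,linorder} + 'n::{finite,linorder}) set \<Rightarrow> 'n ratfun fps) set \<Rightarrow>
    (('j::{finite,linorder} + 'n) set \<Rightarrow> 'n ratfun fps) set" where
  "change_cech s t c = hmap (cech t 0) (2 * CARD('n)) (restr (map_sum Inr id))
     (inv_into (cohomology (cech (case_sum s t) 0) (2 * CARD('n)))
        (hmap (cech s 0) (2 * CARD('n)) (restr (map_sum Inl id))) c)"

text \<open>
  Grothendieck's residue of the class of \<open>c \<alpha>\<^sub>1 \<dots> \<alpha>\<^sub>n dx\<^sub>1 \<dots> dx\<^sub>n\<close> in the Cech model for \<open>x\<^sub>1, \<dots>, x\<^sub>n\<close>: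
  modulo Cech coboundaries \<open>c\<close> is a linear combination of the \<open>1 / x\<^sup>a\<close> with all \<open>a\<^sub>i \<ge> 1\<close>.
\<close>

definition res_G :: "'n::{finite,linorder} ratfun \<Rightarrow> complex" where
  "res_G c = (THE r. \<exists>P :: 'n mpoly. (\<forall>a\<in>Poly_Mapping.keys P. \<forall>i. 1 \<le> Poly_Mapping.lookup a i) \<and>
     c - (\<Sum>a\<in>Poly_Mapping.keys P. cst (Poly_Mapping.lookup P a) / emb (Poly_Mapping.single a 1))
       \<in> {\<Sum>i\<in>UNIV. g i | g. \<forall>i. g i \<in> loc_at Var (UNIV - {i})} \<and>
     r = (\<Sum>a\<in>Poly_Mapping.keys P. Poly_Mapping.lookup P a *
           (if \<forall>i. Poly_Mapping.lookup a i = 1 then 1 else 0)))"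

definition res_vars :: "(('n::{finite,linorder} + 'n) set \<Rightarrow> 'n ratfun fps) set \<Rightarrow> complex fps" where
  "res_vars c = the_elem ((\<lambda>z. Abs_fps (\<lambda>k. res_G (fps_nth (z UNIV) k))) ` c)"

definition res :: "('i \<Rightarrow> 'n mpoly) \<Rightarrow>
    (('i::{finite,linorder} + 'n::{finite,linorder}) set \<Rightarrow> 'n ratfun fps) set \<Rightarrow> complex fps" where
  "res s c = res_vars (change_cech s Var c)"

definition pairing :: "'n mpoly \<Rightarrow> ('n::{finite,linorder} set \<Rightarrow> 'n ratfun fps) set \<Rightarrow>
    ('n set \<Rightarrow> 'n ratfun fps) set \<Rightarrow> complex fps" where
  "pairing f \<xi> \<eta> = res (case_sum (grad f) (grad f)) (kun_wedge (grad f) (grad f)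
     (inv_into (H_supp (grad f) (- f)) (can_map (- f)) (localize_map (- f) \<xi>))
     (inv_into (H_supp (grad f) f) (can_map f) (localize_map f (conj_map f \<eta>))))"

section \<open>The explicit formula\<close>

definition b_coeff :: "nat \<Rightarrow> 'n mpoly \<Rightarrow> 'n mpoly \<Rightarrow> 'n::{finite,linorder} ratfun" where
  "b_coeff k f h = (- 1) ^ CARD('n) * (\<Sum>a\<in>{a :: 'n \<Rightarrow> nat. (\<Sum>i\<in>UNIV. a i) = k}.
     foldr (\<lambda>i q. ((\<lambda>r. rat_deriv i r / emb (grad f i)) ^^ a i) (q / emb (grad f i)))
       (sorted_list_of_set UNIV) (emb h))"

text \<open>The residue of \<open>c \<alpha>\<^sub>1 \<dots> \<alpha>\<^sub>n dx\<^sub>1 \<dots> dx\<^sub>n\<close>, read in the Cech model for the partial derivatives of \<open>f\<close>.\<close>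

definition res_top :: "'n mpoly \<Rightarrow> 'n::{finite,linorder} ratfun \<Rightarrow> complex fps" where
  "res_top f c = res (grad f) (cls (cech (grad f) 0) (2 * CARD('n)) (top_form (fps_const c)))"

definition poly_form :: "'n mpoly \<Rightarrow> 'n::{finite,linorder} set \<Rightarrow> 'n ratfun fps" where
  "poly_form h = top_form (fps_const (emb h))"

definition scale_form :: "complex fps \<Rightarrow> ('n set \<Rightarrow> 'n ratfun fps) \<Rightarrow> 'n::linorder set \<Rightarrow> 'n ratfun fps" where
  "scale_form p \<omega> S = Abs_fps (\<lambda>k. cst (fps_nth p k)) * \<omega> S"

end

(*
  Everything rests on the Jacobian ideal (f_1, ..., f_n) being primary to the maximal ideal m.

  All differentials have the form delta0 + u delta1, and exactness of delta0 implies exactness of the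
  sum, order by order in u. Contraction with sum_i e_i d/dx_i is a homotopy for df between
  sum_i e_i f_i and 0. Writing 1 = c b + sum_i e_i f_i for a common denominator b, this shows that
  localization at m is bijective; with e_i = 1/f_i on the part of the Cech complex where f_i is
  invertible it shows that the canonical map from local cohomology is bijective; with the same
  homotopy in the alpha-directions it shows that enlarging a Cech family inside m does not change
  local cohomology.

  The operators D_i = -f_i + u d/dx_i commute, so the expansion of prod_i (dx_i + alpha_i D_i^-1)
  applied to h is a cocycle that lifts h dx_1 ... dx_n, and its alpha_1 ... alpha_n component is
  sum_k b_k(h) u^k. The product of two such cocycles lives in top degree 2n of the doubled Cech
  complex; restricting it to the first or to the second copy of the alphas leaves a single
  coefficient, and the two restrictions give the two halves of the formula.
*)
theory Submission
  imports Defs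
begin

section \<open>Primes and radicals: the source of all nilpotency and comaximality statements\<close>

section \<open>Ideals and nilpotency\<close>

text \<open>Critical points are prime ideals, so an element of every prime over the Jacobian ideal
  has a power in it by Zorn's lemma alone, without the Nullstellensatz. All differentials are sums
  of g wedge (lam_g + u del_g) over the generators g: for dx_j the pair is (\<phi>_j, d/dx_j), for
  \<alpha>_i it is (1, 0). This puts \<alpha>'s and dx's on the same footing, so one comparison
  theorem serves both the canonical map and the change of Cech family. The pole orders of the
  coefficients of a series in u need not be bounded, so a series may have no common denominator.
  Passing to single orders in u leaves finitely many coefficients to clear at a time, and the
  homotopy may depend on them. The homotopies divide by functions that are invertible only on terms
  containing a given generator; exactness is therefore assembled by induction over these generators.
  Each restriction of the product cocycle already yields the whole pairing. The formula is the mean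
  of two equal series, and no symmetry of the pairing has to be proved.\<close>

definition ideal :: "'a::comm_ring_1 set \<Rightarrow> bool" where
  "ideal I \<longleftrightarrow> 0 \<in> I \<and> (\<forall>p\<in>I. \<forall>q\<in>I. p + q \<in> I) \<and> (\<forall>a. \<forall>p\<in>I. a * p \<in> I)"

lemma ideal_sum:
  assumes "ideal I" "\<And>i. i \<in> A \<Longrightarrow> g i \<in> I"
  shows "(\<Sum>i\<in>A. g i) \<in> I"
  using assms(2)
  by (induction A rule: infinite_finite_induct) (use assms(1) in \<open>auto simp: ideal_def\<close>)

lemma ideal_span:
  fixes s :: "'i::finite \<Rightarrow> 'a::comm_ring_1"
  shows "ideal {\<Sum>i\<in>UNIV. q i * s i | q. True}"
proof -
  have 0: "\<exists>q. 0 = (\<Sum>i\<in>UNIV. q i * s i)"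
    by (rule exI[of _ "\<lambda>_. 0"]) simp
  have 1: "\<exists>q''. (\<Sum>i\<in>UNIV. q i * s i) + (\<Sum>i\<in>UNIV. q' i * s i) = (\<Sum>i\<in>UNIV. q'' i * s i)" for q q'
    by (rule exI[of _ "\<lambda>i. q i + q' i"]) (simp add: algebra_simps sum.distrib)
  have 2: "\<exists>q'. a * (\<Sum>i\<in>UNIV. q i * s i) = (\<Sum>i\<in>UNIV. q' i * s i)" for a q
    by (rule exI[of _ "\<lambda>i. a * q i"]) (simp add: algebra_simps sum_distrib_left)
  show ?thesis using 0 1 2 by (auto simp: ideal_def)
qed

lemma mem_span:
  fixes s :: "'i::finite \<Rightarrow> 'a::comm_ring_1"
  shows "s i \<in> {\<Sum>i\<in>UNIV. q i * s i | q. True}"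
proof -
  have "s i = (\<Sum>j\<in>UNIV. (if j = i then 1 else 0) * s j)"
    by (simp add: if_distrib[of "\<lambda>x. x * _"] cong: if_cong)
  then show ?thesis by (auto intro!: exI[of _ "\<lambda>j. if j = i then 1 else 0"])
qed

lemma ideal_adjoin:
  assumes "ideal I"
  shows "ideal {p + c * x | p c. p \<in> I}"
proof -
  have 0: "\<exists>p c. 0 = p + c * x \<and> p \<in> I"
    using assms by (intro exI[of _ 0]) (auto simp: ideal_def)
  have 1: "\<exists>p'' c''. p + c * x + (p' + c' * x) = p'' + c'' * x \<and> p'' \<in> I"
    if "p \<in> I" "p' \<in> I" for p p' c c'
    using that assms
    by (intro exI[of _ "p + p'"] exI[of _ "c + c'"]) (auto simp: ideal_def algebra_simps)
  have 2: "\<exists>p' c'. a * (p + c * x) = p' + c' * x \<and> p' \<in> I" if "p \<in> I" for a p c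
    using that assms by (intro exI[of _ "a * p"] exI[of _ "a * c"]) (auto simp: ideal_def algebra_simps)
  show ?thesis unfolding ideal_def using 0 1 2 by auto
qed

text \<open>An ideal maximal among those that contain \<open>I\<close> and miss all powers of
  \<open>a\<close> is prime: enlarging it by \<open>x\<close> or by \<open>y\<close> captures a
  power of \<open>a\<close>, and the product of the two powers would fall into the ideal if
  \<open>x * y\<close> did.\<close>

lemma prime_avoiding_powers:
  fixes I :: "'a::comm_ring_1 set"
  assumes "ideal I" "\<And>k. a ^ k \<notin> I"
  obtains P where "prime_ideal P" "I \<subseteq> P" "a \<notin> P"
proof -
  define F where "F = {J. ideal J \<and> I \<subseteq> J \<and> (\<forall>k. a ^ k \<notin> J)}"
  have "\<exists>M\<in>F. \<forall>X\<in>F. M \<subseteq> X \<longrightarrow> X = M"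
  proof (rule subset_Zorn_nonempty)
    show "F \<noteq> {}" using assms by (auto simp: F_def)
    fix C assume C: "C \<noteq> {}" "subset.chain F C"
    then have CF: "C \<subseteq> F" and tot: "\<And>X Y. X \<in> C \<Longrightarrow> Y \<in> C \<Longrightarrow> X \<subseteq> Y \<or> Y \<subseteq> X"
      by (auto simp: subset_chain_def)
    have "p + q \<in> \<Union>C" if h: "p \<in> X" "q \<in> Y" "X \<in> C" "Y \<in> C" for p q X Y
    proof -
      obtain Z where "Z \<in> C" "p \<in> Z" "q \<in> Z" using tot[OF h(3,4)] h by blast
      moreover have "ideal Z" using CF \<open>Z \<in> C\<close> by (auto simp: F_def)
      ultimately show ?thesis unfolding ideal_def by blast
    qed
    moreover have "0 \<in> X" "p \<in> X \<Longrightarrow> r * p \<in> X" "I \<subseteq> X" "a ^ k \<notin> X" if "X \<in> C" for X r p k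
      using CF that by (auto simp: F_def ideal_def)
    ultimately have "ideal (\<Union>C) \<and> I \<subseteq> \<Union>C \<and> (\<forall>k. a ^ k \<notin> \<Union>C)"
      using C(1) unfolding ideal_def by (intro conjI ballI allI) (meson UnionE UnionI ex_in_conv Sup_upper2)+
    then show "\<Union>C \<in> F" unfolding F_def mem_Collect_eq .
  qed
  then obtain M where M: "M \<in> F" and max: "\<And>X. X \<in> F \<Longrightarrow> M \<subseteq> X \<Longrightarrow> X = M" by blast
  have idM: "ideal M" and IM: "I \<subseteq> M" and aM: "\<And>k. a ^ k \<notin> M" using M by (auto simp: F_def)
  have pow: "\<exists>k p c. a ^ k = p + c * x \<and> p \<in> M" if "x \<notin> M" for x
  proof (rule ccontr)
    assume no: "\<not> ?thesis"
    let ?J = "{p + c * x | p c. p \<in> M}"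
    have sub: "M \<subseteq> ?J" by (force intro: exI[of _ 0])
    have "?J \<in> F" using no ideal_adjoin[OF idM] sub IM by (auto simp: F_def)
    then have "?J = M" using max sub by blast
    moreover have "x \<in> ?J" using idM by (force simp: ideal_def intro: exI[of _ 0] exI[of _ 1])
    ultimately show False using that by blast
  qed
  have "x \<in> M \<or> y \<in> M" if xy: "x * y \<in> M" for x y
  proof (rule ccontr)
    assume "\<not> ?thesis"
    then obtain k p c l q d where *: "a ^ k = p + c * x" "p \<in> M" "a ^ l = q + d * y" "q \<in> M"
      using pow[of x] pow[of y] by blast
    have "a ^ (k + l) = (q + d * y) * p + ((c * x) * q + (c * d) * (x * y))"
      by (simp add: power_add * algebra_simps)
    also have "\<dots> \<in> M" using idM * xy by (simp add: ideal_def)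
    finally show False using aM by blast
  qed
  moreover have "1 \<notin> M" using aM[of 0] by simp
  ultimately have "prime_ideal M" using idM by (auto simp: prime_ideal_def ideal_def)
  moreover have "a \<notin> M" using aM[of 1] by simp
  ultimately show ?thesis using that IM by blast
qed

text \<open>Contrapositive of prime avoidance: if every power of \<open>a\<close> misses the span,
  some prime contains all \<open>s i\<close> but not \<open>a\<close>.\<close>

lemma power_in_span:
  fixes s :: "'i::finite \<Rightarrow> 'a::comm_ring_1"
  assumes "\<And>P. prime_ideal P \<Longrightarrow> (\<And>i. s i \<in> P) \<Longrightarrow> a \<in> P"
  obtains k q where "a ^ k = (\<Sum>i\<in>UNIV. q i * s i)"
proof (rule ccontr)
  assume no: "\<not> thesis"
  then have "a ^ k \<notin> {\<Sum>i\<in>UNIV. q i * s i | q. True}" for k using that by blast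
  then obtain P where "prime_ideal P" "{\<Sum>i\<in>UNIV. q i * s i | q. True} \<subseteq> P" "a \<notin> P"
    by (rule prime_avoiding_powers[OF ideal_span[of s]])
  then show False using assms mem_span[of s] by blast
qed

lemma prime_ideal_power: "prime_ideal P \<Longrightarrow> x ^ k \<in> P \<Longrightarrow> x \<in> P"
proof (induction k)
  case (Suc k)
  then have "x \<in> P \<or> x ^ k \<in> P" unfolding prime_ideal_def power_Suc by blast
  then show ?case using Suc by blast
qed (auto simp: prime_ideal_def)

text \<open>The family is enlarged by \<open>b\<close>, placed at the index \<open>None\<close>. A
  prime over \<open>b\<close> and the \<open>s i ^ k\<close> would contain all \<open>s i\<close>,
  so there is none, and even 1 has a power in the span.\<close>

lemma comaximal:
  fixes s :: "'i::finite \<Rightarrow> 'a::comm_ring_1"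
  assumes "\<And>P. prime_ideal P \<Longrightarrow> (\<And>i. s i \<in> P) \<Longrightarrow> b \<notin> P"
  obtains c q where "1 = c * b + (\<Sum>i\<in>UNIV. q i * s i ^ k)"
proof -
  let ?t = "case_option b (\<lambda>i. s i ^ k)"
  have "(1::'a) \<in> P" if P: "prime_ideal P" and t: "\<And>i. ?t i \<in> P" for P
  proof -
    have "s i \<in> P" for i using prime_ideal_power[OF P, of "s i" k] t[of "Some i"] by simp
    then have "b \<notin> P" using assms P by blast
    then show ?thesis using t[of None] by simp
  qed
  then obtain m q where "1 ^ m = (\<Sum>i\<in>UNIV. q i * ?t i)" by (rule power_in_span)
  also have "\<dots> = q None * b + (\<Sum>i\<in>UNIV. q (Some i) * s i ^ k)"
    by (simp add: UNIV_option_conv sum.reindex)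
  finally show ?thesis using that[of "q None" "\<lambda>i. q (Some i)"] by simp
qed

section \<open>The derivations of the field of rational functions\<close>

abbreviation lookup0 :: "'n mpoly \<Rightarrow> complex" where
  "lookup0 p \<equiv> Poly_Mapping.lookup p 0"

lemma emb_0 [simp]: "emb 0 = 0" by (simp add: Zero_fract_def)
lemma emb_1 [simp]: "emb 1 = 1" by (simp add: One_fract_def)
lemma emb_eq_iff [simp]: "emb p = emb q \<longleftrightarrow> p = q" by (simp add: eq_fract)
lemma emb_eq_0_iff [simp]: "emb p = 0 \<longleftrightarrow> p = 0"
  by (metis emb_0 emb_eq_iff)
lemma Fract_conv_divide: "Fraction_Field.Fract a b = emb a / emb b" by simp
lemma emb_add [simp]: "emb (p + q) = emb p + emb q" by simp
lemma emb_diff [simp]: "emb (p - q) = emb p - emb q" by simp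
lemma emb_mult [simp]: "emb (p * q) = emb p * emb q" by simp
lemma emb_minus [simp]: "emb (- p) = - emb p" by simp

text \<open>Without these simp rules \<^term>\<open>emb\<close> is opaque to the simplifier, and field arithmetic is done with \<open>/\<close>.\<close>

declare add_fract [simp del] minus_fract [simp del] diff_fract [simp del] mult_fract [simp del]
  inverse_fract [simp del] divide_fract [simp del]

lemma emb_power [simp]: "emb (p ^ k) = emb p ^ k"
  by (induction k) simp_all
lemma emb_sum [simp]: "emb (sum g A) = (\<Sum>i\<in>A. emb (g i))"
  by (induction A rule: infinite_finite_induct) simp_all
lemma ratfun_cases:
  fixes x :: "'n::linorder ratfun"
  obtains a b where "x = emb a / emb b" "b \<noteq> 0"
  by (rule Fract_cases[of x]) (metis Fract_conv_divide)

lemma mpderiv_1 [simp]: "mpderiv i 1 = 0"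
  using mpderiv_mult[of i 1 1] by simp

lemma mpderiv_minus: "mpderiv i (- p) = - mpderiv i p"
  using mpderiv_add[of i p "- p"] by (simp add: eq_neg_iff_add_eq_0 add.commute)

lemma rat_deriv_emb: "rat_deriv i (emb p) = emb (mpderiv i p)"
  by (simp add: rat_deriv_Fract)

lemma rat_deriv_quot:
  "b \<noteq> 0 \<Longrightarrow> rat_deriv i (emb a / emb b) =
     (emb (mpderiv i a) * emb b - emb a * emb (mpderiv i b)) / (emb b * emb b)"
  using rat_deriv_Fract[of b i a] by (simp add: Fract_conv_divide[of _ b] Fract_conv_divide[of _ "b * b"])

lemma rat_deriv_add: "rat_deriv i (x + y) = rat_deriv i x + rat_deriv i y"
proof -
  obtain a b where x: "x = emb a / emb b" "b \<noteq> 0" by (rule ratfun_cases)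
  obtain c d where y: "y = emb c / emb d" "d \<noteq> 0" by (rule ratfun_cases)
  have bd: "b * d \<noteq> 0" using x(2) y(2) by simp
  have s: "x + y = emb (a * d + c * b) / emb (b * d)"
    using x(2) y(2) by (simp add: x(1) y(1) add_frac_eq)
  show ?thesis
    using x(2) y(2) unfolding s rat_deriv_quot[OF bd] unfolding x(1) y(1)
    by (simp add: rat_deriv_quot mpderiv_add mpderiv_mult field_simps)
qed

lemma rat_deriv_mult: "rat_deriv i (x * y) = rat_deriv i x * y + x * rat_deriv i y"
proof -
  obtain a b where x: "x = emb a / emb b" "b \<noteq> 0" by (rule ratfun_cases)
  obtain c d where y: "y = emb c / emb d" "d \<noteq> 0" by (rule ratfun_cases)
  have bd: "b * d \<noteq> 0" using x(2) y(2) by simp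
  have s: "x * y = emb (a * c) / emb (b * d)"
    using x(2) y(2) by (simp add: x(1) y(1))
  show ?thesis
    using x(2) y(2) unfolding s rat_deriv_quot[OF bd] unfolding x(1) y(1)
    by (simp add: rat_deriv_quot mpderiv_add mpderiv_mult field_simps)
qed

lemma rat_deriv_0 [simp]: "rat_deriv i 0 = 0"
  using rat_deriv_add[of i 0 0] by (simp only: add_0_right add_cancel_right_right)

lemma rat_deriv_minus: "rat_deriv i (- x) = - rat_deriv i x"
  using rat_deriv_add[of i x "- x"] by (simp add: eq_neg_iff_add_eq_0 add.commute)

lemma rat_deriv_sum: "rat_deriv i (sum g A) = (\<Sum>x\<in>A. rat_deriv i (g x))"
  by (induction A rule: infinite_finite_induct) (simp_all add: rat_deriv_add)

lemma rat_deriv_cst [simp]: "rat_deriv i (cst c) = 0"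
  unfolding rat_deriv_emb by (simp add: mpderiv_single)

lemma rat_deriv_1 [simp]: "rat_deriv i 1 = 0"
  using rat_deriv_emb[of i 1] by simp

lemma rat_deriv_divide:
  assumes "y \<noteq> 0"
  shows "rat_deriv i (x / y) = (rat_deriv i x * y - x * rat_deriv i y) / (y * y)"
proof -
  have "rat_deriv i x = rat_deriv i (x / y) * y + (x / y) * rat_deriv i y"
    using assms rat_deriv_mult[of i "x / y" y] by simp
  then show ?thesis using assms by (simp add: field_simps)
qed

lemma mpderiv_commute: "mpderiv i (mpderiv j p) = mpderiv j (mpderiv i p)"
proof -
  have "mpderiv i (mpderiv j (Poly_Mapping.single m c)) = mpderiv j (mpderiv i (Poly_Mapping.single m c))" for m c
  proof (cases "i = j")
    case False
    then show ?thesis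
      by (simp add: mpderiv_single lookup_minus lookup_single diff_diff_eq add.commute mult.left_commute)
  qed simp
  then have "mpderiv i (mpderiv j (\<Sum>m\<in>A. Poly_Mapping.single m (a m))) = mpderiv j (mpderiv i (\<Sum>m\<in>A. Poly_Mapping.single m (a m)))"
    for A a by (simp add: mpderiv_sum)
  then show ?thesis by (metis mpoly_monom_sum)
qed

text \<open>The commutator of two derivations is again a derivation. It vanishes on polynomials,
  hence, by the product rule for \<open>x * emb b\<close>, on quotients.\<close>

lemma rat_deriv_commute: "rat_deriv i (rat_deriv j x) = rat_deriv j (rat_deriv i x)"
proof -
  obtain a b where "x = emb a / emb b" "b \<noteq> 0" by (rule ratfun_cases)
  then have b: "emb b \<noteq> 0" and *: "emb a = x * emb b" by simp_all
  let ?D = "\<lambda>y. rat_deriv i (rat_deriv j y) - rat_deriv j (rat_deriv i y)"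
  have D0: "?D (emb p) = 0" for p by (simp only: rat_deriv_emb mpderiv_commute[of i j]) simp
  have "?D (x * emb b) = ?D x * emb b + x * ?D (emb b)"
    unfolding rat_deriv_mult rat_deriv_add by (simp only: algebra_simps)
  then have "?D x * emb b = 0" unfolding D0 *[symmetric] by simp
  then show ?thesis using b by auto
qed

section \<open>Denominators that do not vanish at the origin, and closure under
  differentiation\<close>

section \<open>The local ring and its localizations\<close>

lemma lookup_times_single_0:
  fixes p :: "'n mpoly"
  shows "lookup0 (p * Var i) = 0"
proof -
  have "lookup0 ((\<Sum>m\<in>A. Poly_Mapping.single m (a m)) * Var i) = 0" for A and a :: "_ \<Rightarrow> complex"
  proof -
    have "m + Poly_Mapping.single i 1 \<noteq> 0" for m :: "'n \<Rightarrow>\<^sub>0 nat"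
      by (metis add_is_0 lookup_add lookup_single_eq lookup_zero zero_neq_one)
    then show ?thesis
      by (simp add: sum_distrib_right lookup_sum mult_single lookup_single when_def)
  qed
  then show ?thesis by (metis mpoly_monom_sum)
qed

text \<open>A monomial other than 1 is divisible by some variable, so only the constant coefficient,
  the value at the origin, obstructs membership.\<close>

lemma mem_max_ideal_iff: "p \<in> max_ideal \<longleftrightarrow> lookup0 p = 0"
  for p :: "'n::finite mpoly"
proof
  assume "p \<in> max_ideal"
  then show "lookup0 p = 0"
    by (auto simp: max_ideal_def lookup_sum lookup_times_single_0 simp del: One_nat_def)
next
  assume p: "lookup0 p = 0"
  let ?I = "max_ideal :: 'n mpoly set"
  have id: "ideal ?I" and V: "\<And>i. Var i \<in> ?I"
    unfolding max_ideal_def by (rule ideal_span, rule mem_span[where s = Var])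
  have "Poly_Mapping.single m (Poly_Mapping.lookup p m) \<in> ?I" if "m \<in> Poly_Mapping.keys p" for m
  proof -
    from p that have "m \<noteq> 0" by (auto simp: in_keys_iff)
    then obtain i where i: "Poly_Mapping.lookup m i \<noteq> 0" by (metis lookup_zero poly_mapping_eqI)
    have "Poly_Mapping.single m (Poly_Mapping.lookup p m) =
        Poly_Mapping.single (m - Poly_Mapping.single i 1) (Poly_Mapping.lookup p m) * Var i"
      using single_minus_shift[of m i "Poly_Mapping.single i 1", OF i]
      by (simp add: mult_single)
    also have "\<dots> \<in> ?I" using id V[of i] by (simp add: ideal_def)
    finally show ?thesis .
  qed
  then have "(\<Sum>m\<in>Poly_Mapping.keys p. Poly_Mapping.single m (Poly_Mapping.lookup p m)) \<in> ?I"
    by (intro ideal_sum[OF id])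
  then show "p \<in> ?I" by (subst mpoly_monom_sum)
qed

text \<open>Evaluation at the origin is multiplicative; hence products of admissible denominators
  are admissible.\<close>

lemma lookup_mult_0: "lookup0 (p * q) = lookup0 p * lookup0 q" for p q :: "'n mpoly"
proof -
  have *: "lookup0 (p * Poly_Mapping.single m c) = lookup0 p * lookup0 (Poly_Mapping.single m c)" for m c and p :: "'n mpoly"
  proof (cases "m = 0")
    case True
    have "p * Poly_Mapping.single 0 c = (\<Sum>m\<in>Poly_Mapping.keys p. Poly_Mapping.single m (Poly_Mapping.lookup p m * c))"
      by (subst mpoly_monom_sum) (simp add: sum_distrib_right mult_single)
    then have "lookup0 (p * Poly_Mapping.single 0 c) = lookup0 p * c"
      by (simp add: lookup_sum lookup_single when_def in_keys_iff)
    then show ?thesis using True by simp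
  next
    case False
    then obtain i where i: "Poly_Mapping.lookup m i \<noteq> 0" by (metis lookup_zero poly_mapping_eqI)
    have "p * Poly_Mapping.single m c = (p * Poly_Mapping.single (m - Poly_Mapping.single i 1) c) * Var i"
      using single_minus_shift[of m i "Poly_Mapping.single i 1", OF i]
      by (simp add: mult_single mult.assoc)
    then show ?thesis using False by (simp only: lookup_times_single_0) (simp add: lookup_single)
  qed
  have "lookup0 (p * (\<Sum>m\<in>A. Poly_Mapping.single m (a m))) = lookup0 p * lookup0 (\<Sum>m\<in>A. Poly_Mapping.single m (a m))"
    for A a by (simp add: sum_distrib_left lookup_sum *)
  then show ?thesis by (metis mpoly_monom_sum)
qed

lemma QmI: "lookup0 b \<noteq> 0 \<Longrightarrow> emb a / emb b \<in> Qm"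
  unfolding Qm_def mem_max_ideal_iff Fract_conv_divide[symmetric] by blast

lemma QmE:
  assumes "x \<in> Qm"
  obtains a b where "x = emb a / emb b" "lookup0 b \<noteq> 0" "b \<noteq> 0"
proof -
  obtain a b where "x = Fraction_Field.Fract a b" "lookup0 b \<noteq> 0"
    using assms unfolding Qm_def mem_max_ideal_iff by blast
  then show ?thesis using that[of a b] Fract_conv_divide[of a b] by (cases "b = 0") simp_all
qed

text \<open>Polynomials, the local ring and its Cech localizations all satisfy this, so their
  complexes can be treated together inside the one field of rational functions.\<close>

locale diff_ring =
  fixes R :: "'n::{finite,linorder} ratfun set"
  assumes emb_mem: "emb p \<in> R"
    and add_mem: "x \<in> R \<Longrightarrow> y \<in> R \<Longrightarrow> x + y \<in> R"
    and mult_mem: "x \<in> R \<Longrightarrow> y \<in> R \<Longrightarrow> x * y \<in> R"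
    and deriv_mem: "x \<in> R \<Longrightarrow> rat_deriv j x \<in> R"
begin

lemma zero_mem: "0 \<in> R" using emb_mem[of 0] by simp
lemma one_mem: "1 \<in> R" using emb_mem[of 1] by simp
lemma minus_mem: "x \<in> R \<Longrightarrow> - x \<in> R"
  using mult_mem[OF emb_mem[of "- 1"], of x] by (simp )
lemma diff_mem: "x \<in> R \<Longrightarrow> y \<in> R \<Longrightarrow> x - y \<in> R"
  using add_mem[of x "- y"] minus_mem[of y] by simp
lemma power_mem: "x \<in> R \<Longrightarrow> x ^ k \<in> R"
  by (induction k) (auto intro: one_mem mult_mem)
lemma sum_mem: "(\<And>i. i \<in> A \<Longrightarrow> g i \<in> R) \<Longrightarrow> (\<Sum>i\<in>A. g i) \<in> R"
  by (induction A rule: infinite_finite_induct) (auto intro: zero_mem add_mem)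

end

lemma diff_ring_poly: "diff_ring (range emb)"
proof
  show "emb p \<in> range emb" for p by blast
  show "x + y \<in> range emb" if "x \<in> range emb" "y \<in> range emb" for x y :: "'a ratfun"
    using that by (auto simp flip: emb_add)
  show "x * y \<in> range emb" if "x \<in> range emb" "y \<in> range emb" for x y :: "'a ratfun"
    using that by (auto simp flip: emb_mult)
  show "rat_deriv j x \<in> range emb" if "x \<in> range emb" for x :: "'a ratfun" and j
    using that by (auto simp only: rat_deriv_emb)
qed

lemma diff_ring_Qm: "diff_ring Qm"
proof
  show "emb p \<in> Qm" for p using QmI[of 1 p] by simp
  show "x + y \<in> Qm" if x: "x \<in> Qm" and y: "y \<in> Qm" for x y :: "'a ratfun"
  proof -
    obtain a b c d where *: "x = emb a / emb b" "lookup0 b \<noteq> 0" "b \<noteq> 0" "y = emb c / emb d" "lookup0 d \<noteq> 0" "d \<noteq> 0"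
      using QmE[OF x] QmE[OF y] by metis
    have "x + y = emb (a * d + c * b) / emb (b * d)"
      using * by (simp add: add_frac_eq)
    then show ?thesis using QmI[of "b * d"] * by (simp only: lookup_mult_0 mult_eq_0_iff) blast
  qed
  show "x * y \<in> Qm" if x: "x \<in> Qm" and y: "y \<in> Qm" for x y :: "'a ratfun"
  proof -
    obtain a b c d where *: "x = emb a / emb b" "lookup0 b \<noteq> 0" "b \<noteq> 0" "y = emb c / emb d" "lookup0 d \<noteq> 0" "d \<noteq> 0"
      using QmE[OF x] QmE[OF y] by metis
    have "x * y = emb (a * c) / emb (b * d)"
      using * by simp
    then show ?thesis using QmI[of "b * d"] * by (simp only: lookup_mult_0 mult_eq_0_iff) blast
  qed
  show "rat_deriv j x \<in> Qm" if x: "x \<in> Qm" for x :: "'a ratfun" and j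
  proof -
    obtain a b where *: "x = emb a / emb b" "lookup0 b \<noteq> 0" "b \<noteq> 0"
      using QmE[OF x] by metis
    have "rat_deriv j x = emb (mpderiv j a * b - a * mpderiv j b) / emb (b * b)"
      using * by (simp add: rat_deriv_quot)
    then show ?thesis using QmI[of "b * b"] * by (simp only: lookup_mult_0 mult_eq_0_iff) blast
  qed
qed

interpretation Qm: diff_ring Qm by (rule diff_ring_Qm)

lemma loc_atI: "x \<in> Qm \<Longrightarrow> x / emb (\<Prod>i\<in>A. s i) ^ k \<in> loc_at s A"
  by (auto simp: loc_at_def)

lemma loc_at_empty [simp]: "loc_at s {} = Qm"
  by (auto simp: loc_at_def)

lemma loc_at_mono:
  fixes s :: "'i::finite \<Rightarrow> 'n::{finite,linorder} mpoly"
  assumes "A \<subseteq> B" and nz: "\<And>i. s i \<noteq> 0"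
  shows "loc_at s A \<subseteq> loc_at s B"
proof
  fix x assume "x \<in> loc_at s A"
  then obtain a k where x: "x = a / emb (\<Prod>i\<in>A. s i) ^ k" "a \<in> Qm" by (auto simp: loc_at_def)
  have "(\<Prod>i\<in>B. s i) = (\<Prod>i\<in>A. s i) * (\<Prod>i\<in>B-A. s i)"
    using assms by (metis finite mult.commute prod.subset_diff)
  then have e: "emb (\<Prod>i\<in>B. s i) = emb (\<Prod>i\<in>A. s i) * emb (\<Prod>i\<in>B-A. s i)" by simp
  have n: "emb (\<Prod>i\<in>B-A. s i) \<noteq> 0" using nz by simp
  have "x = (a * emb (\<Prod>i\<in>B-A. s i) ^ k) / emb (\<Prod>i\<in>B. s i) ^ k"
    unfolding x e power_mult_distrib using n by simp
  also have "\<dots> \<in> loc_at s B" using x by (intro loc_atI Qm.mult_mem Qm.power_mem Qm.emb_mem)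
  finally show "x \<in> loc_at s B" .
qed

text \<open>The exponent works from \<open>k\<close> onwards, so finitely many elements can be
  cleared by a common one.\<close>

lemma loc_at_obtain:
  fixes s :: "'i::finite \<Rightarrow> 'n::{finite,linorder} mpoly"
  assumes "x \<in> loc_at s A" and nz: "\<And>i. s i \<noteq> 0"
  obtains k where "\<And>l. k \<le> l \<Longrightarrow> x * emb (\<Prod>i\<in>A. s i) ^ l \<in> Qm"
proof -
  obtain a k where x: "x = a / emb (\<Prod>i\<in>A. s i) ^ k" "a \<in> Qm" using assms by (auto simp: loc_at_def)
  have "x * emb (\<Prod>i\<in>A. s i) ^ l \<in> Qm" if "k \<le> l" for l
  proof -
    have "emb (\<Prod>i\<in>A. s i) \<noteq> 0" using nz by simp
    then have "x * emb (\<Prod>i\<in>A. s i) ^ l = a * emb (\<Prod>i\<in>A. s i) ^ (l - k)"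
      unfolding x using that by (simp add: power_diff)
    then show ?thesis using x by (simp only: Qm.mult_mem Qm.power_mem Qm.emb_mem)
  qed
  then show ?thesis using that by blast
qed

lemma loc_at_mem_iff:
  fixes s :: "'i::finite \<Rightarrow> 'n::{finite,linorder} mpoly"
  assumes nz: "\<And>i. s i \<noteq> 0"
  shows "x \<in> loc_at s A \<longleftrightarrow> (\<exists>k. x * emb (\<Prod>i\<in>A. s i) ^ k \<in> Qm)"
proof -
  have "x \<in> loc_at s A" if "x * emb (\<Prod>i\<in>A. s i) ^ k \<in> Qm" for k
  proof -
    have "emb (\<Prod>i\<in>A. s i) \<noteq> 0" using nz by simp
    then have "x = (x * emb (\<Prod>i\<in>A. s i) ^ k) / emb (\<Prod>i\<in>A. s i) ^ k" by simp
    then show ?thesis using that loc_atI by metis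
  qed
  moreover have "\<exists>k. x * emb (\<Prod>i\<in>A. s i) ^ k \<in> Qm" if "x \<in> loc_at s A"
    using loc_at_obtain[OF that nz] by blast
  ultimately show ?thesis by blast
qed

lemma diff_ring_loc_at:
  fixes s :: "'i::finite \<Rightarrow> 'n::{finite,linorder} mpoly"
  assumes nz: "\<And>i. s i \<noteq> 0"
  shows "diff_ring (loc_at s A)"
proof
  let ?e = "emb (\<Prod>i\<in>A. s i)"
  have eQ: "?e \<in> Qm" "\<And>k. ?e ^ k \<in> Qm" by (simp_all only: Qm.emb_mem Qm.power_mem)
  note iff = loc_at_mem_iff[of s, OF nz, where A = A]
  show "emb p \<in> loc_at s A" for p
    unfolding iff by (rule exI[of _ 0]) (simp add: Qm.emb_mem)
  show "x + y \<in> loc_at s A" if xy: "x \<in> loc_at s A" "y \<in> loc_at s A" for x y :: "'n ratfun"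
  proof -
    obtain k where k: "\<And>i. k \<le> i \<Longrightarrow> x * ?e ^ i \<in> Qm"
      using loc_at_obtain[OF xy(1) nz] by blast
    obtain l where l: "\<And>i. l \<le> i \<Longrightarrow> y * ?e ^ i \<in> Qm"
      using loc_at_obtain[OF xy(2) nz] by blast
    have "(x + y) * ?e ^ (k + l) = x * ?e ^ (k + l) + y * ?e ^ (k + l)" by (simp only: distrib_right)
    also have "\<dots> \<in> Qm" using k l by (intro Qm.add_mem) simp_all
    finally show ?thesis unfolding iff by blast
  qed
  show "x * y \<in> loc_at s A" if xy: "x \<in> loc_at s A" "y \<in> loc_at s A" for x y :: "'n ratfun"
  proof -
    obtain k l where *: "x * ?e ^ k \<in> Qm" "y * ?e ^ l \<in> Qm"
      using xy unfolding iff by blast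
    have "(x * y) * ?e ^ (k + l) = (x * ?e ^ k) * (y * ?e ^ l)" by (simp only: power_add mult_ac)
    also have "\<dots> \<in> Qm" by (rule Qm.mult_mem[OF *])
    finally show ?thesis unfolding iff by blast
  qed
  show "rat_deriv j x \<in> loc_at s A" if x: "x \<in> loc_at s A" for x :: "'n ratfun" and j
  proof -
    obtain k where *: "x * ?e ^ k \<in> Qm" using x unfolding iff by blast
    let ?g = "?e ^ k"
    \<comment> \<open>The product rule for \<open>x * ?g\<close>, multiplied once more by
      \<open>?g\<close>: differentiation at most doubles the exponent.\<close>
    have "rat_deriv j x * ?g ^ 2 = (rat_deriv j (x * ?g) * ?g - x * ?g * rat_deriv j ?g)"
      unfolding rat_deriv_mult by (simp only: algebra_simps power2_eq_square)
    also have "\<dots> \<in> Qm"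
      by (rule Qm.diff_mem[OF Qm.mult_mem[OF Qm.deriv_mem[OF *] eQ(2)]
            Qm.mult_mem[OF * Qm.deriv_mem[OF eQ(2)]]])
    finally show ?thesis unfolding iff power_mult[symmetric] by blast
  qed
qed

section \<open>Koszul calculus with explicit signs\<close>

section \<open>Operators on exterior algebras\<close>

text \<open>The sign of moving \<open>g\<close> from the front to its sorted place in
  \<open>S\<close>. It governs both left multiplication by \<open>g\<close> and contraction.\<close>

definition es :: "'g::linorder \<Rightarrow> 'g set \<Rightarrow> 'a::ring_1" where
  "es g S = (- 1) ^ card {b \<in> S. b < g}"

lemma es_cases: "es g S = (1 :: 'a::ring_1) \<or> es g S = (- 1 :: 'a)"
  unfolding es_def by (metis neg_one_even_power neg_one_odd_power)

lemma es_sq [simp]: "es g S * es g S = (1 :: 'a::ring_1)"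
  by (rule disjE[OF es_cases[of g S, where 'a = 'a]]) simp_all

lemma es_sq_left [simp]: "es g S * (es g S * x) = (x :: 'a::ring_1)"
  by (simp flip: mult.assoc)

lemma es_Diff_self [simp]: "es g (S - {g}) = es g S"
  unfolding es_def by (rule arg_cong[where f = "\<lambda>A. (-1) ^ card A"]) auto

lemma es_insert_self [simp]: "es g (insert g S) = es g S"
  unfolding es_def by (rule arg_cong[where f = "\<lambda>A. (-1) ^ card A"]) auto

text \<open>Removing the smaller generator first lowers the count for the larger one by one, while
  the count for the smaller one never sees the larger. This is the single sign.\<close>

lemma es_swap:
  fixes g h :: "'g::{finite,linorder}"
  assumes "g \<in> S" "h \<in> S" "g \<noteq> h"
  shows "es g S * es h (S - {g}) = - (es h S * es g (S - {h}) :: 'a::comm_ring_1)"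
proof -
  have *: "es g S * es h (S - {g}) = - (es h S * es g (S - {h}) :: 'a)"
    if "g \<in> S" "h \<in> S" "g < h" for g h :: 'g
  proof -
    have "{b \<in> S - {h}. b < g} = {b \<in> S. b < g}" using that by auto
    then have 1: "es g (S - {h}) = (es g S :: 'a)" unfolding es_def by simp
    have "{b \<in> S. b < h} = insert g {b \<in> S - {g}. b < h}" using that by auto
    then have "card {b \<in> S. b < h} = Suc (card {b \<in> S - {g}. b < h})" by simp
    then have 2: "es h S = (- es h (S - {g}) :: 'a)" unfolding es_def by simp
    show ?thesis unfolding 1 2 by (simp add: mult.commute)
  qed
  show ?thesis
  proof (cases "g < h")
    case False
    then have "es h S * es g (S - {h}) = - (es g S * es h (S - {g}) :: 'a)"
      using assms by (intro *) auto
    then show ?thesis by simp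
  qed (use assms * in auto)
qed

lemma additive_es:
  fixes \<Delta> :: "'a::ring_1 \<Rightarrow> 'a"
  assumes "additive \<Delta>"
  shows "\<Delta> (es g S * x) = es g S * \<Delta> x"
  by (rule disjE[OF es_cases[of g S, where 'a = 'a]]) (simp_all add: additive.minus[OF assms])

lemma sum_fun_apply: "(\<Sum>i\<in>A. F i) x = (\<Sum>i\<in>A. F i x)"
  by (induction A rule: infinite_finite_induct) auto

lemma additive_id: "additive (\<lambda>x. x)" by (simp add: additive_def)
lemma additive_zero: "additive (\<lambda>_. 0 :: 'a::ab_group_add)" by (simp add: additive_def)
lemma additive_times: "additive (\<lambda>x. c * x :: 'a::ring)" by (simp add: additive_def distrib_left)
lemma additive_rat_deriv: "additive (rat_deriv i)" by (simp add: additive_def rat_deriv_add)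

text \<open>The operator sum_g g wedge \<open>\<Delta> g\<close>, in coordinates. It squares to zero
  as soon as the \<open>\<Delta> g\<close> are additive and commute.\<close>

definition ext_op :: "('g \<Rightarrow> 'a \<Rightarrow> 'a) \<Rightarrow> ('g::{finite,linorder} set \<Rightarrow> 'a::comm_ring_1) \<Rightarrow> 'g set \<Rightarrow> 'a" where
  "ext_op \<Delta> \<omega> S = (\<Sum>g\<in>S. es g S * \<Delta> g (\<omega> (S - {g})))"

lemma gen_wedge:
  "(gen g \<^bold>\<and> \<omega>) S = (if g \<in> S then es g S * \<omega> (S - {g}) else 0)"
proof -
  have "(gen g \<^bold>\<and> \<omega>) S = (\<Sum>A\<in>Pow S. if A = {g} then
      (- 1) ^ card {(a, b). a \<in> A \<and> b \<in> S - A \<and> b < a} * \<omega> (S - A) else 0)"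
    unfolding wedge_def gen_def by (intro sum.cong) auto
  also have "\<dots> = (if {g} \<in> Pow S then
      (- 1) ^ card {(a, b). a \<in> {g} \<and> b \<in> S - {g} \<and> b < a} * \<omega> (S - {g}) else 0)"
    by (subst sum.delta) simp_all
  also have "{(a, b). a \<in> {g} \<and> b \<in> S - {g} \<and> b < a} = Pair g ` {b \<in> S. b < g}" by auto
  also have "card \<dots> = card {b \<in> S. b < g}" by (simp add: card_image inj_on_def)
  finally show ?thesis by (simp add: es_def)
qed

lemma sum_gen_wedge:
  "(\<Sum>g\<in>UNIV. gen g \<^bold>\<and> (\<lambda>S. \<Delta> g (\<omega> S))) = ext_op \<Delta> \<omega>"
proof
  fix S
  have "(\<Sum>g\<in>UNIV. gen g \<^bold>\<and> (\<lambda>S. \<Delta> g (\<omega> S))) S = (\<Sum>g\<in>UNIV. if g \<in> S then es g S * \<Delta> g (\<omega> (S - {g})) else 0)"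
    by (simp add: gen_wedge sum_fun_apply)
  also have "\<dots> = ext_op \<Delta> \<omega> S"
    unfolding ext_op_def by (simp add: sum.If_cases)
  finally show "(\<Sum>g\<in>UNIV. gen g \<^bold>\<and> (\<lambda>S. \<Delta> g (\<omega> S))) S = ext_op \<Delta> \<omega> S" .
qed

lemma additive_ext_op:
  assumes "\<And>g. additive (\<Delta> g)"
  shows "additive (ext_op \<Delta>)"
  by (auto simp: additive_def ext_op_def fun_eq_iff additive.add[OF assms] distrib_left sum.distrib)

text \<open>The terms for (g, h) and (h, g) cancel by \<open>es_swap\<close>. Both the vanishing of
  squares and anticommutation reduce to this.\<close>

lemma alternating_sum_zero:
  fixes \<Phi> :: "'g::{finite,linorder} \<Rightarrow> 'g \<Rightarrow> 'g set \<Rightarrow> 'a::comm_ring_1"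
  assumes "\<And>g h T. \<Phi> g h T = \<Phi> h g T"
  shows "(\<Sum>g\<in>S. \<Sum>h\<in>S-{g}. es g S * es h (S-{g}) * \<Phi> g h (S-{g}-{h})) = 0"
proof -
  define F where "F = (\<lambda>(g, h). es g S * es h (S-{g}) * \<Phi> g h (S-{g}-{h}))"
  define L where "L = {(g, h). g \<in> S \<and> h \<in> S \<and> g < h}"
  define U where "U = {(g, h). g \<in> S \<and> h \<in> S \<and> h < g}"
  have anti: "F (h, g) = - F (g, h)" if "g \<in> S" "h \<in> S" "g \<noteq> h" for g h
  proof -
    have "S - {g} - {h} = S - {h} - {g}" by auto
    then show ?thesis using es_swap[OF that(2,1), where 'a = 'a] that(3) assms[of g h]
      unfolding F_def by simp
  qed
  have "(\<Sum>g\<in>S. \<Sum>h\<in>S-{g}. es g S * es h (S-{g}) * \<Phi> g h (S-{g}-{h})) = sum F (Sigma S (\<lambda>g. S - {g}))"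
    by (subst sum.Sigma) (auto simp: F_def)
  also have "Sigma S (\<lambda>g. S - {g}) = L \<union> U" by (auto simp: L_def U_def)
  also have "sum F (L \<union> U) = sum F L + sum F U"
    by (intro sum.union_disjoint) (auto simp: L_def U_def)
  also have "sum F U = (\<Sum>(g, h)\<in>L. F (h, g))"
    by (intro sum.reindex_bij_witness[of _ "\<lambda>(g, h). (h, g)" "\<lambda>(g, h). (h, g)"]) (auto simp: L_def U_def)
  also have "\<dots> = - sum F L"
    unfolding sum_negf[symmetric] by (intro sum.cong) (auto simp: L_def intro!: anti)
  finally show ?thesis by simp
qed

lemma ext_op_ext_op:
  assumes "\<And>g. additive (A g)"
  shows "ext_op A (ext_op B \<omega>) S =
    (\<Sum>g\<in>S. \<Sum>h\<in>S-{g}. es g S * es h (S-{g}) * A g (B h (\<omega> (S-{g}-{h}))))"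
  unfolding ext_op_def
  by (simp add: additive.sum[OF assms] additive_es[OF assms] sum_distrib_left mult.assoc)

lemma ext_op_square:
  assumes "\<And>g. additive (A g)" "\<And>g h x. A g (A h x) = A h (A g x)"
  shows "ext_op A (ext_op A \<omega>) = 0"
proof
  fix S
  show "ext_op A (ext_op A \<omega>) S = 0 S"
    unfolding ext_op_ext_op[of A, OF assms(1)] zero_fun_apply by (rule alternating_sum_zero) (rule assms(2))
qed

text \<open>Polarized form of \<open>ext_op_square\<close>. Only the symmetrized composites must
  agree, which matters because multiplication by \<open>lam\<close> does not commute with the
  derivations.\<close>

lemma ext_op_anticommute:
  assumes "\<And>g. additive (A g)" "\<And>g. additive (B g)"
    and "\<And>g h x. A g (B h x) + B g (A h x) = A h (B g x) + B h (A g x)"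
  shows "ext_op A (ext_op B \<omega>) + ext_op B (ext_op A \<omega>) = 0"
proof
  fix S
  have "(ext_op A (ext_op B \<omega>) + ext_op B (ext_op A \<omega>)) S =
     (\<Sum>g\<in>S. \<Sum>h\<in>S-{g}. es g S * es h (S-{g}) *
        (A g (B h (\<omega> (S-{g}-{h}))) + B g (A h (\<omega> (S-{g}-{h})))))"
    unfolding plus_fun_apply ext_op_ext_op[of A, OF assms(1)] ext_op_ext_op[of B, OF assms(2)]
    by (simp add: sum.distrib distrib_left)
  also have "\<dots> = 0" by (rule alternating_sum_zero[where \<Phi> = "\<lambda>g h T. A g (B h (\<omega> T)) + B g (A h (\<omega> T))"]) (rule assms(3))
  finally show "(ext_op A (ext_op B \<omega>) + ext_op B (ext_op A \<omega>)) S = 0 S" by simp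
qed

text \<open>Interior product with the vector field \<open>\<mu>\<close>.\<close>

definition contract :: "('g \<Rightarrow> 'a) \<Rightarrow> ('g::{finite,linorder} set \<Rightarrow> 'a::comm_ring_1) \<Rightarrow> 'g set \<Rightarrow> 'a" where
  "contract \<mu> \<omega> S = (\<Sum>g\<in>-S. es g S * \<mu> g * \<omega> (insert g S))"

abbreviation mul :: "('g::{finite,linorder} \<Rightarrow> 'a) \<Rightarrow> ('g set \<Rightarrow> 'a::comm_ring_1) \<Rightarrow> 'g set \<Rightarrow> 'a" where
  "mul lam \<equiv> ext_op (\<lambda>g x. lam g * x)"

text \<open>Terms that exchange one generator for another cancel, and the diagonal terms add up to
  the pairing of covector and vector. When this pairing is 1, contraction is a contracting homotopy
  for \<open>mul lam\<close>.\<close>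

lemma mul_contract:
  "mul lam (contract \<mu> \<omega>) S + contract \<mu> (mul lam \<omega>) S = (\<Sum>g\<in>UNIV. lam g * \<mu> g) * \<omega> S"
proof -
  have 1: "mul lam (contract \<mu> \<omega>) S = (\<Sum>g\<in>S. lam g * \<mu> g * \<omega> S) +
     (\<Sum>g\<in>S. \<Sum>k\<in>-S. es g S * es k (S - {g}) * lam g * \<mu> k * \<omega> (insert k (S - {g})))"
  proof -
    have "es g S * (lam g * contract \<mu> \<omega> (S - {g})) = lam g * \<mu> g * \<omega> S +
        (\<Sum>k\<in>-S. es g S * es k (S - {g}) * lam g * \<mu> k * \<omega> (insert k (S - {g})))" if "g \<in> S" for g
    proof -
      have "- (S - {g}) = insert g (- S)" using that by auto
      then have "contract \<mu> \<omega> (S - {g}) = es g S * \<mu> g * \<omega> S +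
          (\<Sum>k\<in>-S. es k (S - {g}) * \<mu> k * \<omega> (insert k (S - {g})))"
        unfolding contract_def using that by (simp add: insert_absorb)
      then show ?thesis
        by (simp add: algebra_simps sum_distrib_left)
    qed
    then show ?thesis unfolding ext_op_def by (simp add: sum.distrib)
  qed
  have 2: "contract \<mu> (mul lam \<omega>) S = (\<Sum>k\<in>-S. lam k * \<mu> k * \<omega> S) +
     (\<Sum>k\<in>-S. \<Sum>g\<in>S. es k S * es g (insert k S) * lam g * \<mu> k * \<omega> (insert k S - {g}))"
  proof -
    have "es k S * \<mu> k * mul lam \<omega> (insert k S) = lam k * \<mu> k * \<omega> S +
      (\<Sum>g\<in>S. es k S * es g (insert k S) * lam g * \<mu> k * \<omega> (insert k S - {g}))" if "k \<in> - S" for k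
    proof -
      have "mul lam \<omega> (insert k S) = es k S * (lam k * \<omega> S) +
         (\<Sum>g\<in>S. es g (insert k S) * (lam g * \<omega> (insert k S - {g})))"
        unfolding ext_op_def using that by simp
      then show ?thesis by (simp add: algebra_simps sum_distrib_left)
    qed
    then show ?thesis unfolding contract_def by (simp add: sum.distrib)
  qed
  \<comment> \<open>Inserting \<open>k\<close> and removing \<open>g\<close> in the two possible
    orders carries opposite signs, by \<open>es_swap\<close> on \<open>insert k S\<close>.\<close>
  have 3: "es k S * es g (insert k S) * lam g * \<mu> k * \<omega> (insert k S - {g}) =
      - (es g S * es k (S - {g}) * lam g * \<mu> k * \<omega> (insert k (S - {g})))" if "g \<in> S" "k \<in> - S" for g k
  proof -
    have ne: "k \<noteq> g" using that by auto
    have s: "insert k S - {g} = insert k (S - {g})" "insert k S - {k} = S" using that by auto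
    have "es g (insert k S) * es k (S - {g}) = - (es k S * es g S :: 'a)"
      using es_swap[of g "insert k S" k, where 'a = 'a] that ne by (simp add: s)
    then have "es g S * es k (S - {g}) = - (es k S * es g (insert k S) :: 'a)"
      using es_cases[of g S, where 'a = 'a] es_cases[of k S, where 'a = 'a]
        es_cases[of g "insert k S", where 'a = 'a] es_cases[of k "S - {g}", where 'a = 'a] by auto
    then show ?thesis unfolding s by simp
  qed
  have "(\<Sum>k\<in>-S. \<Sum>g\<in>S. es k S * es g (insert k S) * lam g * \<mu> k * \<omega> (insert k S - {g})) =
     - (\<Sum>k\<in>-S. \<Sum>g\<in>S. es g S * es k (S - {g}) * lam g * \<mu> k * \<omega> (insert k (S - {g})))"
    unfolding sum_negf[symmetric] by (intro sum.cong refl 3) auto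
  also have "\<dots> = - (\<Sum>g\<in>S. \<Sum>k\<in>-S. es g S * es k (S - {g}) * lam g * \<mu> k * \<omega> (insert k (S - {g})))"
    by (subst sum.swap) simp
  finally have "mul lam (contract \<mu> \<omega>) S + contract \<mu> (mul lam \<omega>) S =
     (\<Sum>g\<in>S. lam g * \<mu> g * \<omega> S) + (\<Sum>k\<in>-S. lam k * \<mu> k * \<omega> S)"
    unfolding 1 2 by simp
  also have "\<dots> = (\<Sum>g\<in>UNIV. lam g * \<mu> g * \<omega> S)"
    by (subst sum.union_disjoint[symmetric]) auto
  finally show ?thesis by (simp add: sum_distrib_right)
qed

section \<open>From order zero in u to all orders\<close>

section \<open>Deformation in the formal variable\<close>

text \<open>\<open>Z\<close> and \<open>W\<close> are the coefficient sequences of a cocycle and of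
  a primitive. Working modulo \<open>N\<close> covers exactness of a complex
  (\<open>N = {0}\<close>) and exactness of a quotient complex by the same argument.\<close>

lemma power_series_exact:
  fixes \<delta>0 \<delta>1 :: "'b::ab_group_add \<Rightarrow> 'b" and Z :: "nat \<Rightarrow> 'b"
  assumes add: "additive \<delta>0" "additive \<delta>1"
    and anti: "\<And>x. \<delta>0 (\<delta>1 x) = - \<delta>1 (\<delta>0 x)" "\<And>x. \<delta>1 (\<delta>1 x) = 0"
    and N: "0 \<in> N" "\<And>x y. x \<in> N \<Longrightarrow> y \<in> N \<Longrightarrow> x - y \<in> N" "\<And>x. x \<in> N \<Longrightarrow> \<delta>1 x \<in> N"
    and exact: "\<And>z. z \<in> C \<Longrightarrow> \<delta>0 z \<in> N \<Longrightarrow> \<exists>w\<in>C'. z - \<delta>0 w \<in> N"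
    and C: "\<And>z w. z \<in> C \<Longrightarrow> w \<in> C' \<Longrightarrow> z - \<delta>1 w \<in> C"
    and Z: "\<And>k. Z k \<in> C" "\<delta>0 (Z 0) \<in> N" "\<And>k. \<delta>0 (Z (Suc k)) + \<delta>1 (Z k) \<in> N"
  obtains W where "\<And>k. W k \<in> C'" "Z 0 - \<delta>0 (W 0) \<in> N"
    "\<And>k. Z (Suc k) - \<delta>1 (W k) - \<delta>0 (W (Suc k)) \<in> N"
proof -
  \<comment> \<open>\<open>v\<close> stands for \<open>\<delta>1\<close> of the preceding term of the sequence\<close>
  let ?P = "\<lambda>k w. w \<in> C' \<and> (\<exists>v. \<delta>1 v = 0 \<and> Z k - v - \<delta>0 w \<in> N)"
  let ?Q = "\<lambda>k w w'. Z (Suc k) - \<delta>1 w - \<delta>0 w' \<in> N"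
  have "\<exists>W. \<forall>k. ?P k (W k) \<and> ?Q k (W k) (W (Suc k)) \<and> (k = 0 \<longrightarrow> Z 0 - \<delta>0 (W 0) \<in> N)"
  proof -
    obtain w0 where w0: "w0 \<in> C'" "Z 0 - \<delta>0 w0 \<in> N" using exact Z by blast
    have "\<exists>w'. ?P (Suc k) w' \<and> ?Q k w w'" if w: "?P k w" for k w
    proof -
      obtain v where v: "\<delta>1 v = 0" "Z k - v - \<delta>0 w \<in> N" using w by blast
      \<comment> \<open>The error to be removed at the next order is closed for \<delta>0 modulo
        \<open>N\<close>: anticommutation expresses its image through the cocycle condition and
        \<delta>1 of the present error, where \<open>v\<close> drops out.\<close>
      have "\<delta>0 (Z (Suc k) - \<delta>1 w) = (\<delta>0 (Z (Suc k)) + \<delta>1 (Z k)) - \<delta>1 (Z k - v - \<delta>0 w)"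
        by (simp add: additive.diff[OF add(1)] additive.diff[OF add(2)] anti v)
      also have "\<dots> \<in> N" using Z(3) v(2) N(2,3) by blast
      finally obtain w' where "w' \<in> C'" "Z (Suc k) - \<delta>1 w - \<delta>0 w' \<in> N"
        using exact C Z(1) w by blast
      then show ?thesis using anti(2) by blast
    qed
    moreover have "?P 0 w0" using w0 additive.zero[OF add(2)] by (auto intro: exI[of _ 0])
    ultimately have "\<exists>W. \<forall>k. (?P k (W k) \<and> (k = 0 \<longrightarrow> W k = w0)) \<and> ?Q k (W k) (W (Suc k))"
      by (intro dependent_nat_choice) blast+
    then obtain W where W: "\<And>k. ?P k (W k)" "\<And>k. ?Q k (W k) (W (Suc k))" "W 0 = w0"
      by blast
    then show ?thesis using w0 by (intro exI[of _ W]) auto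
  qed
  then show ?thesis using that by blast
qed

section \<open>Cohomology classes\<close>

locale cochain =
  fixes C :: "'a::ab_group_add cplx"
  assumes zero_mem: "0 \<in> fst C k"
    and diff_mem: "x \<in> fst C k \<Longrightarrow> y \<in> fst C k \<Longrightarrow> x - y \<in> fst C k"
    and d_mem: "x \<in> fst C k \<Longrightarrow> snd C x \<in> fst C (Suc k)"
    and d_add: "additive (snd C)"
    and d_d: "x \<in> fst C k \<Longrightarrow> snd C (snd C x) = 0"
begin

lemma minus_mem: "x \<in> fst C k \<Longrightarrow> - x \<in> fst C k"
  using diff_mem[OF zero_mem, of x k] by simp

lemma add_mem: "x \<in> fst C k \<Longrightarrow> y \<in> fst C k \<Longrightarrow> x + y \<in> fst C k"
  using diff_mem[of x k "- y"] minus_mem[of y k] by simp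

lemma cocycles_diff: "x \<in> cocycles C k \<Longrightarrow> y \<in> cocycles C k \<Longrightarrow> x - y \<in> cocycles C k"
  by (simp add: cocycles_def diff_mem additive.diff[OF d_add])

lemma cocycles_zero: "0 \<in> cocycles C k"
  by (simp add: cocycles_def zero_mem additive.zero[OF d_add])

lemma cocycles_minus: "x \<in> cocycles C k \<Longrightarrow> - x \<in> cocycles C k"
  using cocycles_diff[OF cocycles_zero, of x k] by simp

lemma cocycles_add: "x \<in> cocycles C k \<Longrightarrow> y \<in> cocycles C k \<Longrightarrow> x + y \<in> cocycles C k"
  using cocycles_diff[of x k "- y"] cocycles_minus[of y k] by simp

lemma coboundaries_zero: "0 \<in> coboundaries C k"
  unfolding coboundaries_def using zero_mem additive.zero[OF d_add]
  by (auto split: nat.splits intro!: image_eqI[of _ _ 0])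

lemma coboundaries_diff:
  "x \<in> coboundaries C k \<Longrightarrow> y \<in> coboundaries C k \<Longrightarrow> x - y \<in> coboundaries C k"
  unfolding coboundaries_def
  by (auto split: nat.splits simp flip: additive.diff[OF d_add] intro!: imageI diff_mem)

lemma coboundaries_minus: "x \<in> coboundaries C k \<Longrightarrow> - x \<in> coboundaries C k"
  using coboundaries_diff[OF coboundaries_zero, of x k] by simp

lemma coboundaries_add:
  "x \<in> coboundaries C k \<Longrightarrow> y \<in> coboundaries C k \<Longrightarrow> x + y \<in> coboundaries C k"
  using coboundaries_diff[of x k "- y"] coboundaries_minus[of y k] by simp

lemma coboundaryI: "x \<in> fst C k \<Longrightarrow> snd C x \<in> coboundaries C (Suc k)"
  by (simp add: coboundaries_def)

lemma equiv_cohomologous: "equiv (cocycles C k) (cohomologous C k)"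
proof (rule equivI)
  show "refl_on (cocycles C k) (cohomologous C k)"
    by (auto simp: refl_on_def cohomologous_def coboundaries_zero)
  show "cohomologous C k \<subseteq> cocycles C k \<times> cocycles C k" by (auto simp: cohomologous_def)
  show "sym (cohomologous C k)"
    unfolding sym_def cohomologous_def using coboundaries_minus by fastforce
  show "trans (cohomologous C k)"
    unfolding trans_def cohomologous_def using coboundaries_add by fastforce
qed

lemma mem_cls_iff:
  "z \<in> cocycles C k \<Longrightarrow> w \<in> cls C k z \<longleftrightarrow> w \<in> cocycles C k \<and> z - w \<in> coboundaries C k"
  by (auto simp: cls_def cohomologous_def)

lemma self_in_cls: "z \<in> cocycles C k \<Longrightarrow> z \<in> cls C k z"
  by (simp add: mem_cls_iff coboundaries_zero)

lemma cls_eq_iff: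
  "z \<in> cocycles C k \<Longrightarrow> w \<in> cocycles C k \<Longrightarrow> cls C k z = cls C k w \<longleftrightarrow> z - w \<in> coboundaries C k"
  unfolding cls_def by (subst eq_equiv_class_iff[OF equiv_cohomologous]) (auto simp: cohomologous_def)

lemma cohomology_eq: "cohomology C k = cls C k ` cocycles C k"
  by (auto simp: cohomology_def cls_def quotient_def)

lemma cls_mem: "z \<in> cocycles C k \<Longrightarrow> cls C k z \<in> cohomology C k"
  by (simp add: cohomology_eq)

end

text \<open>Only cocycles and coboundaries of the one degree \<open>k\<close> are constrained. Maps
  that commute with the differentials merely up to sign, such as \<open>conj_form\<close>, therefore
  fit as well.\<close>

locale coh_map = C: cochain C + D: cochain D
  for C :: "'a::ab_group_add cplx" and D :: "'b::ab_group_add cplx" +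
  fixes k :: nat and \<phi> :: "'a \<Rightarrow> 'b"
  assumes additive: "additive \<phi>"
    and cocycle: "z \<in> cocycles C k \<Longrightarrow> \<phi> z \<in> cocycles D k"
    and coboundary: "z \<in> coboundaries C k \<Longrightarrow> \<phi> z \<in> coboundaries D k"
begin

lemma hmap_cls:
  assumes "z \<in> cocycles C k"
  shows "hmap D k \<phi> (cls C k z) = cls D k (\<phi> z)"
proof -
  have "cls D k (\<phi> w) = cls D k (\<phi> z)" if "w \<in> cls C k z" for w
  proof -
    have w: "w \<in> cocycles C k" "z - w \<in> coboundaries C k" using that assms by (auto simp: C.mem_cls_iff)
    have "\<phi> z - \<phi> w \<in> coboundaries D k"
      using coboundary[OF w(2)] by (simp add: additive.diff[OF additive])
    then show ?thesis using D.cls_eq_iff cocycle assms w by metis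
  qed
  then show ?thesis using C.self_in_cls[OF assms] unfolding hmap_def by blast
qed

lemma bij_betw_hmap:
  assumes surj: "\<And>w. w \<in> cocycles D k \<Longrightarrow> \<exists>z\<in>cocycles C k. \<phi> z - w \<in> coboundaries D k"
    and inj: "\<And>z. z \<in> cocycles C k \<Longrightarrow> \<phi> z \<in> coboundaries D k \<Longrightarrow> z \<in> coboundaries C k"
  shows "bij_betw (hmap D k \<phi>) (cohomology C k) (cohomology D k)"
proof (rule bij_betw_imageI)
  show "inj_on (hmap D k \<phi>) (cohomology C k)"
  proof (rule inj_onI)
    fix c c' assume "c \<in> cohomology C k" "c' \<in> cohomology C k" and eq: "hmap D k \<phi> c = hmap D k \<phi> c'"
    then obtain z w where z: "z \<in> cocycles C k" "w \<in> cocycles C k" and c: "c = cls C k z" "c' = cls C k w"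
      by (auto simp: C.cohomology_eq)
    have "\<phi> z - \<phi> w \<in> coboundaries D k"
      using eq z by (simp add: c hmap_cls D.cls_eq_iff cocycle)
    then have "z - w \<in> coboundaries C k"
      using inj[OF C.cocycles_diff[OF z]] by (simp add: additive.diff[OF additive])
    then show "c = c'" using z by (simp add: c C.cls_eq_iff)
  qed
  show "hmap D k \<phi> ` cohomology C k = cohomology D k"
  proof safe
    fix c assume "c \<in> cohomology C k"
    then show "hmap D k \<phi> c \<in> cohomology D k"
      by (auto simp: C.cohomology_eq hmap_cls intro!: D.cls_mem cocycle)
  next
    fix c assume "c \<in> cohomology D k"
    then obtain w where w: "w \<in> cocycles D k" "c = cls D k w" by (auto simp: D.cohomology_eq)
    obtain z where z: "z \<in> cocycles C k" "\<phi> z - w \<in> coboundaries D k" using surj[OF w(1)] by blast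
    have "c = hmap D k \<phi> (cls C k z)"
      using z w by (simp add: hmap_cls) (metis D.cls_eq_iff cocycle)
    then show "c \<in> hmap D k \<phi> ` cohomology C k" using C.cls_mem[OF z(1)] by blast
  qed
qed

end

lemma coh_mapI:
  assumes "cochain C" "cochain D" "additive \<phi>"
    and mem: "\<And>j x. x \<in> fst C j \<Longrightarrow> \<phi> x \<in> fst D j"
    and d: "\<And>j x. x \<in> fst C j \<Longrightarrow> snd D (\<phi> x) = \<phi> (snd C x)"
  shows "coh_map C D k \<phi>"
proof -
  interpret C: cochain C by fact
  interpret D: cochain D by fact
  show ?thesis
  proof (intro coh_map.intro coh_map_axioms.intro assms(1,2))
    show "additive \<phi>" by fact
    show "\<phi> z \<in> cocycles D k" if "z \<in> cocycles C k" for z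
      using that mem[of z k] d[of z k] by (simp add: cocycles_def additive.zero[OF assms(3)])
    show "\<phi> z \<in> coboundaries D k" if "z \<in> coboundaries C k" for z
      using that unfolding coboundaries_def
      by (cases k) (auto simp: additive.zero[OF assms(3)] simp flip: d intro!: imageI mem)
  qed
qed

section \<open>Twisted complexes of forms\<close>

definition tw :: "('g \<Rightarrow> 'a) \<Rightarrow> ('g \<Rightarrow> 'a \<Rightarrow> 'a) \<Rightarrow> 'g \<Rightarrow> 'a::comm_ring_1 fps \<Rightarrow> 'a fps" where
  "tw lam del g F = fps_const (lam g) * F + fps_X * Abs_fps (\<lambda>k. del g (fps_nth F k))"

text \<open>A form with power series as coefficients is the same as a power series of forms;
  \<open>coef\<close> and \<open>series\<close> pass between the two views, and
  \<open>power_series_exact\<close> lives in the second.\<close>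

definition coef :: "('g set \<Rightarrow> 'a::comm_ring_1 fps) \<Rightarrow> nat \<Rightarrow> 'g set \<Rightarrow> 'a" where
  "coef \<omega> k S = fps_nth (\<omega> S) k"

definition series :: "(nat \<Rightarrow> 'g set \<Rightarrow> 'a::comm_ring_1) \<Rightarrow> 'g set \<Rightarrow> 'a fps" where
  "series W S = Abs_fps (\<lambda>k. W k S)"

lemma coef_series [simp]: "coef (series W) k = W k"
  by (simp add: coef_def series_def fun_eq_iff)

lemma series_coef [simp]: "series (coef \<omega>) = \<omega>"
  by (simp add: coef_def series_def fun_eq_iff fps_eq_iff)

lemma coef_eqI: "(\<And>k. coef \<omega> k = coef \<eta> k) \<Longrightarrow> \<omega> = \<eta>"
  by (metis series_coef ext)

lemma coef_diff [simp]: "coef (\<omega> - \<eta>) k = coef \<omega> k - coef \<eta> k"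
  by (simp add: coef_def fun_eq_iff)

lemma tw_nth_0 [simp]: "fps_nth (tw lam del g F) 0 = lam g * fps_nth F 0"
  by (simp add: tw_def)

lemma tw_nth_Suc [simp]:
  "fps_nth (tw lam del g F) (Suc k) = lam g * fps_nth F (Suc k) + del g (fps_nth F k)"
  by (simp add: tw_def)

lemma es_fps: "(es g S :: 'a::comm_ring_1 fps) = fps_const (es g S)"
  unfolding es_def by (simp flip: fps_const_power fps_const_1_eq_1 fps_const_neg)

lemma coef_tw_0: "coef (ext_op (tw lam del) \<omega>) 0 = mul lam (coef \<omega> 0)"
  by (simp add: coef_def ext_op_def fps_sum_nth fun_eq_iff es_fps)

lemma coef_tw_Suc: "coef (ext_op (tw lam del) \<omega>) (Suc k) = mul lam (coef \<omega> (Suc k)) + ext_op del (coef \<omega> k)"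
  by (simp add: coef_def ext_op_def fps_sum_nth fun_eq_iff es_fps distrib_left sum.distrib)

text \<open>The coefficient module may depend on the basis element, because in a Cech complex the
  \<alpha>'s that are present decide which denominators are allowed.\<close>

definition forms :: "('g set \<Rightarrow> 'a::comm_ring_1 set) \<Rightarrow> nat \<Rightarrow> ('g set \<Rightarrow> 'a fps) set" where
  "forms M k = {\<omega>. (\<forall>S j. fps_nth (\<omega> S) j \<in> M S) \<and> (\<forall>S. \<omega> S \<noteq> 0 \<longrightarrow> card S = k)}"

definition fcx :: "('g::{finite,linorder} set \<Rightarrow> 'a::comm_ring_1 set) \<Rightarrow> ('g \<Rightarrow> 'a) \<Rightarrow> ('g \<Rightarrow> 'a \<Rightarrow> 'a) \<Rightarrow>
    ('g set \<Rightarrow> 'a fps) cplx" where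
  "fcx M lam del = (forms M, ext_op (tw lam del))"

lemma forms_iff_coef:
  "\<omega> \<in> forms M k \<longleftrightarrow> (\<forall>j S. coef \<omega> j S \<in> M S) \<and> (\<forall>j S. coef \<omega> j S \<noteq> 0 \<longrightarrow> card S = k)"
  by (auto simp: forms_def coef_def fps_eq_iff)

text \<open>\<open>del_lam\<close> says that the 1-form \<open>lam\<close> is closed. This is what
  makes the components \<open>tw lam del g\<close> commute although \<open>lam\<close> is not
  constant.\<close>

locale twisted =
  fixes lam :: "'g::{finite,linorder} \<Rightarrow> 'a::comm_ring_1" and del :: "'g \<Rightarrow> 'a \<Rightarrow> 'a"
  assumes del_additive: "additive (del g)"
    and del_mult: "del g (x * y) = del g x * y + x * del g y"
    and del_commute: "del g (del h x) = del h (del g x)"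
    and del_lam: "del g (lam h) = del h (lam g)"
begin

lemma additive_tw: "additive (tw lam del g)"
  by (auto simp: additive_def tw_def fps_eq_iff distrib_left additive.add[OF del_additive] fps_mult_fps_X_commute)

lemma tw_commute: "tw lam del g (tw lam del h F) = tw lam del h (tw lam del g F)"
proof (rule fps_ext)
  fix n
  show "fps_nth (tw lam del g (tw lam del h F)) n = fps_nth (tw lam del h (tw lam del g F)) n"
  proof (cases n)
    case (Suc k)
    show ?thesis
      unfolding Suc using del_lam[of g h] del_commute[of g h]
      by (cases k) (simp_all add: additive.add[OF del_additive] del_mult algebra_simps)
  qed (simp add: mult.left_commute)
qed

lemma additive_d: "additive (ext_op (tw lam del))"
  by (rule additive_ext_op[OF additive_tw])

lemma d_d: "ext_op (tw lam del) (ext_op (tw lam del) \<omega>) = 0"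
  by (rule ext_op_square[OF additive_tw tw_commute])

lemma mul_del_anticommute: "mul lam (ext_op del \<omega>) = - ext_op del (mul lam \<omega>)"
proof -
  have "mul lam (ext_op del \<omega>) + ext_op del (mul lam \<omega>) = 0"
    using del_lam del_commute
    by (intro ext_op_anticommute additive_times del_additive) (simp add: del_mult algebra_simps)
  then show ?thesis by (simp add: eq_neg_iff_add_eq_0)
qed

lemma ext_del_square: "ext_op del (ext_op del \<omega>) = 0"
  by (rule ext_op_square[OF del_additive del_commute])

lemma mul_square: "mul lam (mul lam \<omega>) = 0"
  by (rule ext_op_square[OF additive_times]) (simp add: mult.left_commute)

text \<open>\<open>mul lam\<close> is the part of the differential of order zero in u and
  \<open>ext_op del\<close> the part of order one; exactness of the former is passed on to the
  whole.\<close>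

lemma series_exact:
  assumes N: "0 \<in> N" "\<And>x y. x \<in> N \<Longrightarrow> y \<in> N \<Longrightarrow> x - y \<in> N" "\<And>x. x \<in> N \<Longrightarrow> ext_op del x \<in> N"
    and exact: "\<And>z. z \<in> C \<Longrightarrow> mul lam z \<in> N \<Longrightarrow> \<exists>w\<in>C'. z - mul lam w \<in> N"
    and C: "\<And>z w. z \<in> C \<Longrightarrow> w \<in> C' \<Longrightarrow> z - ext_op del w \<in> C"
    and \<omega>: "\<And>k. coef \<omega> k \<in> C" "\<And>k. coef (ext_op (tw lam del) \<omega>) k \<in> N"
  obtains \<eta> where "\<And>k. coef \<eta> k \<in> C'" "\<And>k. coef (\<omega> - ext_op (tw lam del) \<eta>) k \<in> N"
proof -
  obtain W where W: "\<And>k. W k \<in> C'" "coef \<omega> 0 - mul lam (W 0) \<in> N"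
    "\<And>k. coef \<omega> (Suc k) - ext_op del (W k) - mul lam (W (Suc k)) \<in> N"
  proof (rule power_series_exact[of "mul lam" "ext_op del" N C C' "coef \<omega>"])
    show "additive (mul lam)" by (rule additive_ext_op[OF additive_times])
    show "additive (ext_op del)" by (rule additive_ext_op[OF del_additive])
    show "mul lam (coef \<omega> 0) \<in> N" using \<omega>(2)[of 0] by (simp add: coef_tw_0)
    show "mul lam (coef \<omega> (Suc k)) + ext_op del (coef \<omega> k) \<in> N" for k
      using \<omega>(2)[of "Suc k"] by (simp add: coef_tw_Suc)
  qed (use assms mul_del_anticommute ext_del_square in auto)
  have "coef (\<omega> - ext_op (tw lam del) (series W)) k \<in> N" for k
    using W(2,3) by (cases k) (simp_all add: coef_tw_0 coef_tw_Suc algebra_simps)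
  then show ?thesis using W(1) that[of "series W"] by simp
qed

end

locale form_cx = twisted lam del
  for lam :: "'g::{finite,linorder} \<Rightarrow> 'a::comm_ring_1" and del :: "'g \<Rightarrow> 'a \<Rightarrow> 'a" +
  fixes M :: "'g set \<Rightarrow> 'a set"
  assumes M_zero: "0 \<in> M S"
    and M_diff: "x \<in> M S \<Longrightarrow> y \<in> M S \<Longrightarrow> x - y \<in> M S"
    and M_lam: "g \<notin> S \<Longrightarrow> x \<in> M S \<Longrightarrow> lam g * x \<in> M (insert g S)"
    and M_del: "g \<notin> S \<Longrightarrow> x \<in> M S \<Longrightarrow> del g x \<in> M (insert g S)"
begin

lemma M_minus: "x \<in> M S \<Longrightarrow> - x \<in> M S"
  using M_diff[OF M_zero, of x S] by simp
lemma M_add: "x \<in> M S \<Longrightarrow> y \<in> M S \<Longrightarrow> x + y \<in> M S"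
  using M_diff[of x S "- y"] M_minus[of y S] by simp
lemma M_sum: "(\<And>i. i \<in> A \<Longrightarrow> h i \<in> M S) \<Longrightarrow> (\<Sum>i\<in>A. h i) \<in> M S"
  by (induction A rule: infinite_finite_induct) (auto intro: M_zero M_add)
lemma M_es: "x \<in> M S \<Longrightarrow> es g T * x \<in> M S"
  by (rule disjE[OF es_cases[of g T, where 'a = 'a]]) (auto intro: M_minus)

lemma mul_mem: "(\<And>S. w S \<in> M S) \<Longrightarrow> mul lam w S \<in> M S"
  unfolding ext_op_def
  by (intro M_sum M_es) (metis Diff_iff M_lam insertCI insert_Diff)

lemma ext_del_mem: "(\<And>S. w S \<in> M S) \<Longrightarrow> ext_op del w S \<in> M S"
  unfolding ext_op_def
  by (intro M_sum M_es) (metis Diff_iff M_del insertCI insert_Diff)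

lemma ext_op_nonzero:
  assumes "\<And>g. additive (\<Delta> g)" "ext_op \<Delta> w S \<noteq> 0"
  shows "\<exists>g\<in>S. w (S - {g}) \<noteq> 0"
proof -
  obtain g where g: "g \<in> S" "es g S * \<Delta> g (w (S - {g})) \<noteq> 0"
    using assms(2) unfolding ext_op_def by (meson sum.not_neutral_contains_not_neutral)
  then have "w (S - {g}) \<noteq> 0" using additive.zero[OF assms(1)] by auto
  then show ?thesis using g(1) by blast
qed

lemma ext_op_card:
  assumes "\<And>g. additive (\<Delta> g)" "\<And>S. w S \<noteq> 0 \<Longrightarrow> card S = k"
    and "ext_op \<Delta> w S \<noteq> 0"
  shows "card S = Suc k"
proof -
  obtain g where g: "g \<in> S" "w (S - {g}) \<noteq> 0"
    using ext_op_nonzero[OF assms(1,3)] by blast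
  then have "card (S - {g}) = k" using assms(2) by blast
  then show ?thesis using g(1) by (metis card.remove finite)
qed

lemma coef_d_mem: "(\<And>k S. coef \<omega> k S \<in> M S) \<Longrightarrow> coef (ext_op (tw lam del) \<omega>) k S \<in> M S"
  by (cases k) (auto simp: coef_tw_0 coef_tw_Suc intro!: M_add mul_mem ext_del_mem)

lemma cochain_fcx: "cochain (fcx M lam del)"
proof (rule cochain.intro)
  show "0 \<in> fst (fcx M lam del) k" for k by (simp add: fcx_def forms_def M_zero)
  show "x - y \<in> fst (fcx M lam del) k" if "x \<in> fst (fcx M lam del) k" "y \<in> fst (fcx M lam del) k" for x y k
    using that by (auto simp: fcx_def forms_def intro: M_diff) (metis diff_zero diff_self)
  show "additive (snd (fcx M lam del))" by (simp add: fcx_def additive_d)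
  show "snd (fcx M lam del) (snd (fcx M lam del) x) = 0" for x by (simp add: fcx_def d_d)
  show "snd (fcx M lam del) x \<in> fst (fcx M lam del) (Suc k)" if "x \<in> fst (fcx M lam del) k" for x k
  proof -
    have x: "\<And>j S. coef x j S \<in> M S" "\<And>S. x S \<noteq> 0 \<Longrightarrow> card S = k"
      using that by (auto simp: fcx_def forms_def coef_def)
    have "fps_nth (ext_op (tw lam del) x S) j \<in> M S" for S j
      using coef_d_mem[of x j S] x(1) by (simp add: coef_def)
    then show ?thesis using ext_op_card[OF additive_tw x(2)] by (auto simp: fcx_def forms_def)
  qed
qed

end

section \<open>Comparison of complexes along an inclusion of generators\<close>

section \<open>Restriction to a subset of the generators\<close>

lemma es_image:
  fixes e :: "'h::{finite,linorder} \<Rightarrow> 'g::{finite,linorder}"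
  assumes "strict_mono e"
  shows "es (e g) (e ` S) = es g S"
proof -
  have "{b \<in> e ` S. b < e g} = e ` {b \<in> S. b < g}" by (auto simp: strict_mono_less[OF assms])
  then have "card {b \<in> e ` S. b < e g} = card {b \<in> S. b < g}"
    using card_image[OF inj_on_subset[OF strict_mono_imp_inj_on[OF assms] subset_UNIV]] by simp
  then show ?thesis unfolding es_def by (simp only:)
qed

lemma restr_ext_op:
  fixes e :: "'h::{finite,linorder} \<Rightarrow> 'g::{finite,linorder}"
  assumes "strict_mono e"
  shows "restr e (ext_op \<Delta> \<omega>) = ext_op (\<lambda>g. \<Delta> (e g)) (restr e \<omega>)"
proof
  fix S
  have inj: "inj_on e A" for A using inj_on_subset[OF strict_mono_imp_inj_on[OF assms]] by blast
  have "e ` S - {e g} = e ` (S - {g})" if "g \<in> S" for g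
    using inj_on_image_set_diff[of e UNIV S "{g}"] inj by simp
  then show "restr e (ext_op \<Delta> \<omega>) S = ext_op (\<lambda>g. \<Delta> (e g)) (restr e \<omega>) S"
    unfolding restr_def ext_op_def by (simp add: sum.reindex[OF inj] es_image[OF assms])
qed

lemma restr_extend: "inj e \<Longrightarrow> restr e (extend e \<omega>) = \<omega>"
  by (auto simp: restr_def extend_def fun_eq_iff inj_vimage_image_eq)

lemma extend_ext_op:
  fixes e :: "'h::{finite,linorder} \<Rightarrow> 'g::{finite,linorder}"
  assumes e: "strict_mono e" and add: "\<And>g. \<Delta> g 0 = 0" and out: "\<And>g x. g \<notin> range e \<Longrightarrow> \<Delta> g x = 0"
  shows "ext_op \<Delta> (extend e \<omega>) = extend e (ext_op (\<lambda>g. \<Delta> (e g)) \<omega>)"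
proof
  fix T
  show "ext_op \<Delta> (extend e \<omega>) T = extend e (ext_op (\<lambda>g. \<Delta> (e g)) \<omega>) T"
  proof (cases "T \<subseteq> range e")
    case True
    then have T: "T = e ` (e -` T)" by auto
    have "ext_op \<Delta> (extend e \<omega>) T = restr e (ext_op \<Delta> (extend e \<omega>)) (e -` T)"
      unfolding restr_def using T by metis
    then show ?thesis
      using True strict_mono_imp_inj_on[OF e]
      by (simp add: restr_ext_op[OF e] restr_extend) (simp add: extend_def)
  next
    case False
    have "es g T * \<Delta> g (extend e \<omega> (T - {g})) = 0" if "g \<in> T" for g
    proof (cases "g \<in> range e")
      case True
      then have "\<not> T - {g} \<subseteq> range e" using False by auto
      then show ?thesis by (simp add: extend_def add)
    qed (simp add: out)
    then show ?thesis using False unfolding ext_op_def by (simp add: extend_def)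
  qed
qed

context form_cx
begin

text \<open>A homotopy is available only on forms all of whose terms contain a fixed
  \<open>t\<close> in \<open>T\<close>, and it may depend on the form, whose denominators it has to
  absorb. Since \<open>\<mu>\<close> vanishes on \<open>T\<close>, contraction removes no generator
  of \<open>T\<close>; this lets the induction treat the members of \<open>J\<close> one after
  another.\<close>

lemma mul_exact_on_cover:
  assumes homotopy: "\<And>t \<omega>. t \<in> T \<Longrightarrow> (\<And>S. \<omega> S \<in> M S) \<Longrightarrow> (\<And>S. \<omega> S \<noteq> 0 \<Longrightarrow> t \<in> S) \<Longrightarrow>
      \<exists>\<mu>. (\<forall>g\<in>T. \<mu> g = 0) \<and> (\<Sum>g\<in>UNIV. lam g * \<mu> g) = 1 \<and>
          (\<forall>S g. g \<notin> S \<longrightarrow> \<mu> g * \<omega> (insert g S) \<in> M S)"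
    and "J \<subseteq> T" "\<And>S. z S \<in> M S" "\<And>S. z S \<noteq> 0 \<Longrightarrow> card S = k \<and> S \<inter> J \<noteq> {}" "mul lam z = 0"
  shows "\<exists>w. (\<forall>S. w S \<in> M S) \<and> (\<forall>S. w S \<noteq> 0 \<longrightarrow> Suc (card S) = k \<and> S \<inter> J \<noteq> {}) \<and> mul lam w = z"
proof -
  have "finite J" by simp
  then show ?thesis using assms(2-)
  proof (induction J arbitrary: z rule: finite_induct)
    case empty
    then have "z = 0" by (auto simp: fun_eq_iff)
    then have "mul lam z = z" by (simp only: additive.zero[OF additive_ext_op[OF additive_times]])
    moreover have "z S = 0" for S using \<open>z = 0\<close> by simp
    ultimately show ?case using empty.prems(2) by (intro exI[of _ z]) blast
  next
    case (insert t J)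
    \<comment> \<open>The part of \<open>z\<close> whose terms avoid \<open>J\<close>. They all
      contain \<open>t\<close>, so the homotopy for \<open>t\<close> applies to it.\<close>
    define z' where "z' = (\<lambda>S. if S \<inter> J = {} then z S else 0)"
    have tT: "t \<in> T" and JT: "J \<subseteq> T" using insert.prems(1) by auto
    have z'M: "z' S \<in> M S" for S using insert.prems(2) by (simp add: z'_def M_zero)
    have z't: "t \<in> S" "card S = k" if "z' S \<noteq> 0" for S
      using insert.prems(3)[of S] that by (auto simp: z'_def split: if_splits)
    obtain \<mu> where \<mu>: "\<And>g. g \<in> T \<Longrightarrow> \<mu> g = 0" "(\<Sum>g\<in>UNIV. lam g * \<mu> g) = 1"
        "\<And>S g. g \<notin> S \<Longrightarrow> \<mu> g * z' (insert g S) \<in> M S"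
      using homotopy[of t z', OF tT z'M z't(1)] by blast
    define w' where "w' = contract \<mu> z'"
    have w'M: "w' S \<in> M S" for S
      unfolding w'_def contract_def mult.assoc by (intro M_sum M_es \<mu>(3)) auto
    have w's: "Suc (card S) = k" "t \<in> S" "S \<inter> J = {}" if nz: "w' S \<noteq> 0" for S
    proof -
      obtain g where g: "g \<notin> S" "\<mu> g * z' (insert g S) \<noteq> 0"
        using nz unfolding w'_def contract_def
        by (metis (no_types, lifting) ComplD mult.assoc mult_zero_right sum.neutral)
      then have *: "g \<notin> T" "z' (insert g S) \<noteq> 0" using \<mu>(1) by auto
      then show "Suc (card S) = k" "t \<in> S" "S \<inter> J = {}"
        using z't[OF *(2)] g tT by (auto simp: z'_def split: if_splits)
    qed
    define z'' where "z'' = z - mul lam w'"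
    have mz'': "mul lam z'' = 0"
      by (simp add: z''_def additive.diff[OF additive_ext_op[OF additive_times]] insert.prems(4) mul_square zero_fun_def)
    have z''s: "card S = k \<and> S \<inter> J \<noteq> {}" if nz: "z'' S \<noteq> 0" for S
    proof
      have "z S \<noteq> 0 \<or> mul lam w' S \<noteq> 0" using nz by (auto simp: z''_def)
      then show "card S = k"
      proof
        assume "mul lam w' S \<noteq> 0"
        \<comment> \<open>The truncated \<open>k - 1\<close> is harmless: a nonzero value comes from
          a nonzero value of \<open>w'\<close>, which forces \<open>k > 0\<close>.\<close>
        then have "card S = Suc (k - 1)" 
          by (rule ext_op_card[OF additive_times, rotated]) (use w's(1) in force)
        moreover have "k > 0" using \<open>mul lam w' S \<noteq> 0\<close> w's(1) ext_op_nonzero[OF additive_times, of lam w' S]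
          by fastforce
        ultimately show ?thesis by simp
      qed (use insert.prems(3) in blast)
      show "S \<inter> J \<noteq> {}"
      proof
        assume S: "S \<inter> J = {}"
        \<comment> \<open>Only generators outside \<open>T\<close> are contracted, so all sets
          involved avoid \<open>J\<close>; there \<open>z'\<close> agrees with \<open>z\<close> and
          \<open>mul lam z' = mul lam z = 0\<close>. Hence \<open>mul lam w'\<close> equals
          \<open>z'\<close> on such sets.\<close>
        have "contract \<mu> (mul lam z') S = 0"
          unfolding contract_def
        proof (intro sum.neutral ballI)
          fix g assume "g \<in> - S"
          show "es g S * \<mu> g * mul lam z' (insert g S) = 0"
          proof (cases "g \<in> T")
            case False
            then have "insert g S \<inter> J = {}" using JT S by auto
            then have "mul lam z' (insert g S) = mul lam z (insert g S)"
              unfolding ext_op_def z'_def by (intro sum.cong) auto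
            then show ?thesis using insert.prems(4) by simp
          qed (simp add: \<mu>(1))
        qed
        then have "mul lam w' S = z' S"
          using mul_contract[of lam \<mu> z' S] \<mu>(2) by (simp add: w'_def)
        then show False using nz S by (simp add: z''_def z'_def)
      qed
    qed
    have z''M: "z'' S \<in> M S" for S
      using insert.prems(2) mul_mem[of w'] w'M by (simp add: z''_def M_diff)
    obtain w where w: "\<And>S. w S \<in> M S" "\<And>S. w S \<noteq> 0 \<Longrightarrow> Suc (card S) = k \<and> S \<inter> J \<noteq> {}" "mul lam w = z''"
      using insert.IH[OF JT z''M z''s mz''] by blast
    show ?case
    proof (intro exI[of _ "w + w'"] conjI allI impI)
      show "(w + w') S \<in> M S" for S using w(1) w'M by (simp add: M_add)
      show "mul lam (w + w') = z"
        by (simp add: additive.add[OF additive_ext_op[OF additive_times]] w(3) z''_def)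
      fix S assume "(w + w') S \<noteq> 0"
      then have "w S \<noteq> 0 \<or> w' S \<noteq> 0" by auto
      then show "Suc (card S) = k" "S \<inter> insert t J \<noteq> {}" using w(2) w's by blast+
    qed
  qed
qed

lemma form_cx_restr:
  fixes e :: "'h::{finite,linorder} \<Rightarrow> 'g"
  assumes "inj e"
  shows "form_cx (\<lambda>g. lam (e g)) (\<lambda>g. del (e g)) (\<lambda>S. M (e ` S))"
proof (intro form_cx.intro twisted.intro form_cx_axioms.intro)
  show "lam (e g) * x \<in> M (e ` insert g S)" if "g \<notin> S" "x \<in> M (e ` S)" for g S x
    using that M_lam[of "e g" "e ` S"] assms by (simp add: inj_image_mem_iff)
  show "del (e g) x \<in> M (e ` insert g S)" if "g \<notin> S" "x \<in> M (e ` S)" for g S x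
    using that M_del[of "e g" "e ` S"] assms by (simp add: inj_image_mem_iff)
qed (auto simp: del_additive del_mult del_commute del_lam M_zero M_diff)

lemma coh_map_restr:
  fixes e :: "'h::{finite,linorder} \<Rightarrow> 'g"
  assumes e: "strict_mono e"
  shows "coh_map (fcx M lam del) (fcx (\<lambda>S. M (e ` S)) (\<lambda>g. lam (e g)) (\<lambda>g. del (e g))) k (restr e)"
proof (rule coh_mapI)
  have inj: "inj e" using strict_mono_imp_inj_on[OF e] .
  show "cochain (fcx M lam del)" by (rule cochain_fcx)
  show "cochain (fcx (\<lambda>S. M (e ` S)) (\<lambda>g. lam (e g)) (\<lambda>g. del (e g)))"
    by (rule form_cx.cochain_fcx[OF form_cx_restr[OF inj]])
  show "additive (restr e)" by (auto simp: additive_def restr_def fun_eq_iff)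
  show "restr e x \<in> fst (fcx (\<lambda>S. M (e ` S)) (\<lambda>g. lam (e g)) (\<lambda>g. del (e g))) j"
    if "x \<in> fst (fcx M lam del) j" for x j
    using that inj by (auto simp: fcx_def forms_def restr_def) (metis card_image inj_on_subset subset_UNIV)
  have "restr e (ext_op (tw lam del) x) = ext_op (tw (\<lambda>g. lam (e g)) (\<lambda>g. del (e g))) (restr e x)" for x
    unfolding restr_ext_op[OF e] tw_def ..
  then show "snd (fcx (\<lambda>S. M (e ` S)) (\<lambda>g. lam (e g)) (\<lambda>g. del (e g))) (restr e x) = restr e (snd (fcx M lam del) x)"
    for x by (simp add: fcx_def)
qed

text \<open>Extension by zero is a section of \<open>restr e\<close> that respects modules and
  degrees. It need not commute with the differential.\<close>

lemma extend_forms: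
  fixes e :: "'h::{finite,linorder} \<Rightarrow> 'g"
  assumes inj: "inj e" and x: "x \<in> forms (\<lambda>S. M (e ` S)) j"
  shows "extend e x \<in> forms M j"
proof -
  have "fps_nth (x (e -` S)) i \<in> M S \<and> (x (e -` S) \<noteq> 0 \<longrightarrow> card S = j)" if "S \<subseteq> range e" for S i
  proof -
    have S: "S = e ` (e -` S)" using that by auto
    have "card S = card (e -` S)" using card_vimage_inj[OF inj that] by simp
    then show ?thesis using x S by (auto simp: forms_def) (metis S)
  qed
  then show ?thesis by (auto simp: forms_def extend_def M_zero)
qed

text \<open>Restriction is surjective on forms, so it suffices that its kernel is exact. The kernel
  consists of forms whose terms all contain a generator outside \<open>range e\<close>. What remains
  is the long exact sequence, carried out on representatives.\<close>

theorem bij_betw_restr: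
  fixes e :: "'h::{finite,linorder} \<Rightarrow> 'g"
  assumes e: "strict_mono e"
    and homotopy: "\<And>t \<omega>. t \<notin> range e \<Longrightarrow> (\<And>S. \<omega> S \<in> M S) \<Longrightarrow> (\<And>S. \<omega> S \<noteq> 0 \<Longrightarrow> t \<in> S) \<Longrightarrow>
      \<exists>\<mu>. (\<forall>g. g \<notin> range e \<longrightarrow> \<mu> g = 0) \<and> (\<Sum>g\<in>UNIV. lam g * \<mu> g) = 1 \<and>
          (\<forall>S g. g \<notin> S \<longrightarrow> \<mu> g * \<omega> (insert g S) \<in> M S)"
    and "0 < k"
  shows "bij_betw (hmap (fcx (\<lambda>S. M (e ` S)) (\<lambda>g. lam (e g)) (\<lambda>g. del (e g))) k (restr e))
     (cohomology (fcx M lam del) k)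
     (cohomology (fcx (\<lambda>S. M (e ` S)) (\<lambda>g. lam (e g)) (\<lambda>g. del (e g))) k)"
proof -
  let ?C = "fcx M lam del" and ?D = "fcx (\<lambda>S. M (e ` S)) (\<lambda>g. lam (e g)) (\<lambda>g. del (e g))"
  let ?d = "ext_op (tw lam del)"
  have inj: "inj e" using strict_mono_imp_inj_on[OF e] .
  interpret coh_map ?C ?D k "restr e" by (rule coh_map_restr[OF e])
  have d_restr: "restr e (?d x) = ext_op (tw (\<lambda>g. lam (e g)) (\<lambda>g. del (e g))) (restr e x)" for x
    unfolding restr_ext_op[OF e] tw_def ..
  \<comment> \<open>Exactness of the kernel, with a primitive that again lies in the kernel.\<close>
  have cover: "\<exists>\<eta>\<in>forms M j. \<omega> = ?d \<eta> \<and> restr e \<eta> = 0"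
    if \<omega>: "\<omega> \<in> forms M (Suc j)" "restr e \<omega> = 0" "?d \<omega> = 0" for \<omega> j
  proof -
    let ?T = "- range e"
    let ?C = "{z. (\<forall>S. z S \<in> M S) \<and> (\<forall>S. z S \<noteq> 0 \<longrightarrow> card S = Suc j \<and> S \<inter> ?T \<noteq> {})}"
    let ?C' = "{z. (\<forall>S. z S \<in> M S) \<and> (\<forall>S. z S \<noteq> 0 \<longrightarrow> Suc (card S) = Suc j \<and> S \<inter> ?T \<noteq> {})}"
    obtain \<eta> where \<eta>: "\<And>k. coef \<eta> k \<in> ?C'" "\<And>k. coef (\<omega> - ?d \<eta>) k \<in> {0}"
    proof (rule series_exact[of "{0}" ?C ?C' \<omega>])
      show "\<exists>w\<in>?C'. z - mul lam w \<in> {0}" if "z \<in> ?C" "mul lam z \<in> {0}" for z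
      proof -
        have hom: "\<exists>\<mu>. (\<forall>g\<in>?T. \<mu> g = 0) \<and> (\<Sum>g\<in>UNIV. lam g * \<mu> g) = 1 \<and>
            (\<forall>S g. g \<notin> S \<longrightarrow> \<mu> g * \<omega> (insert g S) \<in> M S)"
          if "t \<in> ?T" "\<And>S. \<omega> S \<in> M S" "\<And>S. \<omega> S \<noteq> 0 \<Longrightarrow> t \<in> S" for t \<omega>
          using homotopy[of t \<omega>] that unfolding Ball_def Compl_iff by blast
        have "mul lam z = 0" using that(2) by simp
        then have "\<exists>w. (\<forall>S. w S \<in> M S) \<and> (\<forall>S. w S \<noteq> 0 \<longrightarrow> Suc (card S) = Suc j \<and> S \<inter> ?T \<noteq> {}) \<and> mul lam w = z"
          using that(1) by (intro mul_exact_on_cover[of ?T ?T z "Suc j", OF hom]) simp_all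
        then obtain w where "w \<in> ?C'" "mul lam w = z" by blast
        then show ?thesis by (intro bexI[of _ w]) simp_all
      qed
      show "z - ext_op del w \<in> ?C" if "z \<in> ?C" "w \<in> ?C'" for z w
      proof -
        have "card S = Suc j \<and> S \<inter> ?T \<noteq> {}" if nz: "ext_op del w S \<noteq> 0" for S
        proof -
          obtain g where g: "g \<in> S" "w (S - {g}) \<noteq> 0"
            using ext_op_nonzero[OF del_additive nz] by blast
          then have "Suc (card (S - {g})) = Suc j" "(S - {g}) \<inter> ?T \<noteq> {}" "g \<in> S"
            using \<open>w \<in> ?C'\<close> g by simp_all
          then show ?thesis using card.remove[of S g] by (metis Diff_subset Int_mono finite order_refl subset_empty)
        qed
        moreover have "ext_op del w S \<in> M S" for S using \<open>w \<in> ?C'\<close> by (auto intro!: ext_del_mem)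
        moreover have "z S \<noteq> 0 \<or> ext_op del w S \<noteq> 0" if "(z - ext_op del w) S \<noteq> 0" for S
          using that by auto
        moreover have "z S \<in> M S" "z S \<noteq> 0 \<Longrightarrow> card S = Suc j \<and> S \<inter> ?T \<noteq> {}" for S
          using \<open>z \<in> ?C\<close> by simp_all
        ultimately show ?thesis unfolding mem_Collect_eq minus_apply by (meson M_diff)
      qed
      show "coef \<omega> k \<in> ?C" for k
      proof -
        have "S \<inter> ?T \<noteq> {}" if "coef \<omega> k S \<noteq> 0" for S
        proof
          assume "S \<inter> ?T = {}"
          then have "S = e ` (e -` S)" by auto
          then have "coef \<omega> k S = coef (restr e \<omega>) k (e -` S)" by (simp add: coef_def restr_def)
          then show False using that \<omega>(2) by (simp add: coef_def)
        qed
        then show ?thesis using \<omega>(1) by (auto simp: forms_iff_coef)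
      qed
      show "coef (?d \<omega>) k \<in> {0}" for k using \<omega>(3) by (simp add: coef_def fun_eq_iff)
    qed (auto simp: additive.zero[OF additive_ext_op[OF del_additive]])
    have "\<eta> \<in> forms M j" using \<eta>(1) by (auto simp: forms_iff_coef)
    moreover have "\<omega> = ?d \<eta>" using \<eta>(2) by (intro coef_eqI) simp
    moreover have "restr e \<eta> = 0"
    proof -
      have "coef \<eta> k (e ` S) = 0" for k S using \<eta>(1)[of k] by blast
      then show ?thesis by (simp add: restr_def coef_def fun_eq_iff fps_eq_iff)
    qed
    ultimately show ?thesis by blast
  qed
  note ext_mem = extend_forms[OF inj]
  obtain j where k: "k = Suc j" using \<open>0 < k\<close> by (cases k) auto
  show ?thesis
  proof (rule bij_betw_hmap)
    fix w assume "w \<in> cocycles ?D k"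
    then have w: "w \<in> forms (\<lambda>S. M (e ` S)) k" "ext_op (tw (\<lambda>g. lam (e g)) (\<lambda>g. del (e g))) w = 0"
      by (auto simp: cocycles_def fcx_def)
    \<comment> \<open>\<open>extend e w\<close> may fail to be closed, but its differential is a
      cocycle of the kernel, and a primitive of it gives the correction.\<close>
    let ?y = "?d (extend e w)"
    have "?y \<in> forms M (Suc k)" using C.d_mem[of "extend e w" k] ext_mem[OF w(1)] by (simp add: fcx_def)
    moreover have "restr e ?y = 0" by (simp add: d_restr restr_extend[OF inj] w(2))
    ultimately obtain \<eta> where \<eta>: "\<eta> \<in> forms M k" "?y = ?d \<eta>" "restr e \<eta> = 0" using cover d_d by blast
    have "extend e w - \<eta> \<in> cocycles ?C k"
      using C.diff_mem[of "extend e w" k \<eta>] ext_mem[OF w(1)] \<eta>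
      by (simp add: cocycles_def fcx_def additive.diff[OF additive_d])
    moreover have "restr e (extend e w - \<eta>) - w = 0"
      using \<eta>(3) by (simp add: additive.diff[OF additive] restr_extend[OF inj])
    ultimately show "\<exists>z\<in>cocycles ?C k. restr e z - w \<in> coboundaries ?D k"
      using D.coboundaries_zero by metis
  next
    fix z assume "z \<in> cocycles ?C k" and "restr e z \<in> coboundaries ?D k"
    then obtain y where z: "z \<in> forms M k" "?d z = 0" and y: "y \<in> forms (\<lambda>S. M (e ` S)) j"
        "restr e z = ext_op (tw (\<lambda>g. lam (e g)) (\<lambda>g. del (e g))) y"
      by (auto simp: cocycles_def fcx_def coboundaries_def k)
    let ?y = "z - ?d (extend e y)"
    have "?y \<in> forms M k"
      using C.diff_mem[of z k "?d (extend e y)"] C.d_mem[of "extend e y" j] ext_mem[OF y(1)] z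
      by (simp add: fcx_def k)
    moreover have "restr e ?y = 0"
      by (simp add: additive.diff[OF additive] d_restr restr_extend[OF inj] y(2))
    moreover have "?d ?y = 0" by (simp add: additive.diff[OF additive_d] d_d z(2))
    ultimately obtain \<eta> where \<eta>: "\<eta> \<in> forms M j" "?y = ?d \<eta>" using cover unfolding k by blast
    have "z = ?d (extend e y + \<eta>)" using \<eta>(2) by (simp add: additive.add[OF additive_d] algebra_simps)
    moreover have "extend e y + \<eta> \<in> forms M j"
      using C.add_mem[of "extend e y" j \<eta>] ext_mem[OF y(1)] \<eta>(1) by (simp add: fcx_def)
    ultimately show "z \<in> coboundaries ?C k" by (auto simp: coboundaries_def k fcx_def)
  qed
qed

end

section \<open>The three comparison isomorphisms: localization, canonical map, change of Cech
  family\<close>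

section \<open>The de Rham and Cech--de Rham complexes\<close>

definition cech_lam :: "'n::linorder mpoly \<Rightarrow> 'i + 'n \<Rightarrow> 'n ratfun" where
  "cech_lam \<phi> = case_sum (\<lambda>_. 1) (\<lambda>j. emb (mpderiv j \<phi>))"

definition cech_del :: "'i + 'n \<Rightarrow> 'n::linorder ratfun \<Rightarrow> 'n ratfun" where
  "cech_del = case_sum (\<lambda>_ _. 0) rat_deriv"

definition cech_mod :: "('i \<Rightarrow> 'n mpoly) \<Rightarrow> ('i + 'n) set \<Rightarrow> 'n::{finite,linorder} ratfun set" where
  "cech_mod s S = loc_at s (Inl -` S)"

abbreviation dR_lam :: "'n::linorder mpoly \<Rightarrow> 'n \<Rightarrow> 'n ratfun" where
  "dR_lam \<phi> \<equiv> \<lambda>j. emb (mpderiv j \<phi>)"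

lemma cech_lam_simps [simp]: "cech_lam \<phi> (Inl i) = 1" "cech_lam \<phi> (Inr j) = emb (mpderiv j \<phi>)"
  by (simp_all add: cech_lam_def)

lemma cech_del_simps [simp]: "cech_del (Inl i) = (\<lambda>_. 0)" "cech_del (Inr j) = rat_deriv j"
  by (simp_all add: cech_del_def)

lemma twisted_d_eq:
  "twisted_d \<iota> \<phi> \<omega> = (\<Sum>j\<in>UNIV. gen (\<iota> j) \<^bold>\<and> (\<lambda>S. tw (dR_lam \<phi>) rat_deriv j (\<omega> S)))"
  by (simp add: twisted_d_def tw_def)

lemma deRham_eq: "deRham R \<phi> = fcx (\<lambda>_. R) (dR_lam \<phi>) rat_deriv"
proof -
  have "twisted_d id \<phi> = ext_op (tw (dR_lam \<phi>) rat_deriv)"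
    unfolding fun_eq_iff[of "twisted_d id \<phi>"] twisted_d_eq id_apply sum_gen_wedge by simp
  then show ?thesis by (simp add: deRham_def fcx_def forms_def fun_eq_iff)
qed

lemma tw_cech_Inl: "tw (cech_lam \<phi>) cech_del (Inl i) F = F"
  by (simp add: tw_def fps_eq_iff fps_mult_fps_X_commute)

lemma tw_cech_Inr: "tw (cech_lam \<phi>) cech_del (Inr j) F = tw (dR_lam \<phi>) rat_deriv j F"
  by (simp add: tw_def)

lemma cech_eq: "cech s \<phi> = fcx (cech_mod s) (cech_lam \<phi>) cech_del"
proof -
  have "twisted_d Inr \<phi> \<omega> + (\<Sum>i\<in>UNIV. gen (Inl i) \<^bold>\<and> \<omega>) = ext_op (tw (cech_lam \<phi>) cech_del) \<omega>"
    for \<omega> :: "('a + 'b) set \<Rightarrow> _"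
  proof -
    have "ext_op (tw (cech_lam \<phi>) cech_del) \<omega> =
      (\<Sum>g\<in>UNIV <+> UNIV. gen g \<^bold>\<and> (\<lambda>S. tw (cech_lam \<phi>) cech_del g (\<omega> S)))"
      unfolding UNIV_Plus_UNIV sum_gen_wedge ..
    also have "\<dots> = (\<Sum>i\<in>UNIV. gen (Inl i) \<^bold>\<and> \<omega>) + twisted_d Inr \<phi> \<omega>"
      by (subst sum.Plus) (simp_all add: twisted_d_eq tw_cech_Inl tw_cech_Inr)
    finally show ?thesis by (simp add: add.commute)
  qed
  moreover have "(\<forall>A B j. fps_nth (\<omega> (A <+> B)) j \<in> loc_at s A) \<longleftrightarrow> (\<forall>S j. fps_nth (\<omega> S) j \<in> loc_at s (Inl -` S))"
    for \<omega> :: "('a + 'b) set \<Rightarrow> _"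
  proof -
    have "S = (Inl -` S) <+> (Inr -` S)" for S :: "('a + 'b) set"
    proof (rule set_eqI)
      show "x \<in> S \<longleftrightarrow> x \<in> (Inl -` S) <+> (Inr -` S)" for x by (cases x) auto
    qed
    moreover have "Inl -` (A <+> B) = A" for A :: "'a set" and B :: "'b set" by auto
    ultimately show ?thesis by metis
  qed
  ultimately show ?thesis by (simp add: cech_def fcx_def forms_def fun_eq_iff cech_mod_def)
qed

lemma twisted_dR: "twisted (dR_lam \<phi>) rat_deriv"
  by (intro twisted.intro additive_rat_deriv rat_deriv_mult rat_deriv_commute)
     (simp only: rat_deriv_emb mpderiv_commute)

lemma twisted_cech: "twisted (cech_lam \<phi>) (cech_del :: 'i::{finite,linorder} + 'n::{finite,linorder} \<Rightarrow> _)"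
proof (rule twisted.intro)
  fix g h :: "'i + 'n" and x y
  show "additive (cech_del g)"
    by (cases g) (auto simp: cech_del_def additive_zero additive_rat_deriv)
  show "cech_del g (x * y) = cech_del g x * y + x * cech_del g y"
    by (cases g) (auto simp: rat_deriv_mult)
  show "cech_del g (cech_del h x) = cech_del h (cech_del g x)"
    by (cases g; cases h) (auto simp: rat_deriv_commute)
  show "cech_del g (cech_lam \<phi> h) = cech_del h (cech_lam \<phi> g)"
    by (cases g; cases h) (simp_all add: rat_deriv_emb mpderiv_commute)
qed

lemma form_cx_dR: "diff_ring R \<Longrightarrow> form_cx (dR_lam \<phi>) rat_deriv (\<lambda>_. R)"
  by (intro form_cx.intro twisted_dR form_cx_axioms.intro)
     (simp_all add: diff_ring.zero_mem diff_ring.diff_mem diff_ring.mult_mem diff_ring.emb_mem diff_ring.deriv_mem)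

lemma form_cx_cech:
  fixes s :: "'i::{finite,linorder} \<Rightarrow> 'n::{finite,linorder} mpoly"
  assumes nz: "\<And>i. s i \<noteq> 0"
  shows "form_cx (cech_lam \<phi>) cech_del (cech_mod s)"
proof (intro form_cx.intro twisted_cech form_cx_axioms.intro)
  note R = diff_ring_loc_at[of s, OF nz]
  fix S :: "('i + 'n) set" and x y g
  show "0 \<in> cech_mod s S" unfolding cech_mod_def by (rule diff_ring.zero_mem[OF R])
  show "x - y \<in> cech_mod s S" if "x \<in> cech_mod s S" "y \<in> cech_mod s S"
    using that unfolding cech_mod_def by (rule diff_ring.diff_mem[OF R])
  have mono: "cech_mod s S \<subseteq> cech_mod s (insert g S)"
    unfolding cech_mod_def by (rule loc_at_mono[OF _ nz]) auto
  show "cech_lam \<phi> g * x \<in> cech_mod s (insert g S)" if "x \<in> cech_mod s S"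
    using that mono unfolding cech_mod_def
    by (cases g) (auto intro!: diff_ring.mult_mem[OF R] diff_ring.emb_mem[OF R])
  show "cech_del g x \<in> cech_mod s (insert g S)" if "x \<in> cech_mod s S"
    using that mono unfolding cech_mod_def
    by (cases g) (auto intro!: diff_ring.deriv_mem[OF R] diff_ring.zero_mem[OF R])
qed

lemma cochain_deRham: "diff_ring R \<Longrightarrow> cochain (deRham R \<phi>)"
  unfolding deRham_eq by (rule form_cx.cochain_fcx[OF form_cx_dR])

lemma cochain_cech:
  fixes s :: "'i::{finite,linorder} \<Rightarrow> 'n::{finite,linorder} mpoly"
  assumes "\<And>i. s i \<noteq> 0"
  shows "cochain (cech s \<phi>)"
  unfolding cech_eq by (rule form_cx.cochain_fcx[OF form_cx_cech[of s, OF assms]])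

subsection \<open>Localization\<close>

lemma common_denominator:
  assumes "finite A" "\<And>S. S \<in> A \<Longrightarrow> z S \<in> Qm"
  shows "\<exists>b. lookup0 b \<noteq> 0 \<and> (\<forall>S\<in>A. emb b * z S \<in> range emb)"
  using assms
proof (induction A rule: finite_induct)
  case empty
  show ?case by (rule exI[of _ 1]) simp
next
  case (insert S A)
  obtain b where b: "lookup0 b \<noteq> 0" "\<forall>S\<in>A. emb b * z S \<in> range emb" using insert by auto
  obtain a d where d: "z S = emb a / emb d" "lookup0 d \<noteq> 0" "d \<noteq> 0" using QmE[of "z S"] insert.prems by blast
  have "emb (b * d) * z S = emb (b * a)" using d by simp
  moreover have "emb (b * d) * z S' = emb d * (emb b * z S')" for S' by simp
  moreover have "emb d * (emb b * z S') \<in> range emb" if "S' \<in> A" for S'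
    using b(2) that diff_ring.mult_mem[OF diff_ring_poly rangeI] by blast
  ultimately have "\<forall>S'\<in>insert S A. emb (b * d) * z S' \<in> range emb" by (metis insert_iff rangeI)
  then show ?case using b(1) d(2) by (intro exI[of _ "b * d"]) (simp only: lookup_mult_0 mult_eq_0_iff, blast)
qed

text \<open>Koszul exactness of local forms modulo polynomial ones. If b clears the denominators of
  z and 1 = c b + sum q_i \<phi>_i, the homotopy identity expresses the error as c b z plus the
  contraction of d\<phi> wedge z, and both are polynomial.\<close>

lemma mul_exact_mod_poly:
  fixes z :: "'n::{finite,linorder} set \<Rightarrow> 'n ratfun"
  assumes comax: "\<And>b. lookup0 b \<noteq> 0 \<Longrightarrow> \<exists>c q. 1 = c * b + (\<Sum>i\<in>UNIV. q i * mpderiv i \<phi>)"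
    and z: "\<And>S. z S \<in> Qm" "\<And>S. z S \<noteq> 0 \<Longrightarrow> card S = k" "\<And>S. mul (dR_lam \<phi>) z S \<in> range emb"
  shows "\<exists>w. (\<forall>S. w S \<in> Qm) \<and> (\<forall>S. w S \<noteq> 0 \<longrightarrow> Suc (card S) = k) \<and>
     (\<forall>S. z S - mul (dR_lam \<phi>) w S \<in> range emb)"
proof -
  note P = diff_ring_poly
  interpret fP: form_cx "dR_lam \<phi>" rat_deriv "\<lambda>_. range emb" by (rule form_cx_dR[OF P])
  interpret fQ: form_cx "dR_lam \<phi>" rat_deriv "\<lambda>_. Qm" by (rule form_cx_dR[OF diff_ring_Qm])
  obtain b where b: "lookup0 b \<noteq> 0" "\<And>S. emb b * z S \<in> range emb"
    using common_denominator[of UNIV z] z(1) by auto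
  obtain c q where "1 = c * b + (\<Sum>i\<in>UNIV. q i * mpderiv i \<phi>)" using comax[OF b(1)] by blast
  then have "emb (1 :: 'n mpoly) = emb (c * b + (\<Sum>i\<in>UNIV. q i * mpderiv i \<phi>))" by (rule arg_cong)
  then have e: "(\<Sum>i\<in>UNIV. emb (mpderiv i \<phi>) * emb (q i)) = 1 - emb c * emb b"
    by (simp add: mult.commute algebra_simps)
  define w where "w = contract (\<lambda>i. emb (q i)) z"
  have "z S - mul (dR_lam \<phi>) w S = emb c * (emb b * z S) + contract (\<lambda>i. emb (q i)) (mul (dR_lam \<phi>) z) S" for S
    using mul_contract[of "dR_lam \<phi>" "\<lambda>i. emb (q i)" z S] unfolding e w_def by (simp add: algebra_simps)
  moreover have "contract (\<lambda>i. emb (q i)) (mul (dR_lam \<phi>) z) S \<in> range emb" for S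
    unfolding contract_def mult.assoc
    by (intro fP.M_sum fP.M_es diff_ring.mult_mem[OF P] z(3)) blast
  ultimately have 1: "z S - mul (dR_lam \<phi>) w S \<in> range emb" for S
    by (simp only: diff_ring.add_mem[OF P diff_ring.mult_mem[OF P rangeI b(2)]])
  have 2: "w S \<in> Qm" for S
    unfolding w_def contract_def mult.assoc by (intro fQ.M_sum fQ.M_es Qm.mult_mem z(1) Qm.emb_mem)
  have 3: "Suc (card S) = k" if nz: "w S \<noteq> 0" for S
  proof -
    obtain g where "g \<in> - S" "es g S * emb (q g) * z (insert g S) \<noteq> 0"
      using nz unfolding w_def contract_def by (meson sum.not_neutral_contains_not_neutral)
    then show ?thesis using z(2)[of "insert g S"] by simp
  qed
  show ?thesis using 1 2 3 by blast
qed

text \<open>A local form with polynomial differential becomes polynomial after subtraction of an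
  exact form (\<open>lift\<close>). Applied to cocycles this gives surjectivity, applied to local
  primitives of polynomial cocycles it gives injectivity.\<close>

theorem bij_betw_localize:
  fixes \<phi> :: "'n::{finite,linorder} mpoly"
  assumes comax: "\<And>b. lookup0 b \<noteq> 0 \<Longrightarrow> \<exists>c q. 1 = c * b + (\<Sum>i\<in>UNIV. q i * mpderiv i \<phi>)"
  shows "coh_map (deRham (range emb) \<phi>) (deRham Qm \<phi>) CARD('n) (\<lambda>\<omega>. \<omega>)"
    and "bij_betw (localize_map \<phi>) (H_poly \<phi>) (H_loc \<phi>)"
proof -
  let ?P = "deRham (range emb) \<phi>" and ?Q = "deRham Qm \<phi>" and ?d = "ext_op (tw (dR_lam \<phi>) rat_deriv)"
  let ?n = "CARD('n)"
  interpret P: form_cx "dR_lam \<phi>" rat_deriv "\<lambda>_. range emb" by (rule form_cx_dR[OF diff_ring_poly])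
  have sub: "range emb \<subseteq> (Qm :: 'n ratfun set)" using Qm.emb_mem by blast
  show coh: "coh_map ?P ?Q ?n (\<lambda>\<omega>. \<omega>)"
    by (rule coh_mapI[OF cochain_deRham[OF diff_ring_poly] cochain_deRham[OF diff_ring_Qm] additive_id])
      (use sub in \<open>auto simp: deRham_eq fcx_def forms_def\<close>)
  interpret coh_map ?P ?Q ?n "\<lambda>\<omega>. \<omega>" by (rule coh)
  \<comment> \<open>In degree 0 there is no form to subtract, whereas the truncated
    \<open>k - 1\<close> would again mean degree 0; hence the case distinction.\<close>
  have lift: "\<exists>\<eta>. \<eta> \<in> (if k = 0 then {0} else forms (\<lambda>_. Qm) (k - 1)) \<and> \<omega> - ?d \<eta> \<in> forms (\<lambda>_. range emb) k"
    if \<omega>: "\<omega> \<in> forms (\<lambda>_. Qm) k" "\<And>j S. coef (?d \<omega>) j S \<in> range emb" for \<omega> k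
  proof -
    let ?N = "{z :: 'n set \<Rightarrow> 'n ratfun. \<forall>S. z S \<in> range emb}"
    let ?C = "{z :: 'n set \<Rightarrow> 'n ratfun. (\<forall>S. z S \<in> Qm) \<and> (\<forall>S. z S \<noteq> 0 \<longrightarrow> card S = k)}"
    let ?C' = "{z :: 'n set \<Rightarrow> 'n ratfun. (\<forall>S. z S \<in> Qm) \<and> (\<forall>S. z S \<noteq> 0 \<longrightarrow> Suc (card S) = k)}"
    interpret Q: form_cx "dR_lam \<phi>" rat_deriv "\<lambda>_. Qm" by (rule form_cx_dR[OF diff_ring_Qm])
    obtain \<eta> where \<eta>: "\<And>j. coef \<eta> j \<in> ?C'" "\<And>j. coef (\<omega> - ?d \<eta>) j \<in> ?N"
    proof (rule P.series_exact[of ?N ?C ?C' \<omega>])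
      note * = that
      show "\<exists>w\<in>?C'. z - mul (dR_lam \<phi>) w \<in> ?N" if "z \<in> ?C" "mul (dR_lam \<phi>) z \<in> ?N" for z
      proof -
        have "\<exists>w. (\<forall>S. w S \<in> Qm) \<and> (\<forall>S. w S \<noteq> 0 \<longrightarrow> Suc (card S) = k) \<and>
            (\<forall>S. z S - mul (dR_lam \<phi>) w S \<in> range emb)"
          using that by (intro mul_exact_mod_poly[OF comax]) simp_all
        then obtain w where "\<forall>S. w S \<in> Qm" "\<forall>S. w S \<noteq> 0 \<longrightarrow> Suc (card S) = k"
          "\<forall>S. z S - mul (dR_lam \<phi>) w S \<in> range emb" by blast
        then show ?thesis by (intro bexI[of _ w]) simp_all
      qed
      show "z - ext_op rat_deriv w \<in> ?C" if zw: "z \<in> ?C" "w \<in> ?C'" for z w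
      proof -
        have "card S = k" if nz: "ext_op rat_deriv w S \<noteq> 0" for S
        proof -
          obtain g where g: "g \<in> S" "w (S - {g}) \<noteq> 0"
            using Q.ext_op_nonzero[OF P.del_additive nz] by blast
          then have "Suc (card (S - {g})) = k" using zw(2) unfolding mem_Collect_eq by blast
          then show ?thesis by (metis g(1) card.remove finite)
        qed
        moreover have "z S \<noteq> 0 \<or> ext_op rat_deriv w S \<noteq> 0" if "(z - ext_op rat_deriv w) S \<noteq> 0" for S
          using that by auto
        moreover have "ext_op rat_deriv w S \<in> Qm" for S using zw by (intro Q.ext_del_mem) simp
        moreover have "z S \<in> Qm" "z S \<noteq> 0 \<Longrightarrow> card S = k" for S using zw by simp_all
        ultimately show ?thesis unfolding mem_Collect_eq minus_apply by (meson Qm.diff_mem)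
      qed
      show "coef \<omega> j \<in> ?C" for j using \<omega>(1) by (simp add: forms_iff_coef)
      show "coef (?d \<omega>) j \<in> ?N" for j using \<omega>(2) by simp
      show thesis if "\<And>j. coef \<eta> j \<in> ?C'" "\<And>j. coef (\<omega> - ?d \<eta>) j \<in> ?N" for \<eta>
        by (rule *[OF that])
    qed (use P.M_zero P.M_diff P.ext_del_mem in simp_all)
    have "\<eta> \<in> (if k = 0 then {0} else forms (\<lambda>_. Qm) (k - 1))"
    proof (cases k)
      case 0
      then have "coef \<eta> j S = 0" for j S using \<eta>(1)[of j] by simp
      then have "\<eta> = 0" by (intro coef_eqI) (auto simp: coef_def fun_eq_iff)
      then show ?thesis using 0 by simp
    qed (use \<eta>(1) in \<open>auto simp: forms_iff_coef\<close>)
    moreover have "\<omega> - ?d \<eta> \<in> forms (\<lambda>_. range emb) k"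
    proof -
      have "?d \<eta> \<in> forms (\<lambda>_. Qm) k"
        using \<open>\<eta> \<in> _\<close> D.d_mem[of \<eta> "k - 1"] D.zero_mem[of k] additive.zero[OF P.additive_d]
        by (cases k) (auto simp: deRham_eq fcx_def)
      then have "\<omega> - ?d \<eta> \<in> forms (\<lambda>_. Qm) k"
        using D.diff_mem[of \<omega> k "?d \<eta>"] \<omega>(1) by (simp add: deRham_eq fcx_def)
      then show ?thesis using \<eta>(2) by (simp add: forms_iff_coef)
    qed
    ultimately show ?thesis by blast
  qed
  obtain m where m: "?n = Suc m" by (metis card_gt_0_iff finite UNIV_not_empty gr0_implies_Suc)
  show "bij_betw (localize_map \<phi>) (H_poly \<phi>) (H_loc \<phi>)"
    unfolding localize_map_def
  proof (rule bij_betw_hmap)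
    fix w assume "w \<in> cocycles ?Q ?n"
    then have w: "w \<in> forms (\<lambda>_. Qm) ?n" "?d w = 0" by (auto simp: cocycles_def deRham_eq fcx_def)
    have "coef (?d w) j S \<in> range emb" for j S using w(2) P.M_zero by (simp add: coef_def)
    then obtain \<eta> where \<eta>: "\<eta> \<in> forms (\<lambda>_. Qm) m" "w - ?d \<eta> \<in> forms (\<lambda>_. range emb) ?n"
      using lift[OF w(1)] m by auto
    have "w - ?d \<eta> \<in> cocycles ?P ?n"
      using \<eta>(2) w(2) by (simp add: cocycles_def deRham_eq fcx_def additive.diff[OF P.additive_d] P.d_d)
    moreover have "(w - ?d \<eta>) - w \<in> coboundaries ?Q ?n"
      using \<eta>(1) D.coboundaries_minus[OF D.coboundaryI, of \<eta> m]
      by (simp add: m) (simp add: deRham_eq fcx_def)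
    ultimately show "\<exists>z\<in>cocycles ?P ?n. z - w \<in> coboundaries ?Q ?n" by blast
  next
    fix z assume "z \<in> cocycles ?P ?n" "z \<in> coboundaries ?Q ?n"
    then obtain y where z: "z \<in> forms (\<lambda>_. range emb) ?n" and y: "y \<in> forms (\<lambda>_. Qm) m" "z = ?d y"
      by (auto simp: cocycles_def coboundaries_def deRham_eq fcx_def m)
    have "coef (?d y) j S \<in> range emb" for j S using z y(2) by (simp add: forms_iff_coef)
    then obtain \<eta> where \<eta>: "y - ?d \<eta> \<in> forms (\<lambda>_. range emb) m" using lift[OF y(1)] by blast
    have "z = ?d (y - ?d \<eta>)" by (simp add: additive.diff[OF P.additive_d] P.d_d y(2))
    then show "z \<in> coboundaries ?P ?n" using \<eta> by (simp add: coboundaries_def deRham_eq fcx_def m)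
  qed
qed

subsection \<open>Local cohomology\<close>

lemma strict_mono_Inl: "strict_mono (Inl :: 'a::linorder \<Rightarrow> 'a + 'b::linorder)"
  by (auto simp: strict_mono_def less_sum_def less_eq_sum_def)

lemma strict_mono_Inr: "strict_mono (Inr :: 'b::linorder \<Rightarrow> 'a::linorder + 'b)"
  by (auto simp: strict_mono_def less_sum_def less_eq_sum_def)

lemma strict_mono_map_sum:
  assumes "strict_mono (e :: 'a::linorder \<Rightarrow> 'b::linorder)"
  shows "strict_mono (map_sum e id :: 'a + 'c::linorder \<Rightarrow> 'b + 'c)"
proof (rule strict_monoI)
  fix x y :: "'a + 'c" assume "x < y"
  then show "map_sum e id x < map_sum e id y"
    by (cases x; cases y)
       (auto simp: less_sum_def less_eq_sum_def strict_mono_less[OF assms] strict_mono_less_eq[OF assms])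
qed

text \<open>Terms without \<alpha>'s have coefficients in \<open>loc_at s {}\<close>, that is in
  \<open>Qm\<close>; so the local de Rham complex is the restriction of the Cech complex along
  \<open>Inr\<close>.\<close>

lemma deRham_restr:
  fixes s :: "'i::{finite,linorder} \<Rightarrow> 'n::{finite,linorder} mpoly"
  shows "deRham Qm \<phi> = fcx (\<lambda>S. cech_mod s (Inr ` S)) (\<lambda>g. cech_lam \<phi> (Inr g :: 'i + 'n))
    (\<lambda>g. cech_del (Inr g :: 'i + 'n))"
proof -
  have "cech_mod s (Inr ` S) = Qm" for S
  proof -
    have "Inl -` (Inr ` S) = ({} :: 'i set)" by auto
    then show ?thesis unfolding cech_mod_def by simp
  qed
  then show ?thesis by (simp add: deRham_eq)
qed

lemma loc_at_inverse:
  fixes s :: "'i::finite \<Rightarrow> 'n::{finite,linorder} mpoly"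
  assumes nz: "\<And>i. s i \<noteq> 0" and "i \<in> A"
  shows "1 / emb (s i) ^ k \<in> loc_at s A"
  using loc_atI[OF Qm.one_mem, where s = s and A = "{i}" and k = k] loc_at_mono[of "{i}" A s] assms by auto

text \<open>On terms containing \<alpha>_i the derivative \<phi>_i is invertible, so contraction
  along dx_i with weight 1 / \<phi>_i is a homotopy there. The sign freedom in \<open>s\<close>
  allows the gradient of f to serve for the twists by f and by -f alike.\<close>

theorem bij_betw_can_map:
  fixes s :: "'n::{finite,linorder} \<Rightarrow> 'n mpoly"
  assumes nz: "\<And>i. s i \<noteq> 0" and s: "\<And>i. s i = mpderiv i \<phi> \<or> s i = - mpderiv i \<phi>"
  shows "coh_map (cech s \<phi>) (deRham Qm \<phi>) CARD('n) (restr Inr)"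
    and "bij_betw (can_map \<phi>) (H_supp s \<phi>) (H_loc \<phi>)"
proof -
  interpret form_cx "cech_lam \<phi>" cech_del "cech_mod s" by (rule form_cx_cech[of s, OF nz])
  show "coh_map (cech s \<phi>) (deRham Qm \<phi>) CARD('n) (restr Inr)"
    unfolding cech_eq deRham_restr[of \<phi> s] by (rule coh_map_restr[OF strict_mono_Inr])
  show "bij_betw (can_map \<phi>) (H_supp s \<phi>) (H_loc \<phi>)"
    unfolding can_map_def cech_eq deRham_restr[of \<phi> s]
  proof (rule bij_betw_restr[OF strict_mono_Inr])
    fix t :: "'n + 'n" and \<omega> :: "('n + 'n) set \<Rightarrow> 'n ratfun"
    assume "t \<notin> range Inr" and \<omega>: "\<And>S. \<omega> S \<in> cech_mod s S" "\<And>S. \<omega> S \<noteq> 0 \<Longrightarrow> t \<in> S"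
    then obtain i where t: "t = Inl i" by (cases t) auto
    let ?\<mu> = "\<lambda>g :: 'n + 'n. if g = Inr i then 1 / emb (mpderiv i \<phi>) else 0"
    have nz': "emb (mpderiv i \<phi>) \<noteq> 0" using s[of i] nz[of i] by auto
    have "(\<Sum>g\<in>UNIV. cech_lam \<phi> g * ?\<mu> g) = (\<Sum>g\<in>(UNIV :: ('n + 'n) set). if g = Inr i then cech_lam \<phi> g * (1 / emb (mpderiv i \<phi>)) else 0)"
      by (intro sum.cong) auto
    then have "(\<Sum>g\<in>UNIV. cech_lam \<phi> g * ?\<mu> g) = 1"
      using nz' by simp
    moreover have "?\<mu> g * \<omega> (insert g S) \<in> cech_mod s S" for g S
    proof (cases "g = Inr i \<and> \<omega> (insert g S) \<noteq> 0")
      case True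
      \<comment> \<open>\<open>insert g S\<close> contains \<open>Inl i\<close> while
        \<open>g\<close> is \<open>Inr i\<close>; so \<open>S\<close> itself contains
        \<open>Inl i\<close>, and division by \<phi>_i is allowed on \<open>S\<close>.\<close>
      then have "i \<in> Inl -` S" using \<omega>(2)[of "insert g S"] t by auto
      then have "1 / emb (s i) ^ 1 \<in> loc_at s (Inl -` S)" by (rule loc_at_inverse[of s, OF nz])
      then have a: "1 / emb (mpderiv i \<phi>) \<in> loc_at s (Inl -` S)"
        using s[of i] diff_ring.minus_mem[OF diff_ring_loc_at[of s, OF nz]] by fastforce
      have "\<omega> (insert g S) \<in> loc_at s (Inl -` S)"
        using \<omega>(1)[of "insert g S"] True unfolding cech_mod_def by (simp add: vimage_def)
      from diff_ring.mult_mem[OF diff_ring_loc_at[of s, OF nz] a this] show ?thesis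
        using True unfolding cech_mod_def by simp
    qed (auto simp: M_zero)
    ultimately show "\<exists>\<mu>. (\<forall>g. g \<notin> range Inr \<longrightarrow> \<mu> g = 0) \<and> (\<Sum>g\<in>UNIV. cech_lam \<phi> g * \<mu> g) = 1 \<and>
        (\<forall>S g. g \<notin> S \<longrightarrow> \<mu> g * \<omega> (insert g S) \<in> cech_mod s S)"
      by (intro exI[of _ ?\<mu>]) auto
  qed simp
qed

lemma cech_mod_restr:
  fixes e :: "'i::{finite,linorder} \<Rightarrow> 'k::{finite,linorder}" and s :: "'k \<Rightarrow> 'n::{finite,linorder} mpoly"
  assumes "inj e"
  shows "cech_mod s (map_sum e id ` S) = cech_mod (\<lambda>i. s (e i)) (S :: ('i + 'n) set)"
proof -
  have 1: "Inl -` (map_sum e id ` S) = e ` (Inl -` S)"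
  proof (rule set_eqI)
    fix x
    have "Inl x = map_sum e id y \<longleftrightarrow> (\<exists>x'. y = Inl x' \<and> x = e x')" for y :: "'i + 'n"
      by (cases y) auto
    then show "x \<in> Inl -` (map_sum e id ` S) \<longleftrightarrow> x \<in> e ` (Inl -` S)"
      by (auto simp: image_iff)
  qed
  have "(\<Prod>i\<in>e ` (Inl -` S). s i) = (\<Prod>i\<in>Inl -` S. s (e i))"
    using assms by (simp add: prod.reindex inj_on_subset)
  then show ?thesis unfolding cech_mod_def loc_at_def 1 by simp
qed

lemma cech_restr:
  fixes e :: "'i::{finite,linorder} \<Rightarrow> 'k::{finite,linorder}" and s :: "'k \<Rightarrow> 'n::{finite,linorder} mpoly"
  assumes "inj e"
  shows "cech (\<lambda>i. s (e i)) \<phi> = fcx (\<lambda>S. cech_mod s (map_sum e id ` S))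
      (\<lambda>g. cech_lam \<phi> (map_sum e id g)) (\<lambda>g. cech_del (map_sum e id (g :: 'i::{finite,linorder} + 'n)))"
proof -
  have "cech_lam \<phi> (map_sum e id g) = cech_lam \<phi> g" "cech_del (map_sum e id g) = cech_del g" for g :: "'i + 'n"
    by (cases g; simp add: cech_del_def)+
  then show ?thesis by (simp add: cech_eq cech_mod_restr[OF assms])
qed

lemma coh_map_cech_restr:
  fixes e :: "'i::{finite,linorder} \<Rightarrow> 'k::{finite,linorder}" and s :: "'k \<Rightarrow> 'n::{finite,linorder} mpoly"
  assumes nz: "\<And>i. s i \<noteq> 0" and e: "strict_mono e"
  shows "coh_map (cech s \<phi>) (cech (\<lambda>i. s (e i)) \<phi>) k (restr (map_sum e id))"
  unfolding cech_restr[OF strict_mono_imp_inj_on[OF e]] unfolding cech_eq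
  by (rule form_cx.coh_map_restr[OF form_cx_cech[of s, OF nz] strict_mono_map_sum[OF e]])

text \<open>The homotopy contracts along the retained \<alpha>'s. A relation s_t^m = sum q_i s_(e
  i)^l provides weights q_i s_(e i)^l / s_t^m with sum 1. The numerators cancel the poles along s_(e
  i), which must disappear together with that \<alpha>; dividing by s_t is allowed because t
  stays.\<close>

theorem bij_betw_cech_restr:
  fixes e :: "'i::{finite,linorder} \<Rightarrow> 'k::{finite,linorder}" and s :: "'k \<Rightarrow> 'n::{finite,linorder} mpoly"
  assumes nz: "\<And>i. s i \<noteq> 0" and e: "strict_mono e" and "0 < k"
    and nil: "\<And>t l. t \<notin> range e \<Longrightarrow> \<exists>m q. s t ^ m = (\<Sum>i\<in>UNIV. q i * s (e i) ^ l)"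
  shows "bij_betw (hmap (cech (\<lambda>i. s (e i)) \<phi>) k (restr (map_sum e id)))
     (cohomology (cech s \<phi>) k) (cohomology (cech (\<lambda>i. s (e i)) \<phi>) k)"
proof -
  interpret form_cx "cech_lam \<phi>" cech_del "cech_mod s" by (rule form_cx_cech[of s, OF nz])
  have inj: "inj e" using strict_mono_imp_inj_on[OF e] .
  note R = diff_ring_loc_at[of s, OF nz]
  show ?thesis
    unfolding cech_restr[OF inj] unfolding cech_eq
  proof (rule bij_betw_restr[OF strict_mono_map_sum[OF e] _ \<open>0 < k\<close>])
    fix t' :: "'k + 'n" and \<omega> :: "('k + 'n) set \<Rightarrow> 'n ratfun"
    assume t': "t' \<notin> range (map_sum e id)" and \<omega>: "\<And>S. \<omega> S \<in> cech_mod s S" "\<And>S. \<omega> S \<noteq> 0 \<Longrightarrow> t' \<in> S"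
    obtain t where t: "t' = Inl t" "t \<notin> range e"
    proof (cases t')
      case (Inr x)
      then have "t' = map_sum e id (Inr x)" by simp
      then show ?thesis using t' by blast
    next
      case (Inl x)
      have "t' = map_sum e id (Inl y)" if "x = e y" for y using Inl that by simp
      then have "x \<notin> range e" using t' by blast
      then show ?thesis using that[of x] Inl by blast
    qed
    let ?e = "\<lambda>A. emb (\<Prod>i\<in>A. s i)"
    have "\<exists>l. \<forall>k\<ge>l. \<omega> S * ?e (Inl -` S) ^ k \<in> Qm" for S
      using loc_at_obtain[OF \<omega>(1)[of S, unfolded cech_mod_def] nz] by blast
    then obtain L where L: "\<And>S k. k \<ge> L S \<Longrightarrow> \<omega> S * ?e (Inl -` S) ^ k \<in> Qm" by metis
    \<comment> \<open>One exponent clears all of the finitely many coefficients of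
      \<open>\<omega>\<close>. It depends on \<open>\<omega>\<close>, which is why
      \<open>nil\<close> is assumed for every exponent.\<close>
    define l where "l = (\<Sum>S\<in>UNIV. L S)"
    have "L S \<le> l" for S unfolding l_def by (rule member_le_sum) auto
    then have l: "\<omega> S * ?e (Inl -` S) ^ l \<in> Qm" for S by (rule L)
    obtain m q where mq: "s t ^ m = (\<Sum>i\<in>UNIV. q i * s (e i) ^ l)" using nil[OF t(2), of l] by blast
    define \<mu> :: "'k + 'n \<Rightarrow> 'n ratfun" where
      "\<mu> = case_sum (\<lambda>x. if x \<in> range e then emb (q (inv e x)) * emb (s x) ^ l / emb (s t) ^ m else 0) (\<lambda>_. 0)"
    have \<mu>0: "\<mu> g = 0" if "g \<notin> range (map_sum e id)" for g
    proof (cases g)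
      case (Inl x)
      have "g = map_sum e id (Inl y)" if "x = e y" for y using Inl that by simp
      then have "x \<notin> range e" using that by blast
      then show ?thesis by (simp add: Inl \<mu>_def)
    qed (simp add: \<mu>_def)
    have "(\<Sum>g\<in>UNIV <+> UNIV. cech_lam \<phi> g * \<mu> g) = (\<Sum>x\<in>UNIV. \<mu> (Inl x))"
      by (subst sum.Plus) (simp_all add: \<mu>_def)
    also have "\<dots> = (\<Sum>x\<in>range e. \<mu> (Inl x))"
      by (rule sum.mono_neutral_right) (auto simp: \<mu>_def)
    also have "\<dots> = (\<Sum>i\<in>UNIV. emb (q i) * emb (s (e i)) ^ l / emb (s t) ^ m)"
      using inj by (simp add: sum.reindex \<mu>_def)
    also have "\<dots> = emb (s t ^ m) / emb (s t) ^ m"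
      unfolding mq by (simp add: sum_divide_distrib)
    also have "\<dots> = 1" using nz by simp
    finally have sum1: "(\<Sum>g\<in>UNIV. cech_lam \<phi> g * \<mu> g) = 1" by simp
    have mem: "\<mu> g * \<omega> (insert g S) \<in> cech_mod s S" if "g \<notin> S" for g S
    proof (cases "\<mu> g * \<omega> (insert g S) = 0")
      case False
      then have "\<mu> g \<noteq> 0" "\<omega> (insert g S) \<noteq> 0" by auto
      then obtain i where g: "g = Inl (e i)"
        by (cases g) (auto simp: \<mu>_def split: if_splits)
      have tS: "t \<in> Inl -` S" using \<omega>(2)[OF \<open>\<omega> (insert g S) \<noteq> 0\<close>] t g by auto
      let ?A = "Inl -` S" and ?w = "\<omega> (insert g S)"
      have "e i \<notin> ?A" using that g by auto
      then have pr: "?e (insert (e i) ?A) = emb (s (e i)) * ?e ?A" by simp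
      have A: "Inl -` insert g S = insert (e i) ?A" using g by auto
      have w: "?w * ?e (insert (e i) ?A) ^ l \<in> Qm" using l[of "insert g S"] unfolding A .
      have "?e ?A \<noteq> 0" using nz by simp
      \<comment> \<open>The factor \<open>s (e i) ^ l\<close> of the weight completes the product
        over \<open>?A\<close> to the one over \<open>insert (e i) ?A\<close>, which clears
        \<open>?w\<close>; only powers over \<open>?A\<close> and of \<open>s t\<close> remain as
        denominators.\<close>
      then have "\<mu> g * ?w = (emb (q i) * (1 / emb (s t) ^ m)) * ((?w * ?e (insert (e i) ?A) ^ l) / ?e ?A ^ l)"
        unfolding pr g \<mu>_def using inj by (simp add: power_mult_distrib)
      moreover have "(?w * ?e (insert (e i) ?A) ^ l) / ?e ?A ^ l \<in> loc_at s ?A" by (rule loc_atI[OF w])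
      ultimately show ?thesis
        unfolding cech_mod_def using tS
        by (simp only:) (intro diff_ring.mult_mem[OF R] diff_ring.emb_mem[OF R] loc_at_inverse[of s, OF nz])
    qed (simp add: M_zero del: mult_eq_0_iff)
    show "\<exists>\<mu>. (\<forall>g. g \<notin> range (map_sum e id) \<longrightarrow> \<mu> g = 0) \<and> (\<Sum>g\<in>UNIV. cech_lam \<phi> g * \<mu> g) = 1 \<and>
        (\<forall>S g. g \<notin> S \<longrightarrow> \<mu> g * \<omega> (insert g S) \<in> cech_mod s S)"
      using \<mu>0 sum1 mem by blast
  qed
qed

text \<open>Keeps the exponent in \<^term>\<open>Var i\<close> from being rewritten to \<^term>\<open>Suc 0\<close>.\<close>

declare One_nat_def [simp del]

section \<open>What the hypothesis on the critical points says about the Jacobian ideal\<close>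

section \<open>Isolated critical points\<close>

lemma lookup_mult:
  fixes p q :: "'n mpoly"
  shows "Poly_Mapping.lookup (p * q) k = (\<Sum>m\<in>Poly_Mapping.keys p. \<Sum>m'\<in>Poly_Mapping.keys q.
    if m + m' = k then Poly_Mapping.lookup p m * Poly_Mapping.lookup q m' else 0)"
proof -
  have "Poly_Mapping.lookup ((\<Sum>m\<in>A. Poly_Mapping.single m (a m)) * (\<Sum>m\<in>B. Poly_Mapping.single m (b m))) k =
    (\<Sum>m\<in>A. \<Sum>m'\<in>B. if m + m' = k then a m * b m' else 0)"
    for A B and a b :: "('n \<Rightarrow>\<^sub>0 nat) \<Rightarrow> complex"
    by (simp add: sum_product mult_single lookup_sum lookup_single when_def)
  from this[where A = "Poly_Mapping.keys p" and a = "Poly_Mapping.lookup p"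
      and B = "Poly_Mapping.keys q" and b = "Poly_Mapping.lookup q"]
  show ?thesis by (simp only: mpoly_monom_sum[symmetric])
qed

lemma sum_nonzero: "(\<Sum>x\<in>A. h x) \<noteq> 0 \<Longrightarrow> \<exists>x\<in>A. h x \<noteq> 0"
  by (rule ccontr) (simp add: sum.neutral)

lemma lookup_mult_nonzeroE:
  fixes p q :: "'n mpoly"
  assumes "Poly_Mapping.lookup (p * q) k \<noteq> 0"
  obtains m m' where "k = m + m'" "Poly_Mapping.lookup p m \<noteq> 0" "Poly_Mapping.lookup q m' \<noteq> 0"
proof -
  obtain m m' where "(if m + m' = k then Poly_Mapping.lookup p m * Poly_Mapping.lookup q m' else 0) \<noteq> 0"
    using sum_nonzero[OF assms[unfolded lookup_mult]] sum_nonzero by blast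
  then have "k = m + m'" "Poly_Mapping.lookup p m * Poly_Mapping.lookup q m' \<noteq> 0"
    by (simp_all split: if_splits)
  then show ?thesis using that[of m m'] by simp
qed

lemma lookup_mpderiv:
  fixes p :: "'n mpoly"
  shows "Poly_Mapping.lookup (mpderiv i p) m =
    of_nat (Suc (Poly_Mapping.lookup m i)) * Poly_Mapping.lookup p (m + Poly_Mapping.single i 1)"
proof -
  have "Poly_Mapping.lookup (mpderiv i (Poly_Mapping.single k c)) m =
      of_nat (Suc (Poly_Mapping.lookup m i)) * Poly_Mapping.lookup (Poly_Mapping.single k c) (m + Poly_Mapping.single i 1)"
    for k and c :: complex
  proof (cases "k = m + Poly_Mapping.single i 1")
    case True
    then show ?thesis by (simp add: mpderiv_single lookup_add)
  next
    case False
    moreover have "of_nat (Poly_Mapping.lookup k i) = (0 :: complex)" if "k - Poly_Mapping.single i 1 = m"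
    proof (rule ccontr)
      assume "of_nat (Poly_Mapping.lookup k i) \<noteq> (0 :: complex)"
      then have "Poly_Mapping.lookup k i \<noteq> 0" by simp
      then have "k = m + Poly_Mapping.single i 1"
        using that single_minus_shift[of k i "Poly_Mapping.single i 1"] by simp
      then show False using False by simp
    qed
    ultimately show ?thesis by (auto simp: mpderiv_single lookup_single when_def)
  qed
  then have "Poly_Mapping.lookup (mpderiv i (\<Sum>k\<in>A. Poly_Mapping.single k (a k))) m =
      of_nat (Suc (Poly_Mapping.lookup m i)) * Poly_Mapping.lookup (\<Sum>k\<in>A. Poly_Mapping.single k (a k)) (m + Poly_Mapping.single i 1)"
    for A a by (simp only: mpderiv_sum lookup_sum sum_distrib_left)
  then show ?thesis by (metis mpoly_monom_sum)
qed

lemma Var_power: "Var i ^ k = (Poly_Mapping.single (Poly_Mapping.single i k) 1 :: 'n mpoly)"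
proof (induction k)
  case (Suc k)
  then show ?case by (simp add: mult_single plus_1_eq_Suc flip: single_add)
qed simp

lemma Var_in_max_ideal: "Var i \<in> max_ideal"
  unfolding max_ideal_def by (rule mem_span[where s = Var])

locale isolated_critical_point =
  fixes f :: "'n::{finite,linorder} mpoly"
  assumes crit: "critical_points f = {max_ideal}"
begin

lemma prime_grad: "prime_ideal P \<Longrightarrow> (\<And>i. grad f i \<in> P) \<Longrightarrow> P = max_ideal"
  using crit by (auto simp: critical_points_def grad_def)

lemma grad_lookup0: "lookup0 (grad f i) = 0"
  using crit by (auto simp: critical_points_def grad_def simp flip: mem_max_ideal_iff)

text \<open>A prime containing the l-th powers of the partial derivatives contains the derivatives
  themselves, hence is \<open>max_ideal\<close> and contains the variables.\<close>

lemma Var_nilpotent: "\<exists>m q. Var j ^ m = (\<Sum>i\<in>UNIV. q i * grad f i ^ l)"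
proof -
  have "Var j \<in> P" if "prime_ideal P" "\<And>i. grad f i ^ l \<in> P" for P
    using prime_grad[OF that(1)] prime_ideal_power[OF that(1)] that(2) Var_in_max_ideal by metis
  then show ?thesis using power_in_span[of "\<lambda>i. grad f i ^ l" "Var j"] by metis
qed

text \<open>The only prime over the Jacobian ideal is \<open>max_ideal\<close>, and it misses
  \<open>b\<close>.\<close>

lemma grad_comaximal:
  assumes "lookup0 b \<noteq> 0"
  shows "\<exists>c q. 1 = c * b + (\<Sum>i\<in>UNIV. q i * grad f i)"
proof -
  obtain c q where "1 = c * b + (\<Sum>i\<in>UNIV. q i * grad f i ^ 1)"
  proof (rule comaximal[of "grad f" b 1])
    show "b \<notin> P" if "prime_ideal P" "\<And>i. grad f i \<in> P" for P
      using prime_grad[OF that] assms by (simp add: mem_max_ideal_iff)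
  qed
  then show ?thesis by auto
qed

text \<open>If \<open>f\<^sub>i = 0\<close>, then \<open>x\<^sub>i\<close> does not occur in \<open>f\<close>, so no power of \<open>x\<^sub>i\<close> lies in the Jacobian ideal.\<close>

lemma grad_nonzero: "grad f i \<noteq> 0"
proof
  assume 0: "grad f i = 0"
  have f0: "Poly_Mapping.lookup f m = 0" if "Poly_Mapping.lookup m i \<noteq> 0" for m
  proof -
    have "m - Poly_Mapping.single i 1 + Poly_Mapping.single i 1 = m"
      using single_minus_shift[of m i "Poly_Mapping.single i 1", OF that] by simp
    then show ?thesis
      using 0 lookup_mpderiv[of i f "m - Poly_Mapping.single i 1"]
      by (simp add: grad_def del: of_nat_Suc)
  qed
  \<comment> \<open>Coefficients at pure powers of x_i: for positive powers they vanish because x_i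
    does not occur in f, for the power 0 because the origin is critical. Multiples of the f_j
    inherit this.\<close>
  have g0: "Poly_Mapping.lookup (grad f j) (Poly_Mapping.single i c) = 0" for j c
  proof (cases "c = 0")
    case False
    then have "Poly_Mapping.lookup (Poly_Mapping.single i c + Poly_Mapping.single j 1) i \<noteq> 0"
      by (simp add: lookup_add)
    then show ?thesis by (simp add: grad_def lookup_mpderiv f0)
  qed (simp add: grad_lookup0)
  have qg0: "Poly_Mapping.lookup (q * grad f j) (Poly_Mapping.single i c) = 0" for q j c
  proof (rule ccontr)
    assume "Poly_Mapping.lookup (q * grad f j) (Poly_Mapping.single i c) \<noteq> 0"
    then obtain m m' where m: "Poly_Mapping.single i c = m + m'" "Poly_Mapping.lookup (grad f j) m' \<noteq> 0"
      by (rule lookup_mult_nonzeroE)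
    have "Poly_Mapping.lookup m' k = Poly_Mapping.lookup (Poly_Mapping.single i (Poly_Mapping.lookup m' i)) k" for k
    proof (cases "k = i")
      case False
      have "Poly_Mapping.lookup (m + m') k = 0" using False by (simp flip: m(1) add: lookup_single)
      then show ?thesis using False by (simp add: lookup_add lookup_single)
    qed simp
    then have "m' = Poly_Mapping.single i (Poly_Mapping.lookup m' i)" by (rule poly_mapping_eqI)
    then show False using m(2) g0 by metis
  qed
  obtain M q where "Var i ^ M = (\<Sum>j\<in>UNIV. q j * grad f j ^ 1)" using Var_nilpotent[of i 1] by blast
  then have "Poly_Mapping.lookup (Var i ^ M) (Poly_Mapping.single i M) = (\<Sum>j\<in>UNIV. 0 :: complex)"
    by (simp add: lookup_sum qg0)
  then show False unfolding Var_power by simp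
qed

end

text \<open>Modulo the variables \<open>b\<close> equals its constant term, which is a unit; a prime
  over the variables that contained \<open>b\<close> would contain 1.\<close>

lemma prime_over_Var:
  fixes b :: "'n::finite mpoly"
  assumes P: "prime_ideal P" "\<And>i. Var i \<in> P" and b: "lookup0 b \<noteq> 0"
  shows "b \<notin> P"
proof
  assume "b \<in> P"
  have id: "ideal P" using P(1) by (auto simp: prime_ideal_def ideal_def)
  have max: "max_ideal \<subseteq> P"
    unfolding max_ideal_def using id P(2) by (auto intro!: ideal_sum[OF id] simp: ideal_def)
  have neg: "- x \<in> P" if "x \<in> P" for x using id that unfolding ideal_def by (metis mult_minus1)
  let ?c = "Poly_Mapping.single 0 (lookup0 b) :: 'n mpoly"
  have "b - ?c \<in> P" using max by (auto simp: mem_max_ideal_iff lookup_minus)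
  then have "b + - (b - ?c) \<in> P" using \<open>b \<in> P\<close> neg id unfolding ideal_def by blast
  then have "?c \<in> P" by simp
  then have "Poly_Mapping.single 0 (1 / lookup0 b) * ?c \<in> P" using id unfolding ideal_def by blast
  then have "1 \<in> P" using b by (simp add: mult_single)
  then show False using P(1) by (simp add: prime_ideal_def)
qed

lemma Var_comaximal:
  fixes b :: "'n::finite mpoly"
  assumes "lookup0 b \<noteq> 0"
  obtains c q where "1 = c * b + (\<Sum>i\<in>UNIV. q i * Var i ^ k)"
  by (rule comaximal[of Var b k]) (use prime_over_Var assms in blast)

lemma Var_nonzero: "(Var i :: 'n mpoly) \<noteq> 0"
  by (metis lookup_single_eq lookup_zero zero_neq_one)

section \<open>The classes of 1 / x^a with all a_i at least 1 form a basis of the top local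
  cohomology\<close>

section \<open>Grothendieck's residue\<close>

definition expo :: "'n set \<Rightarrow> nat \<Rightarrow> 'n::finite \<Rightarrow>\<^sub>0 nat" where
  "expo A k = (\<Sum>i\<in>A. Poly_Mapping.single i k)"

lemma lookup_expo [simp]: "Poly_Mapping.lookup (expo A k) i = (if i \<in> A then k else 0)"
  by (simp add: expo_def lookup_sum lookup_single when_def)

lemma prod_Var_power: "(\<Prod>i\<in>A. Var i) ^ k = (Poly_Mapping.single (expo A k) 1 :: 'n::finite mpoly)"
proof -
  have "finite A" by simp
  then show ?thesis
  proof (induction A rule: finite_induct)
    case empty
    then show ?case by (simp add: expo_def)
  next
    case (insert i A)
    then have "(\<Prod>i\<in>insert i A. Var i) ^ k = Var i ^ k * (\<Prod>i\<in>A. Var i) ^ k"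
      by (simp add: power_mult_distrib)
    then show ?case using insert unfolding Var_power by (simp add: expo_def mult_single)
  qed
qed

lemma monomial_nonzero: "(Poly_Mapping.single a 1 :: 'n mpoly) \<noteq> 0"
  by (metis lookup_single_eq lookup_zero zero_neq_one)

text \<open>The top-degree Cech coboundaries for the variables: the i-th summand comes from a term
  without \<alpha>_i and has no pole along x_i.\<close>

definition res_exact :: "'n::{finite,linorder} ratfun set" where
  "res_exact = {\<Sum>i\<in>UNIV. g i | g. \<forall>i. g i \<in> loc_at Var (UNIV - {i})}"

text \<open>The polynomial only serves as a finite table of coefficients; its exponent a stands for
  1 / x^a.\<close>

definition principal_part :: "'n::{finite,linorder} mpoly \<Rightarrow> 'n ratfun" where
  "principal_part P = (\<Sum>a\<in>Poly_Mapping.keys P. cst (Poly_Mapping.lookup P a) / emb (Poly_Mapping.single a 1))"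

definition polar :: "'n mpoly \<Rightarrow> bool" where
  "polar P \<longleftrightarrow> (\<forall>a\<in>Poly_Mapping.keys P. \<forall>i. 1 \<le> Poly_Mapping.lookup a i)"

lemma R_Var: "diff_ring (loc_at (Var :: 'n::{finite,linorder} \<Rightarrow> _) A)"
  by (rule diff_ring_loc_at[OF Var_nonzero])

lemma res_exact_sumI: "(\<And>i. g i \<in> loc_at Var (UNIV - {i})) \<Longrightarrow> (\<Sum>i\<in>UNIV. g i) \<in> res_exact"
  unfolding res_exact_def by blast

lemma res_exactE:
  assumes "x \<in> res_exact"
  obtains g where "x = (\<Sum>i\<in>UNIV. g i)" "\<forall>i. g i \<in> loc_at Var (UNIV - {i})"
  using assms unfolding res_exact_def by blast

lemma res_exactI:
  fixes x :: "'n::{finite,linorder} ratfun"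
  assumes "x \<in> loc_at Var (UNIV - {i})"
  shows "x \<in> res_exact"
proof -
  have "(\<Sum>j\<in>UNIV. if j = i then x else 0) \<in> res_exact"
    by (intro res_exact_sumI) (simp add: assms diff_ring.zero_mem[OF R_Var])
  then show ?thesis by simp
qed

lemma res_exact_add:
  assumes "x \<in> res_exact" "y \<in> res_exact"
  shows "x + y \<in> res_exact"
proof -
  obtain g h where gh: "x = (\<Sum>i\<in>UNIV. g i)" "\<forall>i. g i \<in> loc_at Var (UNIV - {i})"
    "y = (\<Sum>i\<in>UNIV. h i)" "\<forall>i. h i \<in> loc_at Var (UNIV - {i})"
    using assms by (metis res_exactE)
  then show ?thesis
    unfolding gh(1,3) sum.distrib[symmetric] by (intro res_exact_sumI diff_ring.add_mem[OF R_Var]) simp_all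
qed

lemma res_exact_zero: "0 \<in> res_exact"
  by (rule res_exactI[OF diff_ring.zero_mem[OF R_Var]])

lemma res_exact_cst:
  assumes "x \<in> res_exact"
  shows "cst c * x \<in> res_exact"
proof -
  obtain g where g: "x = (\<Sum>i\<in>UNIV. g i)" "\<forall>i. g i \<in> loc_at Var (UNIV - {i})"
    using assms by (rule res_exactE)
  show ?thesis
    unfolding g(1) sum_distrib_left
    by (intro res_exact_sumI diff_ring.mult_mem[OF R_Var] diff_ring.emb_mem[OF R_Var] g(2)[rule_format])
qed

lemma res_exact_deriv:
  assumes "x \<in> res_exact"
  shows "rat_deriv j x \<in> res_exact"
proof -
  obtain g where g: "x = (\<Sum>i\<in>UNIV. g i)" "\<forall>i. g i \<in> loc_at Var (UNIV - {i})"
    using assms by (rule res_exactE)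
  show ?thesis
    unfolding g(1) rat_deriv_sum by (intro res_exact_sumI diff_ring.deriv_mem[OF R_Var] g(2)[rule_format])
qed

lemma cst_add: "cst (a + b) = cst a + cst b"
  by (simp add: single_add)

lemma cst_mult: "cst (a * b) = cst a * cst b"
  by (simp add: mult_single flip: emb_mult)

lemma cst_1 [simp]: "cst 1 = 1"
  by (simp add: single_one)

lemma cst_minus: "cst (- a) = - cst a"
  by (simp add: single_uminus)

lemma res_exact_diff: "x \<in> res_exact \<Longrightarrow> y \<in> res_exact \<Longrightarrow> x - y \<in> res_exact"
  using res_exact_add[of x "cst (- 1) * y"] res_exact_cst[of y "- 1"] by (simp add: cst_minus del: emb_minus)

lemma principal_part_superset:
  assumes "finite S" "Poly_Mapping.keys P \<subseteq> S"
  shows "principal_part P = (\<Sum>a\<in>S. cst (Poly_Mapping.lookup P a) / emb (Poly_Mapping.single a 1))"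
  unfolding principal_part_def using assms
  by (intro sum.mono_neutral_left) (auto simp: in_keys_iff)

lemma principal_part_add: "principal_part (P + Q) = principal_part P + principal_part Q"
proof -
  let ?S = "Poly_Mapping.keys P \<union> Poly_Mapping.keys Q"
  have "Poly_Mapping.keys (P + Q) \<subseteq> ?S" by (rule Poly_Mapping.keys_add)
  then show ?thesis
    by (simp add: principal_part_superset[of ?S] lookup_add cst_add add_divide_distrib sum.distrib del: emb_add)
qed

lemma principal_part_single: "principal_part (Poly_Mapping.single a c) = cst c / emb (Poly_Mapping.single a 1)"
  by (cases "c = 0") (simp_all add: principal_part_def)

lemma lookup_scale: "Poly_Mapping.lookup (Poly_Mapping.single 0 c * P) a = c * Poly_Mapping.lookup P a"
  for P :: "'n mpoly"
proof -
  have "Poly_Mapping.lookup (Poly_Mapping.single 0 c * (\<Sum>m\<in>A. Poly_Mapping.single m (p m))) a =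
      c * Poly_Mapping.lookup (\<Sum>m\<in>A. Poly_Mapping.single m (p m) :: 'n mpoly) a" for A p
    unfolding sum_distrib_left lookup_sum by (intro sum.cong) (auto simp: mult_single lookup_single when_def)
  then show ?thesis by (metis mpoly_monom_sum)
qed

lemma principal_part_scale: "principal_part (Poly_Mapping.single 0 c * P) = cst c * principal_part P"
proof -
  note l = lookup_scale[of c P]
  have "Poly_Mapping.keys (Poly_Mapping.single 0 c * P) \<subseteq> Poly_Mapping.keys P"
    by (auto simp: in_keys_iff l)
  then show ?thesis
    by (simp add: principal_part_superset[of "Poly_Mapping.keys P"] l cst_mult sum_distrib_left)
qed

lemma polar_add: "polar P \<Longrightarrow> polar Q \<Longrightarrow> polar (P + Q)"
  using Poly_Mapping.keys_add[of P Q] unfolding polar_def by blast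

lemma polar_scale: "polar P \<Longrightarrow> polar (Poly_Mapping.single 0 c * P)"
  unfolding polar_def by (auto simp: in_keys_iff lookup_scale)

text \<open>Clearing denominators gives b R = sum p_i x_i^N, where b(0) is nonzero and all exponents
  in R are below N. A monomial of lowest degree in R survives in b R, multiplied by b(0), but every
  monomial on the right has an exponent at least N.\<close>

lemma principal_part_unique:
  fixes P :: "'n::{finite,linorder} mpoly"
  assumes "polar P" "principal_part P \<in> res_exact"
  shows "P = 0"
proof (rule ccontr)
  assume "P \<noteq> 0"
  obtain g where g: "principal_part P = (\<Sum>i\<in>UNIV. g i)" "\<And>i. g i \<in> loc_at Var (UNIV - {i})"
    using assms(2) by (auto simp: res_exact_def)
  let ?X = "\<lambda>A k. emb (Poly_Mapping.single (expo A k) 1)"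
  have "\<forall>i. \<exists>k. \<forall>l\<ge>k. g i * ?X (UNIV - {i}) l \<in> Qm"
    using loc_at_obtain[OF g(2) Var_nonzero] unfolding emb_power[symmetric] prod_Var_power by blast
  then obtain L where L: "\<And>i l. l \<ge> L i \<Longrightarrow> g i * ?X (UNIV - {i}) l \<in> Qm" using choice by metis
  \<comment> \<open>Large enough to bound all exponents occurring in \<open>P\<close> and the pole
    orders of all \<open>g i\<close>.\<close>
  define N where "N = (\<Sum>i\<in>UNIV. L i) + (\<Sum>a\<in>Poly_Mapping.keys P. \<Sum>i\<in>UNIV. Poly_Mapping.lookup a i)"
  have LN: "L i \<le> N" for i
  proof -
    have "L i \<le> (\<Sum>i\<in>UNIV. L i)" by (rule member_le_sum) auto
    then show ?thesis by (simp add: N_def)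
  qed
  have aN: "Poly_Mapping.lookup a i \<le> N" if "a \<in> Poly_Mapping.keys P" for a i
  proof -
    have "Poly_Mapping.lookup a i \<le> (\<Sum>i\<in>UNIV. Poly_Mapping.lookup a i)" by (rule member_le_sum) auto
    also have "\<dots> \<le> (\<Sum>a\<in>Poly_Mapping.keys P. \<Sum>i\<in>UNIV. Poly_Mapping.lookup a i)"
      by (rule member_le_sum) (use that in auto)
    finally show ?thesis by (simp add: N_def)
  qed
  obtain b where b: "lookup0 b \<noteq> 0" "\<And>i. emb b * (g i * ?X (UNIV - {i}) N) \<in> range emb"
    using common_denominator[of UNIV "\<lambda>i. g i * ?X (UNIV - {i}) N"] L LN by auto
  then obtain p where p: "\<And>i. emb b * (g i * ?X (UNIV - {i}) N) = emb (p i)" by (auto simp: image_iff) metis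
  \<comment> \<open>The principal part multiplied by (x_1 ... x_n)^N: the exponent a turns into N -
    a.\<close>
  define R :: "'n mpoly" where "R = (\<Sum>a\<in>Poly_Mapping.keys P. Poly_Mapping.single (expo UNIV N - a) (Poly_Mapping.lookup P a))"
  have sub: "a + (expo UNIV N - a) = expo UNIV N" if "a \<in> Poly_Mapping.keys P" for a
    using aN[OF that] by (intro poly_mapping_eqI) (simp add: lookup_add lookup_minus)
  have lookup_R: "Poly_Mapping.lookup R (expo UNIV N - a) = Poly_Mapping.lookup P a" if a: "a \<in> Poly_Mapping.keys P" for a
  proof -
    have "a' = a" if "expo UNIV N - a' = expo UNIV N - a" "a' \<in> Poly_Mapping.keys P" for a'
      using sub[OF a] sub[OF that(2)] that(1) by (metis add_right_cancel)
    then have "Poly_Mapping.lookup R (expo UNIV N - a) = (\<Sum>a'\<in>Poly_Mapping.keys P. if a' = a then Poly_Mapping.lookup P a else 0)"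
      unfolding R_def lookup_sum lookup_single when_def by (intro sum.cong) auto
    then show ?thesis using a by simp
  qed
  have keys_R: "\<exists>a\<in>Poly_Mapping.keys P. k = expo UNIV N - a" if "Poly_Mapping.lookup R k \<noteq> 0" for k
    using sum_nonzero[OF that[unfolded R_def lookup_sum]] by (auto simp: lookup_single when_def split: if_splits)
  have "emb R = principal_part P * ?X UNIV N"
  proof -
    have "emb (Poly_Mapping.single (expo UNIV N - a) (Poly_Mapping.lookup P a)) =
        cst (Poly_Mapping.lookup P a) / emb (Poly_Mapping.single a 1) * ?X UNIV N" if "a \<in> Poly_Mapping.keys P" for a
    proof -
      have "emb (Poly_Mapping.single a 1) * emb (Poly_Mapping.single (expo UNIV N - a) (Poly_Mapping.lookup P a)) =
         cst (Poly_Mapping.lookup P a) * ?X UNIV N"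
        unfolding emb_mult[symmetric] mult_single sub[OF that] by simp
      then show ?thesis using monomial_nonzero[of a] by (simp add: field_simps)
    qed
    then show ?thesis unfolding R_def principal_part_def by (simp add: sum_distrib_right)
  qed
  moreover have "emb b * (g i * ?X UNIV N) = emb (p i * Var i ^ N)" for i
  proof -
    have "expo UNIV N = expo (UNIV - {i}) N + Poly_Mapping.single i N"
      by (intro poly_mapping_eqI) (simp add: lookup_add lookup_single when_def)
    then have "?X UNIV N = ?X (UNIV - {i}) N * emb (Var i ^ N)"
      unfolding emb_mult[symmetric] Var_power mult_single by simp
    then show ?thesis unfolding emb_mult p[symmetric] by simp
  qed
  ultimately have "emb (b * R) = emb (\<Sum>i\<in>UNIV. p i * Var i ^ N)"
    unfolding emb_mult emb_sum g(1) by (simp add: sum_distrib_right sum_distrib_left del: emb_mult emb_power)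
  then have eq: "b * R = (\<Sum>i\<in>UNIV. p i * Var i ^ N)" by (simp only: emb_eq_iff)
  \<comment> \<open>Minimality of the total degree leaves the constant term of \<open>b\<close> as
    the only one that contributes to the coefficient at \<open>m0\<close>.\<close>
  let ?deg = "\<lambda>m :: 'n \<Rightarrow>\<^sub>0 nat. \<Sum>i\<in>UNIV. Poly_Mapping.lookup m i"
  obtain a where "a \<in> Poly_Mapping.keys P" using \<open>P \<noteq> 0\<close> by fastforce
  then have "Poly_Mapping.keys R \<noteq> {}" using lookup_R[of a] by (auto simp: in_keys_iff)
  then obtain m0 where m0: "m0 \<in> Poly_Mapping.keys R" "\<And>m. m \<in> Poly_Mapping.keys R \<Longrightarrow> ?deg m0 \<le> ?deg m"
    using arg_min_if_finite(1)[of "Poly_Mapping.keys R" ?deg] arg_min_least[of "Poly_Mapping.keys R" _ ?deg] by auto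
  obtain a0 where a0: "a0 \<in> Poly_Mapping.keys P" "m0 = expo UNIV N - a0" using keys_R m0(1) by (auto simp: in_keys_iff)
  have "Poly_Mapping.lookup m0 i < N" for i
  proof -
    have "1 \<le> Poly_Mapping.lookup a0 i" using assms(1) a0(1) by (auto simp: polar_def)
    then show ?thesis using aN[OF a0(1), of i] by (simp add: a0(2) lookup_minus)
  qed
  then have "Poly_Mapping.lookup (p i * Var i ^ N) m0 = 0" for i
  proof -
    have False if nz: "Poly_Mapping.lookup (p i * Var i ^ N) m0 \<noteq> 0"
    proof -
      obtain m m' where m: "m0 = m + m'" "Poly_Mapping.lookup (Var i ^ N) m' \<noteq> 0"
        using nz by (rule lookup_mult_nonzeroE)
      then have "m' = Poly_Mapping.single i N" unfolding Var_power by (auto simp: lookup_single when_def split: if_splits)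
      then show False using m(1) \<open>\<And>i. Poly_Mapping.lookup m0 i < N\<close>[of i] by (simp add: lookup_add)
    qed
    then show ?thesis by blast
  qed
  then have "Poly_Mapping.lookup (b * R) m0 = 0" unfolding eq lookup_sum by simp
  moreover have "Poly_Mapping.lookup (b * R) m0 = lookup0 b * Poly_Mapping.lookup R m0"
  proof -
    have *: "m = 0 \<and> m' = m0" if "m + m' = m0" "m' \<in> Poly_Mapping.keys R" for m m'
    proof -
      have "?deg m0 = ?deg m + ?deg m'" by (simp add: that(1)[symmetric] lookup_add sum.distrib)
      then have "?deg m = 0" using m0(2)[OF that(2)] by simp
      then have "m = 0" by (intro poly_mapping_eqI) simp
      then show ?thesis using that(1) by simp
    qed
    have "Poly_Mapping.lookup (b * R) m0 = (\<Sum>m\<in>Poly_Mapping.keys b. \<Sum>m'\<in>Poly_Mapping.keys R.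
        if m' = m0 then (if m = 0 then lookup0 b * Poly_Mapping.lookup R m0 else 0) else 0)"
      unfolding lookup_mult using * by (intro sum.cong refl) auto
    also have "\<dots> = lookup0 b * Poly_Mapping.lookup R m0"
      using m0(1) b(1) by (simp add: in_keys_iff)
    finally show ?thesis .
  qed
  ultimately show False using b(1) m0(1) by (simp add: in_keys_iff)
qed

definition has_principal_part :: "'n::{finite,linorder} ratfun \<Rightarrow> 'n mpoly \<Rightarrow> bool" where
  "has_principal_part c P \<longleftrightarrow> polar P \<and> c - principal_part P \<in> res_exact"

lemma has_principal_part_unique:
  assumes "has_principal_part c P" "has_principal_part c Q"
  shows "P = Q"
proof -
  have m: "- Q = Poly_Mapping.single 0 (- 1) * Q" by (simp add: single_uminus single_one)
  have "principal_part (P + - Q) = (c - principal_part Q) - (c - principal_part P)"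
    unfolding m principal_part_add principal_part_scale by (simp add: single_uminus single_one)
  then have "principal_part (P + - Q) \<in> res_exact"
    using assms res_exact_diff unfolding has_principal_part_def by metis
  moreover have "polar (P + - Q)"
    using assms unfolding m has_principal_part_def by (intro polar_add polar_scale) auto
  ultimately show ?thesis using principal_part_unique[of "P + - Q"] by simp
qed

lemma has_principal_part_add:
  "has_principal_part c P \<Longrightarrow> has_principal_part d Q \<Longrightarrow> has_principal_part (c + d) (P + Q)"
  unfolding has_principal_part_def principal_part_add
  using res_exact_add[of "c - principal_part P" "d - principal_part Q"]
  by (auto intro: polar_add simp: algebra_simps)

lemma has_principal_part_scale:
  "has_principal_part c P \<Longrightarrow> has_principal_part (cst z * c) (Poly_Mapping.single 0 z * P)"
  unfolding has_principal_part_def principal_part_scale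
  using res_exact_cst[of "c - principal_part P" z] by (auto intro: polar_scale simp: right_diff_distrib)

lemma has_principal_part_exact: "c \<in> res_exact \<Longrightarrow> has_principal_part c 0"
  by (simp add: has_principal_part_def polar_def principal_part_def)

text \<open>Write c = a / (x_1 ... x_n)^k with a = p / b. From 1 = r b + sum q_i x_i^k follows a = p
  r + sum a q_i x_i^k. The terms of the sum lose their pole along x_i, as do the monomials of p r
  with an exponent at least k; the other monomials give polar terms.\<close>

lemma has_principal_part_exists:
  fixes c :: "'n::{finite,linorder} ratfun"
  assumes "c \<in> loc_at Var UNIV"
  shows "\<exists>P. has_principal_part c P"
proof -
  let ?X = "\<lambda>A k. emb (Poly_Mapping.single (expo A k) 1)"
  have X0: "?X A k \<noteq> 0" for A :: "'n set" and k using monomial_nonzero by simp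
  obtain a k where c: "c = a / ?X UNIV k" "a \<in> Qm"
    using assms unfolding loc_at_def emb_power[symmetric] prod_Var_power by auto
  obtain p b where a: "a = emb p / emb b" "lookup0 b \<noteq> 0" "b \<noteq> 0" using QmE[OF c(2)] .
  obtain r q where rq: "1 = r * b + (\<Sum>i\<in>UNIV. q i * Var i ^ k)" using Var_comaximal[OF a(2)] .
  have split: "?X UNIV k = ?X (UNIV - {i}) k * emb (Var i ^ k)" for i
  proof -
    have "expo UNIV k = expo (UNIV - {i}) k + Poly_Mapping.single i k"
      by (intro poly_mapping_eqI) (simp add: lookup_add lookup_single when_def)
    then show ?thesis unfolding emb_mult[symmetric] Var_power mult_single by simp
  qed
  have ex: "x * emb (Var i ^ k) / ?X UNIV k \<in> res_exact" if "x \<in> Qm" for x i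
  proof -
    have "emb (Var i ^ k) \<noteq> 0" using Var_nonzero[of i] by simp
    then have "x * emb (Var i ^ k) / ?X UNIV k = x / ?X (UNIV - {i}) k" unfolding split[of i] by simp
    also have "\<dots> \<in> loc_at Var (UNIV - {i})"
      using loc_atI[OF that, where A = "UNIV - {i}" and s = Var and k = k] unfolding emb_power[symmetric] prod_Var_power .
    finally show ?thesis by (rule res_exactI)
  qed
  have mono: "\<exists>P. has_principal_part (emb (Poly_Mapping.single m z) / ?X UNIV k) P" for m :: "'n \<Rightarrow>\<^sub>0 nat" and z
  proof (cases "\<exists>i. k \<le> Poly_Mapping.lookup m i")
    case True
    then obtain i where i: "k \<le> Poly_Mapping.lookup m i" by blast
    have "m = (m - Poly_Mapping.single i k) + Poly_Mapping.single i k"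
      using i by (intro poly_mapping_eqI) (auto simp: lookup_add lookup_minus lookup_single when_def)
    then have "Poly_Mapping.single m z = Poly_Mapping.single (m - Poly_Mapping.single i k) z * Var i ^ k"
      unfolding Var_power mult_single by simp
    then have "emb (Poly_Mapping.single m z) = emb (Poly_Mapping.single (m - Poly_Mapping.single i k) z) * emb (Var i ^ k)"
      by (simp only: emb_mult)
    then show ?thesis using has_principal_part_exact[OF ex[OF Qm.emb_mem]] by metis
  next
    case False
    then have m: "m + (expo UNIV k - m) = expo UNIV k"
      by (intro poly_mapping_eqI) (simp add: lookup_add lookup_minus not_le less_imp_le)
    let ?a = "expo UNIV k - m"
    have nz: "emb (Poly_Mapping.single ?a 1) \<noteq> 0" using monomial_nonzero[of ?a] by simp
    have "emb (Poly_Mapping.single m z) * emb (Poly_Mapping.single ?a 1) = cst z * ?X UNIV k"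
      unfolding emb_mult[symmetric] mult_single m by simp
    then have "emb (Poly_Mapping.single m z) / ?X UNIV k = principal_part (Poly_Mapping.single ?a z)"
      unfolding principal_part_single frac_eq_eq[OF X0 nz] .
    moreover have "polar (Poly_Mapping.single ?a z)"
    proof -
      have "1 \<le> Poly_Mapping.lookup ?a i" for i
      proof -
        have "Poly_Mapping.lookup m i < k" using False by (simp add: not_le)
        then show ?thesis by (simp add: lookup_minus One_nat_def Suc_leI)
      qed
      then show ?thesis unfolding polar_def by (auto split: if_splits)
    qed
    ultimately show ?thesis
      by (intro exI[of _ "Poly_Mapping.single ?a z"]) (simp add: has_principal_part_def res_exact_zero)
  qed
  have fin: "\<exists>P. has_principal_part (\<Sum>m\<in>A. emb (Poly_Mapping.single m (z m)) / ?X UNIV k) P" if "finite A"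
    for A :: "('n \<Rightarrow>\<^sub>0 nat) set" and z
    using that
  proof (induction A rule: finite_induct)
    case empty
    then show ?case using has_principal_part_exact[OF res_exact_zero] by auto
  next
    case (insert m A)
    then show ?case using has_principal_part_add mono[of m "z m"] by simp blast
  qed
  from fin[of "Poly_Mapping.keys (p * r)" "Poly_Mapping.lookup (p * r)"]
  have "\<exists>P. has_principal_part (emb (p * r) / ?X UNIV k) P"
    unfolding sum_divide_distrib[symmetric] emb_sum[symmetric] mpoly_monom_sum[symmetric] by simp
  then obtain P where P: "has_principal_part (emb (p * r) / ?X UNIV k) P" by blast
  have "emb (1 :: 'n mpoly) = emb (r * b + (\<Sum>i\<in>UNIV. q i * Var i ^ k))" using rq by (rule arg_cong)
  then have "1 = emb r * emb b + (\<Sum>i\<in>UNIV. emb (q i) * emb (Var i ^ k))"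
    by (simp only: emb_1 emb_add emb_mult emb_sum)
  then have "a = a * (emb r * emb b + (\<Sum>i\<in>UNIV. emb (q i) * emb (Var i ^ k)))" by simp
  also have "\<dots> = emb (p * r) + (\<Sum>i\<in>UNIV. (a * emb (q i)) * emb (Var i ^ k))"
    using a by (simp add: distrib_left sum_distrib_left mult.assoc)
  finally have e: "a = emb (p * r) + (\<Sum>i\<in>UNIV. (a * emb (q i)) * emb (Var i ^ k))" .
  have c_eq: "c = emb (p * r) / ?X UNIV k + (\<Sum>i\<in>UNIV. (a * emb (q i)) * emb (Var i ^ k) / ?X UNIV k)"
    unfolding c(1) sum_divide_distrib[symmetric] add_divide_distrib[symmetric]
    using e by (rule arg_cong[where f = "\<lambda>x. x / ?X UNIV k"])
  have exA: "(\<Sum>i\<in>A. (a * emb (q i)) * emb (Var i ^ k) / ?X UNIV k) \<in> res_exact" for A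
    by (induction A rule: infinite_finite_induct)
      (use res_exact_zero res_exact_add ex[OF Qm.mult_mem[OF c(2) Qm.emb_mem]] in auto)
  show ?thesis
    unfolding c_eq using has_principal_part_add[OF P has_principal_part_exact[OF exA]] by blast
qed

text \<open>Uniqueness of the principal part makes the definite description in \<open>res_G\<close>
  proper; the value is the coefficient of 1 / (x_1 ... x_n).\<close>

lemma res_G_eq:
  assumes "has_principal_part c P"
  shows "res_G c = Poly_Mapping.lookup P (expo UNIV 1)"
proof -
  have r: "(\<Sum>a\<in>Poly_Mapping.keys Q. Poly_Mapping.lookup Q a *
           (if \<forall>i. Poly_Mapping.lookup a i = 1 then 1 else 0)) = Poly_Mapping.lookup Q (expo UNIV 1)" for Q :: "'a mpoly"
  proof -
    have "(\<forall>i. Poly_Mapping.lookup a i = 1) \<longleftrightarrow> a = expo UNIV 1" for a :: "'a \<Rightarrow>\<^sub>0 nat"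
      by (auto intro!: poly_mapping_eqI)
    then have "(\<Sum>a\<in>Poly_Mapping.keys Q. Poly_Mapping.lookup Q a *
           (if \<forall>i. Poly_Mapping.lookup a i = 1 then 1 else 0)) =
       (\<Sum>a\<in>Poly_Mapping.keys Q. if a = expo UNIV 1 then Poly_Mapping.lookup Q a else 0)"
      by (intro sum.cong) auto
    then show ?thesis by (simp add: in_keys_iff)
  qed
  have "res_G c = (THE r. \<exists>P. has_principal_part c P \<and> r = Poly_Mapping.lookup P (expo UNIV 1))"
    unfolding res_G_def r has_principal_part_def polar_def principal_part_def res_exact_def conj_assoc ..
  then show ?thesis
    using assms has_principal_part_unique by (auto intro!: the_equality)
qed

lemma res_G_add:
  assumes "c \<in> loc_at Var UNIV" "d \<in> loc_at Var UNIV"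
  shows "res_G (c + d) = res_G c + res_G d"
proof -
  obtain P Q where PQ: "has_principal_part c P" "has_principal_part d Q"
    using has_principal_part_exists assms by metis
  show ?thesis
    unfolding res_G_eq[OF PQ(1)] res_G_eq[OF PQ(2)] res_G_eq[OF has_principal_part_add[OF PQ]]
    by (rule lookup_add)
qed

lemma res_G_scale:
  assumes "c \<in> loc_at Var UNIV"
  shows "res_G (cst z * c) = z * res_G c"
proof -
  obtain P where P: "has_principal_part c P" using has_principal_part_exists assms by metis
  show ?thesis
    unfolding res_G_eq[OF P] res_G_eq[OF has_principal_part_scale[OF P]] by (rule lookup_scale)
qed

lemma res_G_exact: "c \<in> res_exact \<Longrightarrow> res_G c = 0"
  using res_G_eq[OF has_principal_part_exact] by simp

lemma res_G_0: "res_G 0 = 0"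
  by (rule res_G_exact[OF res_exact_zero])

text \<open>Differentiation by x_j raises the pole order along x_j from at least 1 to at least 2, so
  1 / (x_1 ... x_n) never arises, and it maps coboundaries to coboundaries.\<close>

lemma res_G_deriv:
  fixes c :: "'n::{finite,linorder} ratfun"
  assumes "c \<in> loc_at Var UNIV"
  shows "res_G (rat_deriv j c) = 0"
proof -
  obtain P where P: "polar P" "c - principal_part P \<in> res_exact"
    using has_principal_part_exists[OF assms] by (auto simp: has_principal_part_def)
  define Q :: "'n mpoly" where "Q = (\<Sum>a\<in>Poly_Mapping.keys P. Poly_Mapping.single (a + Poly_Mapping.single j 1)
      (- of_nat (Poly_Mapping.lookup a j) * Poly_Mapping.lookup P a))"
  have one: "rat_deriv j (cst z / emb (Poly_Mapping.single a 1)) =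
      principal_part (Poly_Mapping.single (a + Poly_Mapping.single j 1) (- of_nat (Poly_Mapping.lookup a j) * z))"
    if "1 \<le> Poly_Mapping.lookup a j" for a z
  proof -
    let ?M = "Poly_Mapping.single a 1 :: 'n mpoly" and ?n = "of_nat (Poly_Mapping.lookup a j) :: complex"
    have M0: "emb ?M \<noteq> 0" "emb (Var j) \<noteq> 0" using monomial_nonzero by simp_all
    have "a - Poly_Mapping.single j 1 + Poly_Mapping.single j 1 = a"
      using that by (intro poly_mapping_eqI) (auto simp: lookup_add lookup_minus lookup_single when_def)
    then have "mpderiv j ?M * Var j = Poly_Mapping.single 0 ?n * ?M"
      by (simp only: mpderiv_single mult_single) simp
    then have e: "rat_deriv j (emb ?M) * emb (Var j) = cst ?n * emb ?M"
      unfolding rat_deriv_emb emb_mult[symmetric] by (simp only:)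
    have s: "Poly_Mapping.single (a + Poly_Mapping.single j 1) 1 = ?M * Var j" by (simp add: mult_single)
    have n: "cst (- ?n * z) = - cst ?n * cst z" unfolding cst_mult by (simp add: single_uminus)
    have "rat_deriv j (cst z / emb ?M) = - cst z * rat_deriv j (emb ?M) / (emb ?M * emb ?M)"
      using M0 by (simp add: rat_deriv_divide)
    also have "\<dots> = - cst z * (rat_deriv j (emb ?M) * emb (Var j)) / (emb ?M * emb ?M * emb (Var j))"
      using M0 by simp
    also have "\<dots> = (- cst ?n * cst z) / (emb ?M * emb (Var j))"
      unfolding e using M0 by simp
    finally show ?thesis unfolding principal_part_single s n emb_mult .
  qed
  have sumpp: "principal_part (sum h A) = (\<Sum>a\<in>A. principal_part (h a))" for h :: "('n \<Rightarrow>\<^sub>0 nat) \<Rightarrow> 'n mpoly" and A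
    by (induction A rule: infinite_finite_induct) (simp_all add: principal_part_add, simp_all add: principal_part_def)
  have "rat_deriv j (principal_part P) = principal_part Q"
    unfolding Q_def sumpp unfolding principal_part_def[of P] rat_deriv_sum
    using P(1) by (intro sum.cong refl one) (auto simp: polar_def)
  moreover have "rat_deriv j (c - principal_part P) \<in> res_exact" using res_exact_deriv[OF P(2)] .
  ultimately have "rat_deriv j c - principal_part Q \<in> res_exact"
    using rat_deriv_add[of j "c" "- principal_part P"] by (simp add: rat_deriv_minus)
  moreover have lQ: "\<exists>a\<in>Poly_Mapping.keys P. k = a + Poly_Mapping.single j 1" if "Poly_Mapping.lookup Q k \<noteq> 0" for k
    using sum_nonzero[OF that[unfolded Q_def lookup_sum]] by (auto simp: lookup_single when_def split: if_splits)
  have "polar Q"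
    unfolding polar_def
  proof (intro ballI allI)
    fix k i assume "k \<in> Poly_Mapping.keys Q"
    then obtain a where a: "a \<in> Poly_Mapping.keys P" "k = a + Poly_Mapping.single j 1"
      using lQ by (auto simp: in_keys_iff)
    then have "1 \<le> Poly_Mapping.lookup a i" using P(1) by (auto simp: polar_def)
    then show "1 \<le> Poly_Mapping.lookup k i" by (simp add: a(2) lookup_add)
  qed
  ultimately have "has_principal_part (rat_deriv j c) Q" by (simp add: has_principal_part_def)
  then have "res_G (rat_deriv j c) = Poly_Mapping.lookup Q (expo UNIV 1)" by (rule res_G_eq)
  also have "\<dots> = 0"
  proof (rule ccontr)
    assume "Poly_Mapping.lookup Q (expo UNIV 1) \<noteq> 0"
    then obtain a where a: "a \<in> Poly_Mapping.keys P" "expo UNIV 1 = a + Poly_Mapping.single j 1" using lQ by blast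
    have "Poly_Mapping.lookup (expo UNIV 1) j = Poly_Mapping.lookup a j + 1" unfolding a(2) by (simp add: lookup_add)
    moreover have "1 \<le> Poly_Mapping.lookup a j" using P(1) a(1) by (auto simp: polar_def)
    ultimately show False by simp
  qed
  finally show ?thesis .
qed

section \<open>Residues of classes and their independence of all choices\<close>

section \<open>The residue map on cohomology classes\<close>

lemma fst_cech: "fst (cech s \<phi>) k = forms (cech_mod s) k"
  by (simp add: cech_eq fcx_def)

lemma snd_cech: "snd (cech s \<phi>) = ext_op (tw (cech_lam \<phi>) cech_del)"
  by (simp add: cech_eq fcx_def)

lemma card_sum_self: "CARD('n::finite + 'n) = 2 * CARD('n)"
  by (simp add: card_UNIV_sum)

lemma forms_subset_UNIV:
  fixes \<omega> :: "'g::finite set \<Rightarrow> 'a::comm_ring_1 fps"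
  assumes "\<omega> \<in> forms M k" "k = CARD('g)"
  shows "\<omega> = top_form (\<omega> UNIV)"
proof
  fix S
  have "S = UNIV" if "\<omega> S \<noteq> 0"
    using assms that by (intro card_eq_UNIV_imp_eq_UNIV) (auto simp: forms_def)
  then show "\<omega> S = top_form (\<omega> UNIV) S" by (auto simp: top_form_def)
qed

lemma res_G_sum:
  assumes "\<And>i. i \<in> A \<Longrightarrow> h i \<in> loc_at Var UNIV"
  shows "res_G (\<Sum>i\<in>A. h i) = (\<Sum>i\<in>A. res_G (h i))"
  using assms
  by (induction A rule: infinite_finite_induct)
    (simp_all add: res_G_0 res_G_add diff_ring.sum_mem[OF R_Var])

lemma cech_mod_UNIV: "cech_mod s UNIV = loc_at s UNIV"
  by (simp add: cech_mod_def)

text \<open>In the top coefficient the \<alpha>-components contribute functions without a pole along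
  one variable, and the dx-components, the twist being 0, contribute u times derivatives. The
  residue kills both.\<close>

lemma res_G_coboundary:
  fixes y :: "('n + 'n::{finite,linorder}) set \<Rightarrow> 'n ratfun fps"
  assumes y: "y \<in> forms (cech_mod Var) k"
  shows "res_G (fps_nth (ext_op (tw (cech_lam 0) cech_del) y UNIV) j) = 0"
proof -
  have y: "fps_nth (y S) i \<in> cech_mod Var S" for S i using y by (simp add: forms_def)
  have sub: "cech_mod Var S \<subseteq> loc_at (Var :: 'n \<Rightarrow> 'n mpoly) UNIV" for S
    unfolding cech_mod_def by (rule loc_at_mono[OF _ Var_nonzero]) simp
  have t: "fps_nth (tw (cech_lam 0) cech_del g (y (UNIV - {g}))) j \<in> loc_at Var UNIV \<and>
     res_G (fps_nth (tw (cech_lam 0) cech_del g (y (UNIV - {g}))) j) = 0" for g :: "'n + 'n"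
  proof (cases g)
    case (Inl i)
    have "Inl -` (UNIV - {g}) = UNIV - {i}" using Inl by auto
    then have "fps_nth (y (UNIV - {g})) j \<in> loc_at Var (UNIV - {i})"
      using y[of "UNIV - {g}" j] by (simp add: cech_mod_def)
    then show ?thesis
      using sub y res_G_exact[OF res_exactI] by (auto simp: Inl tw_cech_Inl)
  next
    case (Inr i)
    show ?thesis
    proof (cases j)
      case 0
      then show ?thesis using diff_ring.zero_mem[OF R_Var] by (simp add: Inr res_G_0)
    next
      case (Suc j')
      have "fps_nth (y (UNIV - {g})) j' \<in> loc_at Var UNIV" using y sub by blast
      then show ?thesis
        by (simp add: Inr Suc diff_ring.deriv_mem[OF R_Var] res_G_deriv)
    qed
  qed
  have s: "res_G (es g S * c) = 0 \<and> es g S * c \<in> loc_at Var UNIV"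
    if "c \<in> loc_at Var UNIV" "res_G c = 0" for g :: "'n + 'n" and S and c :: "'n ratfun"
  proof -
    have "- c = cst (- 1) * c" by (simp add: cst_minus del: emb_minus)
    then have "res_G (- c) = 0" using res_G_scale[OF that(1), of "- 1"] that(2) by simp
    then show ?thesis
      using es_cases[of g S, where 'a = "'n ratfun"] that diff_ring.minus_mem[OF R_Var that(1)] by auto
  qed
  have eq: "fps_nth (ext_op (tw (cech_lam 0) cech_del) y UNIV) j =
     (\<Sum>g\<in>UNIV. es g UNIV * fps_nth (tw (cech_lam 0) cech_del g (y (UNIV - {g}))) j)"
    unfolding ext_op_def fps_sum_nth es_fps by simp
  have "res_G (fps_nth (ext_op (tw (cech_lam 0) cech_del) y UNIV) j) =
     (\<Sum>g\<in>UNIV. res_G (es g UNIV * fps_nth (tw (cech_lam 0) cech_del g (y (UNIV - {g}))) j))"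
    unfolding eq by (rule res_G_sum) (use s t in blast)
  also have "\<dots> = 0" using s t by (intro sum.neutral) blast
  finally show ?thesis .
qed

definition res_fps :: "'n::{finite,linorder} ratfun fps \<Rightarrow> complex fps" where
  "res_fps F = Abs_fps (\<lambda>k. res_G (fps_nth F k))"

definition cst_fps :: "complex fps \<Rightarrow> 'n::linorder ratfun fps" where
  "cst_fps p = Abs_fps (\<lambda>k. cst (fps_nth p k))"

lemma res_fps_add:
  assumes "\<And>k. fps_nth F k \<in> loc_at Var UNIV" "\<And>k. fps_nth G k \<in> loc_at Var UNIV"
  shows "res_fps (F + G) = res_fps F + res_fps G"
  using assms by (simp add: res_fps_def fps_eq_iff res_G_add)

lemma res_fps_scale:
  assumes "\<And>k. fps_nth F k \<in> loc_at Var UNIV"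
  shows "res_fps (cst_fps p * F) = p * res_fps F"
proof (rule fps_ext)
  fix n
  have "cst z * fps_nth F k \<in> loc_at Var UNIV" for z k
    using assms by (intro diff_ring.mult_mem[OF R_Var] diff_ring.emb_mem[OF R_Var])
  then show "fps_nth (res_fps (cst_fps p * F)) n = fps_nth (p * res_fps F) n"
    by (simp add: res_fps_def cst_fps_def fps_mult_nth res_G_sum res_G_scale assms)
qed

text \<open>All representatives have the same residue, so \<open>the_elem\<close> in
  \<open>res_vars\<close> is applied to a singleton.\<close>

lemma res_vars_cls:
  fixes z :: "('n + 'n::{finite,linorder}) set \<Rightarrow> 'n ratfun fps"
  assumes z: "z \<in> cocycles (cech Var 0) (2 * CARD('n))"
  shows "res_vars (cls (cech Var 0) (2 * CARD('n)) z) = res_fps (z UNIV)"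
proof -
  let ?C = "cech (Var :: 'n \<Rightarrow> 'n mpoly) 0"
  interpret cochain ?C by (rule cochain_cech[OF Var_nonzero])
  have nth: "fps_nth (w UNIV) k \<in> loc_at Var UNIV" if "w \<in> fst ?C j" for w k j
    using that by (auto simp: fst_cech forms_def cech_mod_UNIV[symmetric])
  have "res_fps (w UNIV) = res_fps (z UNIV)" if "w \<in> cls ?C (2 * CARD('n)) z" for w
  proof -
    have w: "w \<in> cocycles ?C (2 * CARD('n))" "z - w \<in> coboundaries ?C (2 * CARD('n))"
      using that z by (auto simp: mem_cls_iff)
    obtain m where m: "2 * CARD('n) = Suc m" by (metis card_sum_self card_gt_0_iff finite UNIV_not_empty gr0_implies_Suc)
    obtain y where y: "y \<in> forms (cech_mod Var) m" "z - w = ext_op (tw (cech_lam 0) cech_del) y"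
      using w(2) by (auto simp: m coboundaries_def fst_cech snd_cech)
    have zw: "z = w + (z - w)" by simp
    have "res_fps ((z - w) UNIV) = 0"
      unfolding y(2) res_fps_def fps_eq_iff by (simp add: res_G_coboundary[OF y(1)])
    moreover have "res_fps (z UNIV) = res_fps (w UNIV) + res_fps ((z - w) UNIV)"
    proof -
      have wz: "w \<in> fst ?C (2 * CARD('n))" "z - w \<in> fst ?C (2 * CARD('n))"
        using w z diff_mem by (simp_all add: cocycles_def)
      show ?thesis
        by (subst zw, subst plus_fun_apply, rule res_fps_add[OF nth[OF wz(1)] nth[OF wz(2)]])
    qed
    ultimately show ?thesis by simp
  qed
  then have "(\<lambda>z. Abs_fps (\<lambda>k. res_G (fps_nth (z UNIV) k))) ` cls ?C (2 * CARD('n)) z = {res_fps (z UNIV)}"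
    using self_in_cls[OF z] unfolding res_fps_def[symmetric] by blast
  then show ?thesis by (simp add: res_vars_def)
qed

text \<open>What is needed to adjoin the variables to a Cech family without changing its cohomology,
  and hence to read residues in the complex of x_1, ..., x_n.\<close>

locale parameters =
  fixes s :: "'i::{finite,linorder} \<Rightarrow> 'n::{finite,linorder} mpoly"
  assumes nonzero: "s i \<noteq> 0"
    and nilpotent: "\<exists>m q. Var j ^ m = (\<Sum>i\<in>UNIV. q i * s i ^ l)"
begin

lemma nonzero_Var: "case_sum s Var x \<noteq> 0"
  by (cases x) (simp_all add: nonzero Var_nonzero)

lemma bij_betw_first:
  "bij_betw (hmap (cech s 0) (2 * CARD('n)) (restr (map_sum Inl id)))
     (cohomology (cech (case_sum s Var) 0) (2 * CARD('n))) (cohomology (cech s 0) (2 * CARD('n)))"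
proof -
  have nil: "\<exists>m q. case_sum s Var t ^ m = (\<Sum>i\<in>UNIV. q i * case_sum s Var (Inl i) ^ l)" if t: "t \<notin> range Inl" for t l
  proof -
    obtain j where "t = Inr j" using t by (cases t) auto
    then show ?thesis using nilpotent[of j l] by simp
  qed
  show ?thesis
    using bij_betw_cech_restr[of "case_sum s Var" Inl "2 * CARD('n)" 0, OF nonzero_Var strict_mono_Inl _ nil]
    by simp
qed

lemma coh_map_first: "coh_map (cech (case_sum s Var) 0) (cech s 0) k (restr (map_sum Inl id))"
  using coh_map_cech_restr[of "case_sum s Var" Inl 0 k, OF nonzero_Var strict_mono_Inl] by simp

lemma coh_map_second: "coh_map (cech (case_sum s Var) 0) (cech Var 0) k (restr (map_sum Inr id))"
  using coh_map_cech_restr[of "case_sum s Var" Inr 0 k, OF nonzero_Var strict_mono_Inr] by simp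

text \<open>A cocycle over the combined family stands in for the \<open>inv_into\<close> inside
  \<open>change_cech\<close>.\<close>

definition lifts :: "((('i + 'n) + 'n) set \<Rightarrow> 'n ratfun fps) \<Rightarrow> (('i + 'n) set \<Rightarrow> 'n ratfun fps) \<Rightarrow> bool" where
  "lifts Y z \<longleftrightarrow> Y \<in> cocycles (cech (case_sum s Var) 0) (2 * CARD('n)) \<and>
     restr (map_sum Inl id) Y - z \<in> coboundaries (cech s 0) (2 * CARD('n))"

lemma lift_exists:
  assumes z: "z \<in> cocycles (cech s 0) (2 * CARD('n))"
  shows "\<exists>Y. lifts Y z"
proof -
  interpret coh_map "cech (case_sum s Var) 0" "cech s 0" "2 * CARD('n)" "restr (map_sum Inl id)"
    by (rule coh_map_first)
  have "cls (cech s 0) (2 * CARD('n)) z \<in> hmap (cech s 0) (2 * CARD('n)) (restr (map_sum Inl id)) `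
      cohomology (cech (case_sum s Var) 0) (2 * CARD('n))"
    using D.cls_mem[OF z] bij_betw_imp_surj_on[OF bij_betw_first] by simp
  then obtain Y where Y: "Y \<in> cocycles (cech (case_sum s Var) 0) (2 * CARD('n))"
    "cls (cech s 0) (2 * CARD('n)) z = cls (cech s 0) (2 * CARD('n)) (restr (map_sum Inl id) Y)"
    by (auto simp: C.cohomology_eq hmap_cls)
  then have "restr (map_sum Inl id) Y - z \<in> coboundaries (cech s 0) (2 * CARD('n))"
    using D.cls_eq_iff[OF cocycle[OF Y(1)] z] by simp
  then show ?thesis using Y(1) by (auto simp: lifts_def)
qed

text \<open>Bijectivity identifies the inverse image with the class of \<open>Y\<close>, so any lift
  may be used. The index set consists of all dx's and the \<alpha>'s belonging to the
  variables.\<close>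

lemma res_lift:
  assumes z: "z \<in> cocycles (cech s 0) (2 * CARD('n))" and Y: "lifts Y z"
  shows "res s (cls (cech s 0) (2 * CARD('n)) z) = res_fps (Y (range (map_sum Inr id)))"
proof -
  interpret A: coh_map "cech (case_sum s Var) 0" "cech s 0" "2 * CARD('n)" "restr (map_sum Inl id)"
    by (rule coh_map_first)
  interpret B: coh_map "cech (case_sum s Var) 0" "cech Var 0" "2 * CARD('n)" "restr (map_sum Inr id)"
    by (rule coh_map_second)
  let ?cY = "cls (cech (case_sum s Var) 0) (2 * CARD('n)) Y"
  have Yc: "Y \<in> cocycles (cech (case_sum s Var) 0) (2 * CARD('n))" using Y by (simp add: lifts_def)
  have "hmap (cech s 0) (2 * CARD('n)) (restr (map_sum Inl id)) ?cY = cls (cech s 0) (2 * CARD('n)) z"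
    using Y A.D.cls_eq_iff[OF A.cocycle[OF Yc] z] by (simp add: A.hmap_cls[OF Yc] lifts_def)
  then have "inv_into (cohomology (cech (case_sum s Var) 0) (2 * CARD('n)))
      (hmap (cech s 0) (2 * CARD('n)) (restr (map_sum Inl id))) (cls (cech s 0) (2 * CARD('n)) z) = ?cY"
    using inv_into_f_f[OF bij_betw_imp_inj_on[OF bij_betw_first] A.C.cls_mem[OF Yc]] by simp
  then have "res s (cls (cech s 0) (2 * CARD('n)) z) =
      res_vars (cls (cech Var 0) (2 * CARD('n)) (restr (map_sum Inr id) Y))"
    by (simp add: res_def change_cech_def B.hmap_cls[OF Yc])
  also have "\<dots> = res_fps (restr (map_sum Inr id) Y UNIV)" by (rule res_vars_cls[OF B.cocycle[OF Yc]])
  finally show ?thesis by (simp add: restr_def)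
qed

lemma lift_nth:
  assumes "lifts Y z"
  shows "fps_nth (Y (range (map_sum Inr id))) k \<in> loc_at Var UNIV"
proof -
  interpret B: coh_map "cech (case_sum s Var) 0" "cech Var 0" "2 * CARD('n)" "restr (map_sum Inr id)"
    by (rule coh_map_second)
  have "restr (map_sum Inr id) Y \<in> forms (cech_mod Var) (2 * CARD('n))"
    using B.cocycle[of Y] assms by (simp add: lifts_def cocycles_def fst_cech)
  then have "fps_nth (restr (map_sum Inr id) Y UNIV) k \<in> loc_at Var UNIV"
    by (auto simp: forms_def cech_mod_UNIV[symmetric])
  then show ?thesis by (simp add: restr_def)
qed

lemma res_add:
  assumes "z \<in> cocycles (cech s 0) (2 * CARD('n))" "w \<in> cocycles (cech s 0) (2 * CARD('n))"
  shows "res s (cls (cech s 0) (2 * CARD('n)) (z + w)) =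
     res s (cls (cech s 0) (2 * CARD('n)) z) + res s (cls (cech s 0) (2 * CARD('n)) w)"
proof -
  interpret A: coh_map "cech (case_sum s Var) 0" "cech s 0" "2 * CARD('n)" "restr (map_sum Inl id)"
    by (rule coh_map_first)
  obtain Y W where YW: "lifts Y z" "lifts W w" using lift_exists assms by metis
  have "restr (map_sum Inl id) (Y + W) - (z + w) =
      (restr (map_sum Inl id) Y - z) + (restr (map_sum Inl id) W - w)"
    by (simp add: additive.add[OF A.additive])
  then have "lifts (Y + W) (z + w)"
    using YW A.C.cocycles_add A.D.coboundaries_add unfolding lifts_def by presburger
  then show ?thesis
    using YW assms A.D.cocycles_add
    by (simp add: res_lift res_fps_add[OF lift_nth lift_nth])
qed

end

text \<open>The derivations annihilate constants; this is the linearity of the differentials over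
  complex power series in u.\<close>

lemma tw_cst_fps:
  assumes "del g = (\<lambda>_. 0) \<or> (\<exists>j. del g = rat_deriv j)"
  shows "tw lam del g (cst_fps p * F) = cst_fps p * tw lam del g F"
proof -
  have "Abs_fps (\<lambda>k. del g (fps_nth (cst_fps p * F) k)) = cst_fps p * Abs_fps (\<lambda>k. del g (fps_nth F k))"
    using assms
    by (auto simp: fps_eq_iff fps_mult_nth cst_fps_def rat_deriv_sum rat_deriv_mult)
  then show ?thesis unfolding tw_def by (simp add: algebra_simps)
qed

lemma ext_op_cst_fps:
  assumes "\<And>g. del g = (\<lambda>_. 0) \<or> (\<exists>j. del g = rat_deriv j)"
  shows "ext_op (tw lam del) (\<lambda>S. cst_fps p * \<omega> S) = (\<lambda>S. cst_fps p * ext_op (tw lam del) \<omega> S)"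
proof -
  have "tw lam del g (cst_fps p * F) = cst_fps p * tw lam del g F" for g F
    by (rule tw_cst_fps[OF assms])
  then show ?thesis
    unfolding ext_op_def fun_eq_iff by (simp add: sum_distrib_left mult.left_commute)
qed

lemma cech_del_cases: "cech_del g = (\<lambda>_. 0) \<or> (\<exists>j. cech_del g = rat_deriv j)"
  by (cases g) auto

lemma cst_fps_mem:
  assumes "diff_ring R" "\<And>k. fps_nth F k \<in> R"
  shows "fps_nth (cst_fps p * F) k \<in> R"
  unfolding fps_mult_nth cst_fps_def fps_nth_Abs_fps
  by (intro diff_ring.sum_mem[OF assms(1)] diff_ring.mult_mem[OF assms(1)] diff_ring.emb_mem[OF assms(1)] assms(2))

lemma forms_cech_scale:
  fixes s :: "'i::{finite,linorder} \<Rightarrow> 'n::{finite,linorder} mpoly"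
  assumes nz: "\<And>i. s i \<noteq> 0" and "\<omega> \<in> forms (cech_mod s) k"
  shows "(\<lambda>S. cst_fps p * \<omega> S) \<in> forms (cech_mod s) k"
  using assms(2) cst_fps_mem[OF diff_ring_loc_at[of s, OF nz]]
  by (auto simp: forms_def cech_mod_def)

lemma cocycles_cech_scale:
  fixes s :: "'i::{finite,linorder} \<Rightarrow> 'n::{finite,linorder} mpoly"
  assumes nz: "\<And>i. s i \<noteq> 0" and "z \<in> cocycles (cech s \<phi>) k"
  shows "(\<lambda>S. cst_fps p * z S) \<in> cocycles (cech s \<phi>) k"
  using assms(2) forms_cech_scale[of s z k p, OF nz]
  by (simp add: cocycles_def fst_cech snd_cech ext_op_cst_fps[OF cech_del_cases] fun_eq_iff)

lemma coboundaries_cech_scale: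
  fixes s :: "'i::{finite,linorder} \<Rightarrow> 'n::{finite,linorder} mpoly"
  assumes nz: "\<And>i. s i \<noteq> 0" and "z \<in> coboundaries (cech s \<phi>) k"
  shows "(\<lambda>S. cst_fps p * z S) \<in> coboundaries (cech s \<phi>) k"
proof (cases k)
  case 0
  then show ?thesis using assms(2) by (auto simp: coboundaries_def fun_eq_iff)
next
  case (Suc j)
  then obtain y where y: "y \<in> forms (cech_mod s) j" "z = ext_op (tw (cech_lam \<phi>) cech_del) y"
    using assms(2) by (auto simp: coboundaries_def fst_cech snd_cech)
  then have "(\<lambda>S. cst_fps p * z S) = ext_op (tw (cech_lam \<phi>) cech_del) (\<lambda>S. cst_fps p * y S)"
    by (simp add: ext_op_cst_fps[OF cech_del_cases])
  then show ?thesis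
    using forms_cech_scale[of s y j p, OF nz y(1)] Suc by (auto simp: coboundaries_def fst_cech snd_cech)
qed

context parameters
begin

lemma res_scale:
  assumes z: "z \<in> cocycles (cech s 0) (2 * CARD('n))"
  shows "res s (cls (cech s 0) (2 * CARD('n)) (\<lambda>S. cst_fps p * z S)) =
     p * res s (cls (cech s 0) (2 * CARD('n)) z)"
proof -
  obtain Y where Y: "lifts Y z" using lift_exists[OF z] by blast
  have "(\<lambda>S. restr (map_sum Inl id) (\<lambda>S. cst_fps p * Y S) S - cst_fps p * z S) =
     (\<lambda>S. cst_fps p * (restr (map_sum Inl id) Y - z) S)"
    by (simp add: restr_def right_diff_distrib)
  then have e: "restr (map_sum Inl id) (\<lambda>S. cst_fps p * Y S) - (\<lambda>S. cst_fps p * z S) =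
     (\<lambda>S. cst_fps p * (restr (map_sum Inl id) Y - z) S)"
    by (simp add: fun_diff_def)
  have "lifts (\<lambda>S. cst_fps p * Y S) (\<lambda>S. cst_fps p * z S)"
    unfolding lifts_def e using Y unfolding lifts_def
    by (intro conjI cocycles_cech_scale[of "case_sum s Var", OF nonzero_Var] coboundaries_cech_scale[of s, OF nonzero])
      blast+
  then show ?thesis
    using Y by (simp add: res_lift z cocycles_cech_scale[of s, OF nonzero] res_fps_scale[OF lift_nth[OF Y]])
qed

end

section \<open>The product on the level of forms and its Leibniz rule\<close>

section \<open>Products\<close>

definition shuffle_sign :: "'g::linorder set \<Rightarrow> 'g set \<Rightarrow> 'a::ring_1" where
  "shuffle_sign A B = (- 1) ^ card {(a, b). a \<in> A \<and> b \<in> B \<and> b < a}"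

lemma wedge_eq: "(\<omega> \<^bold>\<and> \<eta>) S = (\<Sum>A\<in>Pow S. shuffle_sign A (S - A) * \<omega> A * \<eta> (S - A))"
  by (simp add: wedge_def shuffle_sign_def)

lemma shuffle_sign_cases: "shuffle_sign A B = (1 :: 'a::ring_1) \<or> shuffle_sign A B = (- 1 :: 'a)"
  unfolding shuffle_sign_def using neg_one_even_power neg_one_odd_power by blast

lemma shuffle_sign_empty [simp]: "shuffle_sign {} B = 1" "shuffle_sign A {} = 1"
  by (simp_all add: shuffle_sign_def)

lemma shuffle_sign_insert_left:
  fixes g :: "'g::{finite,linorder}"
  assumes "g \<notin> A"
  shows "shuffle_sign (insert g A) B = (shuffle_sign A B * es g B :: 'a::comm_ring_1)"
proof -
  have "{(a, b). a \<in> insert g A \<and> b \<in> B \<and> b < a} =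
      {(a, b). a \<in> A \<and> b \<in> B \<and> b < a} \<union> Pair g ` {b \<in> B. b < g}" by auto
  also have "card \<dots> = card {(a, b). a \<in> A \<and> b \<in> B \<and> b < a} + card (Pair g ` {b \<in> B. b < g})"
    using assms by (intro card_Un_disjoint) auto
  also have "card (Pair g ` {b \<in> B. b < g}) = card {b \<in> B. b < g}"
    by (simp add: card_image inj_on_def)
  finally show ?thesis by (simp add: shuffle_sign_def es_def power_add)
qed

text \<open>The sign of moving \<open>g\<close>, standing right of \<open>A\<close>, past the larger
  members of \<open>A\<close>.\<close>

definition es_above :: "'g::linorder \<Rightarrow> 'g set \<Rightarrow> 'a::ring_1" where
  "es_above g A = (- 1) ^ card {a \<in> A. g < a}"

lemma es_above_sq: "es_above g A * es_above g A = (1 :: 'a::comm_ring_1)"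
  by (simp add: es_above_def flip: power_add)

lemma shuffle_sign_insert_right:
  fixes g :: "'g::{finite,linorder}"
  assumes "g \<notin> B"
  shows "shuffle_sign A (insert g B) = (shuffle_sign A B * es_above g A :: 'a::comm_ring_1)"
proof -
  have "{(a, b). a \<in> A \<and> b \<in> insert g B \<and> b < a} =
      {(a, b). a \<in> A \<and> b \<in> B \<and> b < a} \<union> (\<lambda>a. (a, g)) ` {a \<in> A. g < a}" by auto
  also have "card \<dots> = card {(a, b). a \<in> A \<and> b \<in> B \<and> b < a} + card ((\<lambda>a. (a, g)) ` {a \<in> A. g < a})"
    using assms by (intro card_Un_disjoint) auto
  also have "card ((\<lambda>a. (a, g)) ` {a \<in> A. g < a}) = card {a \<in> A. g < a}"
    by (simp add: card_image inj_on_def)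
  finally show ?thesis by (simp add: shuffle_sign_def es_above_def power_add)
qed

lemma es_union:
  fixes g :: "'g::{finite,linorder}"
  assumes "A \<inter> B = {}"
  shows "es g (A \<union> B) = (es g A * es g B :: 'a::comm_ring_1)"
proof -
  have "{b \<in> A \<union> B. b < g} = {b \<in> A. b < g} \<union> {b \<in> B. b < g}" by auto
  then have "card {b \<in> A \<union> B. b < g} = card {b \<in> A. b < g} + card {b \<in> B. b < g}"
    using assms by (simp add: card_Un_disjoint disjoint_iff)
  then show ?thesis by (simp add: es_def power_add)
qed

lemma es_es_above:
  fixes g :: "'g::{finite,linorder}"
  assumes "g \<notin> A"
  shows "es g A * es_above g A = ((- 1) ^ card A :: 'a::comm_ring_1)"
proof -
  have "x \<in> A \<longleftrightarrow> x \<in> {a \<in> A. a < g} \<union> {a \<in> A. g < a}" for x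
    by (cases x g rule: linorder_cases) (use assms in auto)
  then have "A = {a \<in> A. a < g} \<union> {a \<in> A. g < a}" by (rule set_eqI)
  then have "card A = card ({a \<in> A. a < g} \<union> {a \<in> A. g < a})" by simp
  also have "\<dots> = card {a \<in> A. a < g} + card {a \<in> A. g < a}"
    by (intro card_Un_disjoint) auto
  finally show ?thesis by (simp add: es_def es_above_def power_add)
qed

text \<open>Graded Leibniz rule. Three operators are kept apart because the two factors and their
  product carry different twists.\<close>

lemma ext_op_wedge:
  fixes \<omega> \<eta> :: "'g::{finite,linorder} set \<Rightarrow> 'a::comm_ring_1"
  assumes add: "\<And>g. additive (\<Delta> g)"
    and leibniz: "\<And>g x y. \<Delta> g (x * y) = \<Delta>' g x * y + x * \<Delta>'' g y"
  shows "ext_op \<Delta> (\<omega> \<^bold>\<and> \<eta>) = ext_op \<Delta>' \<omega> \<^bold>\<and> \<eta> + (\<lambda>A. (- 1) ^ card A * \<omega> A) \<^bold>\<and> ext_op \<Delta>'' \<eta>"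
proof
  fix S
  have sg: "\<Delta> g (shuffle_sign A B * x) = shuffle_sign A B * \<Delta> g x" for g A B x
    by (rule disjE[OF shuffle_sign_cases[of A B, where 'a = 'a]]) (simp_all add: additive.minus[OF add])
  let ?F = "\<lambda>g A. es g S * shuffle_sign A (S - {g} - A) * (\<Delta>' g (\<omega> A) * \<eta> (S - {g} - A))"
  let ?G = "\<lambda>g A. es g S * shuffle_sign A (S - {g} - A) * (\<omega> A * \<Delta>'' g (\<eta> (S - {g} - A)))"
  have tm: "\<Delta> g (shuffle_sign A B * x * y) = shuffle_sign A B * (\<Delta>' g x * y) + shuffle_sign A B * (x * \<Delta>'' g y)"
    for g A B x y by (simp only: mult.assoc sg) (simp only: leibniz distrib_left)
  have "ext_op \<Delta> (\<omega> \<^bold>\<and> \<eta>) S = (\<Sum>g\<in>S. \<Sum>A\<in>Pow (S - {g}). ?F g A + ?G g A)"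
    unfolding ext_op_def wedge_eq additive.sum[OF add] tm
    by (simp only: mult.assoc sum_distrib_left distrib_left)
  then have "ext_op \<Delta> (\<omega> \<^bold>\<and> \<eta>) S =
      (\<Sum>g\<in>S. \<Sum>A\<in>Pow (S - {g}). ?F g A) + (\<Sum>g\<in>S. \<Sum>A\<in>Pow (S - {g}). ?G g A)"
    by (simp only: sum.distrib)
  moreover have "(\<Sum>g\<in>S. \<Sum>A\<in>Pow (S - {g}). ?F g A) = (ext_op \<Delta>' \<omega> \<^bold>\<and> \<eta>) S"
  proof -
    have "(\<Sum>g\<in>S. \<Sum>A\<in>Pow (S - {g}). ?F g A) = (\<Sum>(g, A)\<in>Sigma S (\<lambda>g. Pow (S - {g})). ?F g A)"
      by (subst sum.Sigma) auto
    also have "\<dots> = (\<Sum>(A, g)\<in>Sigma (Pow S) (\<lambda>A. A).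
        shuffle_sign A (S - A) * (es g A * \<Delta>' g (\<omega> (A - {g}))) * \<eta> (S - A))"
    proof (rule sum.reindex_bij_witness[of _ "\<lambda>(A, g). (g, A - {g})" "\<lambda>(g, A). (insert g A, g)"]; clarsimp)
      fix g A assume g: "g \<in> S" "A \<subseteq> S - {g}"
      have A: "insert g A - {g} = A" "S - insert g A = S - {g} - A" "g \<notin> A" using g by auto
      have S: "S = insert g A \<union> (S - {g} - A)" using g by auto
      have "es g S = es g (insert g A \<union> (S - {g} - A))" using S by simp
      also have "\<dots> = (es g A * es g (S - {g} - A) :: 'a)"
        using g by (subst es_union) auto
      finally have "es g S * shuffle_sign A (S - {g} - A) =
          (shuffle_sign (insert g A) (S - {g} - A) * es g A :: 'a)"
        unfolding shuffle_sign_insert_left[OF A(3)] by (simp add: mult_ac)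
      then show "shuffle_sign (insert g A) (S - insert g A) * (es g A * \<Delta>' g (\<omega> (A - {g}))) * \<eta> (S - insert g A) = ?F g A"
        unfolding A(2) using A(3) by (simp add: mult_ac)
    qed auto
    also have "\<dots> = (\<Sum>A\<in>Pow S. \<Sum>g\<in>A. shuffle_sign A (S - A) * (es g A * \<Delta>' g (\<omega> (A - {g}))) * \<eta> (S - A))"
      by (subst sum.Sigma) (auto intro: finite_subset)
    also have "\<dots> = (ext_op \<Delta>' \<omega> \<^bold>\<and> \<eta>) S"
      unfolding wedge_eq ext_op_def by (simp add: sum_distrib_left sum_distrib_right)
    finally show ?thesis .
  qed
  moreover have "(\<Sum>g\<in>S. \<Sum>A\<in>Pow (S - {g}). ?G g A) = ((\<lambda>A. (- 1) ^ card A * \<omega> A) \<^bold>\<and> ext_op \<Delta>'' \<eta>) S"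
  proof -
    have "(\<Sum>g\<in>S. \<Sum>A\<in>Pow (S - {g}). ?G g A) = (\<Sum>(g, A)\<in>Sigma S (\<lambda>g. Pow (S - {g})). ?G g A)"
      by (subst sum.Sigma) auto
    also have "\<dots> = (\<Sum>(A, g)\<in>Sigma (Pow S) (\<lambda>A. S - A).
        shuffle_sign A (S - A) * ((- 1) ^ card A * \<omega> A) * (es g (S - A) * \<Delta>'' g (\<eta> (S - A - {g}))))"
    proof (rule sum.reindex_bij_witness[of _ "\<lambda>(A, g). (g, A)" "\<lambda>(g, A). (A, g)"]; clarsimp)
      fix g A assume g: "g \<in> S" "A \<subseteq> S - {g}"
      let ?B = "S - {g} - A"
      have A: "S - A = insert g ?B" "S - A - {g} = ?B" "g \<notin> A" "g \<notin> ?B" using g by auto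
      have S: "S = A \<union> insert g ?B" using g by auto
      have "es g S = es g (A \<union> insert g ?B)" using S by simp
      also have "\<dots> = (es g A * es g ?B :: 'a)"
        using g by (subst es_union) auto
      finally have 1: "es g S = (es g A * es g ?B :: 'a)" .
      \<comment> \<open>\<open>es_above g A\<close> enters twice, through the shuffle sign and
        through (-1)^card A, and squares to 1.\<close>
      have 2: "shuffle_sign A (S - A) * ((- 1) ^ card A) * es g (S - A) =
          (shuffle_sign A ?B * (es g A * es g ?B) * (es_above g A * es_above g A) :: 'a)"
        unfolding A(1) shuffle_sign_insert_right[OF A(4)] es_es_above[OF A(3), symmetric] es_insert_self
        by (simp add: mult_ac)
      have "shuffle_sign A (S - A) * ((- 1) ^ card A * \<omega> A) * (es g (S - A) * \<Delta>'' g (\<eta> (S - A - {g}))) =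
         (shuffle_sign A (S - A) * ((- 1) ^ card A) * es g (S - A)) * (\<omega> A * \<Delta>'' g (\<eta> (S - A - {g})))"
        by (simp only: mult_ac)
      then show "shuffle_sign A (S - A) * ((- 1) ^ card A * \<omega> A) * (es g (S - A) * \<Delta>'' g (\<eta> (S - A - {g}))) = ?G g A"
        unfolding 1 2 es_above_sq A(2) by (simp only: mult_ac mult_1_left mult_1_right)
    qed auto
    also have "\<dots> = (\<Sum>A\<in>Pow S. \<Sum>g\<in>S-A.
        shuffle_sign A (S - A) * ((- 1) ^ card A * \<omega> A) * (es g (S - A) * \<Delta>'' g (\<eta> (S - A - {g}))))"
      by (subst sum.Sigma) auto
    also have "\<dots> = ((\<lambda>A. (- 1) ^ card A * \<omega> A) \<^bold>\<and> ext_op \<Delta>'' \<eta>) S"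
      unfolding wedge_eq ext_op_def by (simp add: sum_distrib_left)
    finally show ?thesis .
  qed
  ultimately show "ext_op \<Delta> (\<omega> \<^bold>\<and> \<eta>) S =
      (ext_op \<Delta>' \<omega> \<^bold>\<and> \<eta> + (\<lambda>A. (- 1) ^ card A * \<omega> A) \<^bold>\<and> ext_op \<Delta>'' \<eta>) S"
    by simp
qed

lemma additive_wedge_left: "additive (\<lambda>\<omega>. \<omega> \<^bold>\<and> \<eta>)"
  by (auto simp: additive_def wedge_eq fun_eq_iff distrib_left distrib_right sum.distrib)

lemma additive_wedge_right: "additive (\<lambda>\<eta>. \<omega> \<^bold>\<and> \<eta>)"
  by (auto simp: additive_def wedge_eq fun_eq_iff distrib_left distrib_right sum.distrib)

lemma additive_extend: "additive (extend e)"
  by (auto simp: additive_def extend_def fun_eq_iff)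

abbreviation inj1 :: "'i + 'n \<Rightarrow> ('i + 'j) + 'n" where "inj1 \<equiv> map_sum Inl id"
abbreviation inj2 :: "'j + 'n \<Rightarrow> ('i + 'j) + 'n" where "inj2 \<equiv> map_sum Inr id"

text \<open>The product on representatives: the two copies of the \<alpha>'s stay disjoint, whereas
  the dx's are shared and multiply as forms.\<close>

definition kprod :: "(('i + 'n) set \<Rightarrow> 'n ratfun fps) \<Rightarrow> (('j + 'n) set \<Rightarrow> 'n ratfun fps) \<Rightarrow>
    (('i::{finite,linorder} + 'j::{finite,linorder}) + 'n::{finite,linorder}) set \<Rightarrow> 'n ratfun fps" where
  "kprod z w = extend inj1 z \<^bold>\<and> extend inj2 w"

lemma kprod_add_left: "kprod (z + z') w = kprod z w + kprod z' w"
  unfolding kprod_def by (simp only: additive.add[OF additive_extend] additive.add[OF additive_wedge_left])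

lemma kprod_add_right: "kprod z (w + w') = kprod z w + kprod z w'"
  unfolding kprod_def by (simp only: additive.add[OF additive_extend] additive.add[OF additive_wedge_right])

lemma kprod_zero [simp]: "kprod 0 w = 0" "kprod z 0 = 0"
  unfolding kprod_def
  by (simp_all only: additive.zero[OF additive_extend] additive.zero[OF additive_wedge_left] additive.zero[OF additive_wedge_right])

lemma inj_inj1: "strict_mono (inj1 :: 'i::linorder + 'n::linorder \<Rightarrow> ('i + 'j::linorder) + 'n)"
  by (rule strict_mono_map_sum[OF strict_mono_Inl])

lemma inj_inj2: "strict_mono (inj2 :: 'j::linorder + 'n::linorder \<Rightarrow> ('i::linorder + 'j) + 'n)"
  by (rule strict_mono_map_sum[OF strict_mono_Inr])

text \<open>The twist of the product is split as \<open>l1 + l2\<close>: each part sees one copy of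
  the \<alpha>'s, and on the dx's the parts are d\<phi> and d\<psi>, which cancel. The derivations
  are common, so the Leibniz rule holds generator by generator.\<close>

lemma kprod_d:
  fixes z :: "('i::{finite,linorder} + 'n::{finite,linorder}) set \<Rightarrow> 'n ratfun fps"
    and w :: "('j::{finite,linorder} + 'n) set \<Rightarrow> 'n ratfun fps"
  assumes opp: "\<psi> = - \<phi>" and z: "\<And>S. z S \<noteq> 0 \<Longrightarrow> card S = a"
  shows "ext_op (tw (cech_lam 0) cech_del) (kprod z w) =
     kprod (ext_op (tw (cech_lam \<phi>) cech_del) z) w + (\<lambda>S. (- 1) ^ a * kprod z (ext_op (tw (cech_lam \<psi>) cech_del) w) S)"
proof -
  define l1 l2 :: "('i + 'j) + 'n \<Rightarrow> 'n ratfun" where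
    "l1 = case_sum (case_sum (\<lambda>_. 1) (\<lambda>_. 0)) (dR_lam \<phi>)" and
    "l2 = case_sum (case_sum (\<lambda>_. 0) (\<lambda>_. 1)) (dR_lam \<psi>)"
  have tw0: "tw l1 cech_del (Inl (Inr j)) F = 0" "tw l2 cech_del (Inl (Inl i)) F = 0" for i j F
    by (auto simp: tw_def l1_def l2_def fps_eq_iff fps_mult_fps_X_commute)
  have e1: "ext_op (tw l1 cech_del) (extend inj1 z) = extend inj1 (ext_op (tw (cech_lam \<phi>) cech_del) z)"
  proof -
    have "tw l1 cech_del (inj1 g) = tw (cech_lam \<phi>) cech_del g" for g :: "'i + 'n"
      by (cases g) (simp_all add: tw_def l1_def fun_eq_iff)
    moreover have "tw l1 cech_del g x = 0" if g: "g \<notin> range (inj1 :: 'i + 'n \<Rightarrow> ('i + 'j) + 'n)" for g x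
    proof -
      have "inj1 (Inl i) = Inl (Inl i)" "inj1 (Inr k) = Inr k" for i :: 'i and k :: 'n by simp_all
      then obtain j where "g = Inl (Inr j)"
        using g by (metis obj_sumE range_eqI)
      then show ?thesis by (simp add: tw0)
    qed
    moreover have "tw l1 cech_del g 0 = 0" for g
      by (cases g) (auto simp: tw_def fps_eq_iff fps_mult_fps_X_commute cech_del_def)
    ultimately show ?thesis by (subst extend_ext_op[OF inj_inj1]) simp_all
  qed
  have e2: "ext_op (tw l2 cech_del) (extend inj2 w) = extend inj2 (ext_op (tw (cech_lam \<psi>) cech_del) w)"
  proof -
    have "tw l2 cech_del (inj2 g) = tw (cech_lam \<psi>) cech_del g" for g :: "'j + 'n"
      by (cases g) (simp_all add: tw_def l2_def fun_eq_iff)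
    moreover have "tw l2 cech_del g x = 0" if g: "g \<notin> range (inj2 :: 'j + 'n \<Rightarrow> ('i + 'j) + 'n)" for g x
    proof -
      have "inj2 (Inl i) = Inl (Inr i)" "inj2 (Inr k) = Inr k" for i :: 'j and k :: 'n by simp_all
      then obtain j where "g = Inl (Inl j)"
        using g by (metis obj_sumE range_eqI)
      then show ?thesis by (simp add: tw0)
    qed
    moreover have "tw l2 cech_del g 0 = 0" for g
      by (cases g) (auto simp: tw_def fps_eq_iff fps_mult_fps_X_commute cech_del_def)
    ultimately show ?thesis by (subst extend_ext_op[OF inj_inj2]) simp_all
  qed
  have leib: "tw (cech_lam 0) cech_del g (x * y) = tw l1 cech_del g x * y + x * tw l2 cech_del g y" for g x y
  proof (cases g)
    case (Inl h)
    then show ?thesis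
      by (cases h) (simp_all add: tw_cech_Inl tw0, simp_all add: tw_def l1_def l2_def fps_eq_iff fps_mult_fps_X_commute)
  next
    case (Inr j)
    have "Abs_fps (\<lambda>k. rat_deriv j (fps_nth (x * y) k)) =
        Abs_fps (\<lambda>k. rat_deriv j (fps_nth x k)) * y + x * Abs_fps (\<lambda>k. rat_deriv j (fps_nth y k))"
      by (simp add: fps_eq_iff fps_mult_nth rat_deriv_sum rat_deriv_mult sum.distrib)
    then show ?thesis
      by (simp add: Inr tw_def l1_def l2_def opp mpderiv_minus algebra_simps flip: fps_const_neg)
  qed
  have add: "additive (tw (cech_lam 0) cech_del g)" for g :: "('i + 'j) + 'n"
    by (rule twisted.additive_tw[OF twisted_cech])
  \<comment> \<open>\<open>z\<close> is homogeneous of degree \<open>a\<close>, so the degree sign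
    of the Leibniz rule is constant where \<open>z\<close> does not vanish.\<close>
  have sg: "(\<lambda>A :: (('i + 'j) + 'n) set. (- 1) ^ card A * extend inj1 z A) = (\<lambda>A. (- 1) ^ a * extend inj1 z A)"
  proof
    fix A :: "(('i + 'j) + 'n) set"
    have "card A = a" if "extend inj1 z A \<noteq> 0"
    proof -
      have A: "A \<subseteq> range inj1" "z (inj1 -` A) \<noteq> 0" using that by (auto simp: extend_def split: if_splits)
      have "card (inj1 -` A) = card A" by (rule card_vimage_inj[OF strict_mono_imp_inj_on[OF inj_inj1] A(1)])
      then show ?thesis using z[OF A(2)] by simp
    qed
    then show "(- 1) ^ card A * extend inj1 z A = (- 1) ^ a * extend inj1 z A" by fastforce
  qed
  show ?thesis
    unfolding kprod_def ext_op_wedge[OF add leib] e1 e2 sg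
    by (simp add: fun_eq_iff wedge_eq sum_distrib_left mult_ac)
qed

lemma kprod_mem:
  fixes z :: "('i::{finite,linorder} + 'n::{finite,linorder}) set \<Rightarrow> 'n ratfun fps"
    and w :: "('j::{finite,linorder} + 'n) set \<Rightarrow> 'n ratfun fps"
  assumes nz: "\<And>i. s i \<noteq> 0" "\<And>j. t j \<noteq> 0"
    and z: "z \<in> forms (cech_mod s) a" and w: "w \<in> forms (cech_mod t) b"
  shows "kprod z w \<in> forms (cech_mod (case_sum s t)) (a + b)"
proof -
  have nz': "case_sum s t x \<noteq> 0" for x using nz by (cases x) auto
  interpret form_cx "cech_lam 0" cech_del "cech_mod (case_sum s t)"
    by (rule form_cx_cech[of "case_sum s t", OF nz'])
  have "cech_mod (case_sum s t) (inj1 ` S) = cech_mod s S" for S :: "('i + 'n) set"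
    by (subst cech_mod_restr) simp_all
  then have "z \<in> forms (\<lambda>S. cech_mod (case_sum s t) (inj1 ` S)) a" using z by simp
  then have z': "extend inj1 z \<in> forms (cech_mod (case_sum s t)) a"
    by (rule extend_forms[OF strict_mono_imp_inj_on[OF inj_inj1]])
  have "cech_mod (case_sum s t) (inj2 ` S) = cech_mod t S" for S :: "('j + 'n) set"
    by (subst cech_mod_restr) simp_all
  then have "w \<in> forms (\<lambda>S. cech_mod (case_sum s t) (inj2 ` S)) b" using w by simp
  then have w': "extend inj2 w \<in> forms (cech_mod (case_sum s t)) b"
    by (rule extend_forms[OF strict_mono_imp_inj_on[OF inj_inj2]])
  have R: "diff_ring (cech_mod (case_sum s t) S)" for S :: "(('i + 'j) + 'n) set"
    unfolding cech_mod_def by (rule diff_ring_loc_at[of "case_sum s t", OF nz'])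
  have mono: "cech_mod (case_sum s t) A \<subseteq> cech_mod (case_sum s t) S" if "A \<subseteq> S" for A S :: "(('i + 'j) + 'n) set"
    unfolding cech_mod_def by (rule loc_at_mono[OF _ nz']) (use that in auto)
  have "fps_nth (shuffle_sign A (S - A) * extend inj1 z A * extend inj2 w (S - A)) k \<in> cech_mod (case_sum s t) S"
    if "A \<subseteq> S" for A S k
  proof -
    have "fps_nth (extend inj1 z A) i \<in> cech_mod (case_sum s t) S" for i
      using z' mono[OF that] by (auto simp: forms_def)
    moreover have "fps_nth (extend inj2 w (S - A)) i \<in> cech_mod (case_sum s t) S" for i
      using w' mono[of "S - A" S] by (auto simp: forms_def)
    ultimately have "fps_nth (extend inj1 z A * extend inj2 w (S - A)) k \<in> cech_mod (case_sum s t) S"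
      unfolding fps_mult_nth by (intro diff_ring.sum_mem[OF R] diff_ring.mult_mem[OF R])
    then show ?thesis
      using shuffle_sign_cases[of A "S - A", where 'a = "'n ratfun fps"] diff_ring.minus_mem[OF R] by auto
  qed
  then have 1: "fps_nth (kprod z w S) k \<in> cech_mod (case_sum s t) S" for S k
    unfolding kprod_def wedge_eq fps_sum_nth by (intro diff_ring.sum_mem[OF R]) simp
  have 2: "card S = a + b" if nz: "kprod z w S \<noteq> 0" for S
  proof -
    obtain A where A: "A \<in> Pow S" "shuffle_sign A (S - A) * extend inj1 z A * extend inj2 w (S - A) \<noteq> 0"
      using sum_nonzero[OF nz[unfolded kprod_def wedge_eq]] by blast
    then have "extend inj1 z A \<noteq> 0" "extend inj2 w (S - A) \<noteq> 0" by auto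
    then have "card A = a" "card (S - A) = b" using z' w' by (auto simp: forms_def)
    moreover have "card A + card (S - A) = card S"
      using A(1) card_mono[of S A] by (simp add: card_Diff_subset)
    ultimately show ?thesis by simp
  qed
  show ?thesis using 1 2 by (simp add: forms_def)
qed

text \<open>Well-definedness rests on zw - z'w' = (z - z') w + z' (w - w'): each summand is, up to
  sign, the differential of a product with a primitive.\<close>

lemma kun_wedge_cls:
  fixes s :: "'i::{finite,linorder} \<Rightarrow> 'n::{finite,linorder} mpoly" and t :: "'j::{finite,linorder} \<Rightarrow> 'n mpoly"
  assumes nz: "\<And>i. s i \<noteq> 0" "\<And>j. t j \<noteq> 0" and opp: "\<psi> = - \<phi>"
    and z: "z \<in> cocycles (cech s \<phi>) CARD('n)" and w: "w \<in> cocycles (cech t \<psi>) CARD('n)"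
  shows "kprod z w \<in> cocycles (cech (case_sum s t) 0) (2 * CARD('n))"
    and "kun_wedge s t (cls (cech s \<phi>) CARD('n) z) (cls (cech t \<psi>) CARD('n) w) =
      cls (cech (case_sum s t) 0) (2 * CARD('n)) (kprod z w)"
proof -
  let ?n = "CARD('n)"
  have nz': "case_sum s t x \<noteq> 0" for x using nz by (cases x) auto
  interpret A: cochain "cech s \<phi>" by (rule cochain_cech[of s, OF nz(1)])
  interpret B: cochain "cech t \<psi>" by (rule cochain_cech[of t, OF nz(2)])
  interpret C: cochain "cech (case_sum s t) 0" by (rule cochain_cech[of "case_sum s t", OF nz'])
  let ?dA = "ext_op (tw (cech_lam \<phi>) cech_del)" and ?dB = "ext_op (tw (cech_lam \<psi>) cech_del)"
  let ?dC = "ext_op (tw (cech_lam 0) cech_del)"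
  have cocycle: "kprod z w \<in> cocycles (cech (case_sum s t) 0) (2 * ?n)"
    if "z \<in> cocycles (cech s \<phi>) ?n" "w \<in> cocycles (cech t \<psi>) ?n" for z w
  proof -
    have zw: "z \<in> forms (cech_mod s) ?n" "w \<in> forms (cech_mod t) ?n" "?dA z = 0" "?dB w = 0"
      using that by (simp_all add: cocycles_def fst_cech snd_cech)
    have "?dC (kprod z w) = kprod (?dA z) w + (\<lambda>S. (- 1) ^ ?n * kprod z (?dB w) S)"
      by (rule kprod_d[OF opp]) (use zw(1) in \<open>simp add: forms_def\<close>)
    then have "?dC (kprod z w) = 0" unfolding zw(3,4) kprod_zero by (simp add: fun_eq_iff)
    then show ?thesis
      using kprod_mem[of s t, OF nz zw(1,2)] by (simp add: cocycles_def fst_cech snd_cech mult_2)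
  qed
  show "kprod z w \<in> cocycles (cech (case_sum s t) 0) (2 * ?n)" by (rule cocycle[OF z w])
  obtain m where m: "?n = Suc m" by (metis card_gt_0_iff finite UNIV_not_empty gr0_implies_Suc)
  have m2: "2 * ?n = Suc (m + ?n)" using m by simp
  have eq: "cls (cech (case_sum s t) 0) (2 * ?n) (kprod z' w') = cls (cech (case_sum s t) 0) (2 * ?n) (kprod z w)"
    if zw': "z' \<in> cls (cech s \<phi>) ?n z" "w' \<in> cls (cech t \<psi>) ?n w" for z' w'
  proof -
    have z': "z' \<in> cocycles (cech s \<phi>) ?n" "z - z' \<in> coboundaries (cech s \<phi>) ?n"
      and w': "w' \<in> cocycles (cech t \<psi>) ?n" "w - w' \<in> coboundaries (cech t \<psi>) ?n"
      using zw' z w by (auto simp: A.mem_cls_iff B.mem_cls_iff)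
    obtain x where x: "x \<in> forms (cech_mod s) m" "z - z' = ?dA x"
      using z'(2) by (auto simp: coboundaries_def m fst_cech snd_cech)
    obtain y where y: "y \<in> forms (cech_mod t) m" "w - w' = ?dB y"
      using w'(2) by (auto simp: coboundaries_def m fst_cech snd_cech)
    have zf: "z' \<in> forms (cech_mod s) ?n" "?dA z' = 0" and wf: "w \<in> forms (cech_mod t) ?n" "?dB w = 0"
      using z' w by (simp_all add: cocycles_def fst_cech snd_cech)
    have "?dC (kprod x w) = kprod (?dA x) w + (\<lambda>S. (- 1) ^ m * kprod x (?dB w) S)"
      by (rule kprod_d[OF opp]) (use x(1) in \<open>simp add: forms_def\<close>)
    then have 1: "?dC (kprod x w) = kprod (?dA x) w"
      unfolding wf(2) kprod_zero by (simp add: fun_eq_iff)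
    have "?dC (kprod z' y) = kprod (?dA z') y + (\<lambda>S. (- 1) ^ ?n * kprod z' (?dB y) S)"
      by (rule kprod_d[OF opp]) (use zf(1) in \<open>simp add: forms_def\<close>)
    then have 2: "?dC (kprod z' y) = (\<lambda>S. (- 1) ^ ?n * kprod z' (?dB y) S)"
      unfolding zf(2) kprod_zero by (simp add: fun_eq_iff)
    have c1: "kprod (?dA x) w \<in> coboundaries (cech (case_sum s t) 0) (2 * ?n)"
      using kprod_mem[of s t, OF nz x(1) wf(1)] unfolding coboundaries_def m2
      by (auto simp: fst_cech snd_cech 1[symmetric])
    have c2: "(\<lambda>S. (- 1) ^ ?n * kprod z' (?dB y) S) \<in> coboundaries (cech (case_sum s t) 0) (2 * ?n)"
      using kprod_mem[of s t, OF nz zf(1) y(1)] unfolding coboundaries_def m2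
      by (auto simp: fst_cech snd_cech 2[symmetric] add.commute)
    have c3: "kprod z' (?dB y) \<in> coboundaries (cech (case_sum s t) 0) (2 * ?n)"
    proof (cases "even ?n")
      case True
      then show ?thesis using c2 by simp
    next
      case False
      then have "(\<lambda>S. (- 1) ^ ?n * kprod z' (?dB y) S) = - kprod z' (?dB y)" by (simp add: fun_eq_iff)
      then show ?thesis using C.coboundaries_minus[OF c2] by simp
    qed
    have "kprod z w - kprod z' w' = kprod (?dA x) w + kprod z' (?dB y)"
      using kprod_add_left[of "z - z'" z' w] kprod_add_right[of z' "w - w'" w']
      unfolding x(2)[symmetric] y(2)[symmetric] by simp
    then have "kprod z w - kprod z' w' \<in> coboundaries (cech (case_sum s t) 0) (2 * ?n)"
      using C.coboundaries_add[OF c1 c3] by simp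
    then show ?thesis using C.cls_eq_iff[OF cocycle[OF z w] cocycle[OF z'(1) w'(1)]] by simp
  qed
  have "z \<in> cls (cech s \<phi>) ?n z" "w \<in> cls (cech t \<psi>) ?n w"
    using A.self_in_cls[OF z] B.self_in_cls[OF w] .
  then show "kun_wedge s t (cls (cech s \<phi>) ?n z) (cls (cech t \<psi>) ?n w) =
      cls (cech (case_sum s t) 0) (2 * ?n) (kprod z w)"
    unfolding kun_wedge_def kprod_def[symmetric] using eq by blast
qed

section \<open>An explicit inverse of the canonical map\<close>

section \<open>An explicit cocycle with prescribed top form\<close>

abbreviation dtw :: "'n mpoly \<Rightarrow> 'n::{finite,linorder} \<Rightarrow> 'n ratfun fps \<Rightarrow> 'n ratfun fps" where
  "dtw \<phi> \<equiv> tw (dR_lam \<phi>) rat_deriv"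

text \<open>Recursive solution G of (\<phi>_i + u d/dx_i) G = F over the field of rational
  functions, valid when \<phi>_i is nonzero.\<close>

primrec inv_tw_coef :: "'n mpoly \<Rightarrow> 'n::linorder \<Rightarrow> 'n ratfun fps \<Rightarrow> nat \<Rightarrow> 'n ratfun" where
  "inv_tw_coef \<phi> i F 0 = fps_nth F 0 / emb (mpderiv i \<phi>)"
| "inv_tw_coef \<phi> i F (Suc k) =
     (fps_nth F (Suc k) - rat_deriv i (inv_tw_coef \<phi> i F k)) / emb (mpderiv i \<phi>)"

definition inv_tw :: "'n mpoly \<Rightarrow> 'n::linorder \<Rightarrow> 'n ratfun fps \<Rightarrow> 'n ratfun fps" where
  "inv_tw \<phi> i F = Abs_fps (inv_tw_coef \<phi> i F)"

lemma tw_inv_tw: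
  fixes \<phi> :: "'n::{finite,linorder} mpoly"
  assumes "mpderiv i \<phi> \<noteq> 0"
  shows "dtw \<phi> i (inv_tw \<phi> i F) = F"
proof (rule fps_ext)
  fix n
  show "fps_nth (dtw \<phi> i (inv_tw \<phi> i F)) n = fps_nth F n"
    using assms by (cases n) (simp_all add: inv_tw_def)
qed

lemma dtw_inj:
  fixes \<phi> :: "'n::{finite,linorder} mpoly"
  assumes nz: "mpderiv i \<phi> \<noteq> 0" and eq: "dtw \<phi> i F = dtw \<phi> i G"
  shows "F = G"
proof (rule fps_ext)
  fix n
  show "fps_nth F n = fps_nth G n"
  proof (induction n)
    case 0
    then show ?case using nz arg_cong[OF eq, of "\<lambda>F. fps_nth F 0"] by simp
  next
    case (Suc n)
    then show ?case using nz arg_cong[OF eq, of "\<lambda>F. fps_nth F (Suc n)"] by simp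
  qed
qed

text \<open>Additivity, linearity and commutation of the inverse follow from those of
  \<open>dtw\<close> through this, not from the recursion.\<close>

lemma inv_tw_unique:
  fixes \<phi> :: "'n::{finite,linorder} mpoly"
  assumes nz: "mpderiv i \<phi> \<noteq> 0" and eq: "dtw \<phi> i G = F"
  shows "inv_tw \<phi> i F = G"
  by (rule dtw_inj[OF nz]) (simp only: tw_inv_tw[OF nz] eq)

lemma inv_tw_commute:
  fixes \<phi> :: "'n::{finite,linorder} mpoly"
  assumes "mpderiv i \<phi> \<noteq> 0"
  shows "dtw \<phi> j (inv_tw \<phi> i F) = inv_tw \<phi> i (dtw \<phi> j F)"
  by (rule inv_tw_unique[OF assms, symmetric])
    (simp add: twisted.tw_commute[OF twisted_dR, of \<phi> i j] tw_inv_tw[OF assms])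

lemma inv_tw_add:
  fixes \<phi> :: "'n::{finite,linorder} mpoly"
  assumes "mpderiv i \<phi> \<noteq> 0"
  shows "inv_tw \<phi> i (F + G) = inv_tw \<phi> i F + inv_tw \<phi> i G"
  by (rule inv_tw_unique[OF assms])
    (simp add: additive.add[OF twisted.additive_tw[OF twisted_dR]] tw_inv_tw[OF assms])

lemma inv_tw_scale:
  fixes \<phi> :: "'n::{finite,linorder} mpoly"
  assumes "mpderiv i \<phi> \<noteq> 0"
  shows "inv_tw \<phi> i (cst_fps p * F) = cst_fps p * inv_tw \<phi> i F"
proof (rule inv_tw_unique[OF assms])
  have "dtw \<phi> i (cst_fps p * inv_tw \<phi> i F) = cst_fps p * dtw \<phi> i (inv_tw \<phi> i F)"
    by (rule tw_cst_fps) blast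
  then show "dtw \<phi> i (cst_fps p * inv_tw \<phi> i F) = cst_fps p * F" by (simp add: tw_inv_tw[OF assms])
qed

text \<open>For nonzero partial derivatives the factors commute; the sorted order is the one used in
  \<open>b_coeff\<close>.\<close>

definition inv_tws :: "'n mpoly \<Rightarrow> 'n::{finite,linorder} set \<Rightarrow> 'n ratfun fps \<Rightarrow> 'n ratfun fps" where
  "inv_tws \<phi> A F = foldr (inv_tw \<phi>) (sorted_list_of_set A) F"

lemma inv_tws_add:
  fixes \<phi> :: "'n::{finite,linorder} mpoly"
  assumes "\<And>i. mpderiv i \<phi> \<noteq> 0"
  shows "inv_tws \<phi> A (F + G) = inv_tws \<phi> A F + inv_tws \<phi> A G"
proof -
  have "foldr (inv_tw \<phi>) xs (F + G) = foldr (inv_tw \<phi>) xs F + foldr (inv_tw \<phi>) xs G" for xs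
    by (induction xs) (simp_all add: inv_tw_add[OF assms])
  then show ?thesis by (simp add: inv_tws_def)
qed

lemma inv_tws_scale:
  fixes \<phi> :: "'n::{finite,linorder} mpoly"
  assumes "\<And>i. mpderiv i \<phi> \<noteq> 0"
  shows "inv_tws \<phi> A (cst_fps p * F) = cst_fps p * inv_tws \<phi> A F"
proof -
  have "foldr (inv_tw \<phi>) xs (cst_fps p * F) = cst_fps p * foldr (inv_tw \<phi>) xs F" for xs
    by (induction xs) (simp_all add: inv_tw_scale[OF assms])
  then show ?thesis by (simp add: inv_tws_def)
qed

lemma tw_inv_tws:
  fixes \<phi> :: "'n::{finite,linorder} mpoly"
  assumes nz: "\<And>i. mpderiv i \<phi> \<noteq> 0" and "i \<in> A"
  shows "dtw \<phi> i (inv_tws \<phi> A F) = inv_tws \<phi> (A - {i}) F"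
proof -
  have "dtw \<phi> i (foldr (inv_tw \<phi>) xs F) = foldr (inv_tw \<phi>) (remove1 i xs) F" if "i \<in> set xs" for xs
    using that
  proof (induction xs)
    case (Cons a xs)
    then show ?case
      by (cases "a = i") (simp_all add: tw_inv_tw[OF nz] inv_tw_commute[OF nz, where i = a and j = i])
  qed simp
  then show ?thesis using assms(2) by (simp add: inv_tws_def sorted_list_of_set_remove)
qed

text \<open>Each inverse operator divides only by its own partial derivative, so the result has just
  the denominators allowed beside the \<alpha>'s with index in \<open>A\<close>.\<close>

lemma inv_tws_mem:
  fixes s :: "'n::{finite,linorder} \<Rightarrow> 'n mpoly"
  assumes nz: "\<And>i. s i \<noteq> 0" and s: "\<And>i. s i = mpderiv i \<phi> \<or> s i = - mpderiv i \<phi>"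
    and q: "\<And>k. fps_nth q k \<in> Qm"
  shows "fps_nth (inv_tws \<phi> A q) k \<in> loc_at s A"
proof -
  note R = diff_ring_loc_at[of s, OF nz]
  have one: "x / emb (mpderiv i \<phi>) \<in> loc_at s B" if "x \<in> loc_at s B" "i \<in> B" for x i B
  proof -
    have "1 / emb (s i) ^ 1 \<in> loc_at s B" by (rule loc_at_inverse[of s, OF nz that(2)])
    then have "1 / emb (mpderiv i \<phi>) \<in> loc_at s B"
      using s[of i] diff_ring.minus_mem[OF R] by fastforce
    from diff_ring.mult_mem[OF R that(1) this] show ?thesis by simp
  qed
  have "fps_nth (foldr (inv_tw \<phi>) xs q) k \<in> loc_at s (set xs)" for xs k
  proof (induction xs arbitrary: k)
    case Nil
    then show ?case using q by simp
  next
    case (Cons i xs)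
    let ?F = "foldr (inv_tw \<phi>) xs q"
    have F: "fps_nth ?F k \<in> loc_at s (set (i # xs))" for k
      using Cons.IH loc_at_mono[of "set xs" "set (i # xs)" s, OF _ nz] by auto
    have "inv_tw_coef \<phi> i ?F k \<in> loc_at s (set (i # xs))" for k
      by (induction k) (auto intro!: one F[unfolded list.set] diff_ring.diff_mem[OF R] diff_ring.deriv_mem[OF R])
    then show ?case by (simp add: inv_tw_def[of \<phi> i ?F])
  qed
  from this[of "sorted_list_of_set A"] show ?thesis by (simp add: inv_tws_def)
qed

text \<open>With \<open>D\<^sub>i = \<phi>\<^sub>i + u \<partial>\<^sub>i\<close>, this is the expansion of \<open>\<Prod>\<^sub>i (dx\<^sub>i + \<alpha>\<^sub>i D\<^sub>i\<inverse>)\<close> applied to \<open>q\<close>: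
  since the \<open>D\<^sub>i\<close> commute, each factor is killed by \<open>dx\<^sub>i D\<^sub>i + \<alpha>\<^sub>i\<close>.\<close>

definition koszul_cocycle :: "'n mpoly \<Rightarrow> 'n ratfun fps \<Rightarrow> ('n + 'n::{finite,linorder}) set \<Rightarrow> 'n ratfun fps" where
  "koszul_cocycle \<phi> q S = (if Inr -` S = - (Inl -` S) then
     shuffle_sign (Inl -` S) (- (Inl -` S)) * inv_tws \<phi> (Inl -` S) q else 0)"

lemma card_sum_set:
  fixes S :: "('a::finite + 'b::finite) set"
  shows "card S = card (Inl -` S) + card (Inr -` S)"
proof -
  have "x \<in> S \<longleftrightarrow> x \<in> (Inl -` S) <+> (Inr -` S)" for x by (cases x) auto
  then have "S = (Inl -` S) <+> (Inr -` S)" by (rule set_eqI)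
  then have "card S = card ((Inl -` S) <+> (Inr -` S))" by simp
  then show ?thesis by (simp add: card_Plus)
qed

lemma es_Inl: "es (Inl i) S = es i (Inl -` S)" for S :: "('a::{finite,linorder} + 'b::{finite,linorder}) set"
proof -
  have "x \<in> {b \<in> S. b < Inl i} \<longleftrightarrow> x \<in> Inl ` {a \<in> Inl -` S. a < i}" for x
    by (cases x) (auto simp: less_sum_def less_eq_sum_def)
  then have "{b \<in> S. b < Inl i} = Inl ` {a \<in> Inl -` S. a < i}" by (rule set_eqI)
  then show ?thesis by (simp add: es_def card_image)
qed

lemma es_Inr:
  fixes S :: "('a::{finite,linorder} + 'b::{finite,linorder}) set"
  shows "es (Inr i) S = ((- 1) ^ card (Inl -` S) * es i (Inr -` S) :: 'c::comm_ring_1)"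
proof -
  let ?T = "{b \<in> S. b < Inr i}"
  have "Inl -` ?T = Inl -` S" "Inr -` ?T = {b \<in> Inr -` S. b < i}"
    by (auto simp: less_sum_def less_eq_sum_def)
  then have "card ?T = card (Inl -` S) + card {b \<in> Inr -` S. b < i}" using card_sum_set[of ?T] by simp
  then show ?thesis by (simp add: es_def power_add)
qed

text \<open>A set \<open>S\<close> receives something only if a single index i occurs both as
  \<alpha>_i and as dx_i and every other index occurs once. It is reached from two terms, by
  \<alpha>_i and by dx_i D_i; since D_i undoes D_i^-1, their contributions agree up to an opposite
  sign.\<close>

lemma koszul_cocycle_closed:
  fixes \<phi> :: "'n::{finite,linorder} mpoly"
  assumes nz: "\<And>i. mpderiv i \<phi> \<noteq> 0"
  shows "ext_op (tw (cech_lam \<phi>) cech_del) (koszul_cocycle \<phi> q) = 0"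
proof
  fix S :: "('n + 'n) set"
  let ?A = "Inl -` S" and ?B = "Inr -` S" and ?Z = "koszul_cocycle \<phi> q"
  let ?t = "\<lambda>g. es g S * tw (cech_lam \<phi>) cech_del g (?Z (S - {g}))"
  have l: "Inl -` (S - {Inl i}) = ?A - {i}" "Inr -` (S - {Inl i}) = ?B"
    "Inl -` (S - {Inr i}) = ?A" "Inr -` (S - {Inr i}) = ?B - {i}" for i by auto
  have t0: "?t g = 0" if "?Z (S - {g}) = 0" for g
    using that by (simp add: additive.zero[OF twisted.additive_tw[OF twisted_cech]])
  have "(\<Sum>g\<in>S. ?t g) = 0"
  proof (cases "\<exists>i\<in>?A. ?B = - (?A - {i})")
    case True
    then obtain i where i: "i \<in> ?A" "?B = - (?A - {i})" by blast
    have iB: "i \<in> ?B" using i by blast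
    have other: "?t g = 0" if "g \<in> S" "g \<noteq> Inl i" "g \<noteq> Inr i" for g
    proof (rule t0, cases g)
      case (Inl k)
      then have "k \<in> ?A" "k \<noteq> i" using that by auto
      then have "?B \<noteq> - (?A - {k})" using i by auto
      then show "?Z (S - {g}) = 0" by (simp add: koszul_cocycle_def Inl l)
    next
      case (Inr k)
      then have "k \<noteq> i" using that by auto
      then have "?B - {k} \<noteq> - ?A" using i iB by auto
      then show "?Z (S - {g}) = 0" by (simp add: koszul_cocycle_def Inr l)
    qed
    have "(\<Sum>g\<in>S. ?t g) = (\<Sum>g\<in>{Inl i, Inr i}. ?t g)"
    proof (rule sum.mono_neutral_right)
      show "{Inl i, Inr i} \<subseteq> S" using i(1) iB by simp
      show "\<forall>g\<in>S - {Inl i, Inr i}. ?t g = 0" using other by blast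
    qed simp
    also have "\<dots> = ?t (Inl i) + ?t (Inr i)" by simp
    also have "\<dots> = 0"
    proof -
      let ?Ai = "?A - {i}" and ?Bi = "?B - {i}"
      have "C = insert i (C - {i})" "- C = D - {i}" "- (C - {i}) = D" "D = insert i (D - {i})"
        if "i \<in> C" "D = - (C - {i})" for C D :: "'n set" using that by auto
      note A = this[OF i]
      have ni: "i \<notin> ?Ai" "i \<notin> ?Bi" by simp_all
      have s1: "shuffle_sign ?A (- ?A) = (shuffle_sign ?Ai ?Bi * es i ?Bi :: 'n ratfun fps)"
        by (rule trans[OF arg_cong2[where f = shuffle_sign, OF A(1,2)] shuffle_sign_insert_left[OF ni(1)]])
      have s2: "shuffle_sign ?Ai (- ?Ai) = (shuffle_sign ?Ai ?Bi * es_above i ?Ai :: 'n ratfun fps)"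
        by (rule trans[OF arg_cong2[where f = shuffle_sign, OF refl trans[OF A(3,4)]]
              shuffle_sign_insert_right[OF ni(2)]])
      have c: "card ?A = Suc (card ?Ai)" using i(1) by (metis card.remove finite)
      have e: "es i ?A * es_above i ?Ai = ((- 1) ^ card ?Ai :: 'n ratfun fps)"
        using es_es_above[of i ?Ai, where 'a = "'n ratfun fps"] by simp
      have dt: "dtw \<phi> i (shuffle_sign C D * F) = shuffle_sign C D * dtw \<phi> i F" for C D :: "'n set" and F
        by (rule disjE[OF shuffle_sign_cases[of C D, where 'a = "'n ratfun fps"]])
          (simp_all add: additive.minus[OF twisted.additive_tw[OF twisted_dR]])
      have "?Z (S - {Inl i}) = shuffle_sign ?Ai (- ?Ai) * inv_tws \<phi> ?Ai q"
        unfolding koszul_cocycle_def l using A(3) by simp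
      then have 1: "?t (Inl i) = es i ?A * (shuffle_sign ?Ai (- ?Ai) * inv_tws \<phi> ?Ai q)"
        by (simp add: es_Inl tw_cech_Inl)
      have "?Z (S - {Inr i}) = shuffle_sign ?A (- ?A) * inv_tws \<phi> ?A q"
        unfolding koszul_cocycle_def l using A(2) by simp
      then have 2: "?t (Inr i) = (- 1) ^ card ?A * es i ?B * (shuffle_sign ?A (- ?A) * inv_tws \<phi> ?Ai q)"
        by (simp add: es_Inr tw_cech_Inr dt tw_inv_tws[OF nz i(1)])
      have "?t (Inl i) = (es i ?A * es_above i ?Ai) * (shuffle_sign ?Ai ?Bi * inv_tws \<phi> ?Ai q)"
        unfolding 1 s2 by (simp only: mult_ac)
      moreover have "?t (Inr i) = ((- 1) ^ card ?A * (es i ?B * es i ?Bi)) * (shuffle_sign ?Ai ?Bi * inv_tws \<phi> ?Ai q)"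
        unfolding 2 s1 by (simp only: mult_ac)
      ultimately show ?thesis unfolding e c by simp
    qed
    finally show ?thesis .
  next
    case False
    have "?Z (S - {g}) = 0" if "g \<in> S" for g
    proof (cases g)
      case (Inl k)
      then have "?B \<noteq> - (?A - {k})" using False that by auto
      then show ?thesis by (simp add: koszul_cocycle_def Inl l)
    next
      case (Inr k)
      have "?B - {k} \<noteq> - ?A"
      proof
        assume e: "?B - {k} = - ?A"
        have "k \<in> ?B" using that Inr by simp
        have "k \<in> ?A" using e by blast
        moreover have "?B = - (?A - {k})" using e \<open>k \<in> ?B\<close> by auto
        ultimately show False using False by blast
      qed
      then show ?thesis by (simp add: koszul_cocycle_def Inr l)
    qed
    then show ?thesis by (intro sum.neutral ballI t0)
  qed
  then show "ext_op (tw (cech_lam \<phi>) cech_del) ?Z S = 0 S" by (simp add: ext_op_def)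
qed

text \<open>The only term without \<alpha>'s carries all dx's, so the cocycle is a preimage of the
  top form under the canonical map.\<close>

lemma koszul_cocycle_Inr:
  fixes \<phi> :: "'n::{finite,linorder} mpoly"
  shows "restr Inr (koszul_cocycle \<phi> q) = top_form q"
proof
  fix S :: "'n set"
  have "Inl -` (Inr ` S :: ('n + 'n) set) = {}" "Inr -` (Inr ` S :: ('n + 'n) set) = S" by auto
  then show "restr Inr (koszul_cocycle \<phi> q) S = top_form q S"
    unfolding restr_def koszul_cocycle_def top_form_def by (simp only:) (simp add: inv_tws_def)
qed

lemma koszul_cocycle_range:
  fixes \<phi> :: "'n::{finite,linorder} mpoly"
  shows "koszul_cocycle \<phi> q (range Inr) = q" "koszul_cocycle \<phi> q (range Inl) = inv_tws \<phi> UNIV q"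
proof -
  have "Inl -` (range Inr :: ('n + 'n) set) = {}" "Inr -` (range Inr :: ('n + 'n) set) = UNIV"
    "Inl -` (range Inl :: ('n + 'n) set) = UNIV" "Inr -` (range Inl :: ('n + 'n) set) = {}" by auto
  then show "koszul_cocycle \<phi> q (range Inr) = q" "koszul_cocycle \<phi> q (range Inl) = inv_tws \<phi> UNIV q"
    by (simp_all add: koszul_cocycle_def inv_tws_def)
qed

lemma koszul_cocycle_mem:
  fixes s :: "'n::{finite,linorder} \<Rightarrow> 'n mpoly"
  assumes nz: "\<And>i. s i \<noteq> 0" and s: "\<And>i. s i = mpderiv i \<phi> \<or> s i = - mpderiv i \<phi>"
    and q: "\<And>k. fps_nth q k \<in> Qm"
  shows "koszul_cocycle \<phi> q \<in> cocycles (cech s \<phi>) CARD('n)"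
proof -
  have nz': "mpderiv i \<phi> \<noteq> 0" for i using nz[of i] s[of i] by auto
  have "fps_nth (koszul_cocycle \<phi> q S) k \<in> cech_mod s S" for S k
  proof -
    have m: "fps_nth (inv_tws \<phi> (Inl -` S) q) k \<in> cech_mod s S"
      unfolding cech_mod_def by (rule inv_tws_mem[of s, OF nz s q])
    have R: "diff_ring (cech_mod s S)"
      unfolding cech_mod_def by (rule diff_ring_loc_at[of s, OF nz])
    show ?thesis
      using shuffle_sign_cases[of "Inl -` S" "- (Inl -` S)", where 'a = "'n ratfun fps"] m
        diff_ring.minus_mem[OF R m] diff_ring.zero_mem[OF R]
      by (auto simp: koszul_cocycle_def)
  qed
  moreover have "card S = CARD('n)" if "koszul_cocycle \<phi> q S \<noteq> 0" for S :: "('n + 'n) set"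
  proof -
    have "Inr -` S = - (Inl -` S)" using that by (auto simp: koszul_cocycle_def split: if_splits)
    moreover have "card (Inl -` S) + card (- (Inl -` S)) = CARD('n)"
      by (metis Compl_disjoint Compl_partition card_Un_disjoint finite)
    ultimately show ?thesis using card_sum_set[of S] by simp
  qed
  ultimately show ?thesis
    using koszul_cocycle_closed[OF nz'] by (simp add: cocycles_def fst_cech snd_cech forms_def)
qed

subsection \<open>The coefficients of the cocycle\<close>

text \<open>Geometric series for the inverse of -\<psi>_i + u d/dx_i: factoring out -\<psi>_i leaves
  1 - \<psi>_i^-1 u d/dx_i.\<close>

lemma inv_tw_coef_eq:
  assumes "\<phi> = - \<psi>"
  shows "inv_tw_coef \<phi> i F k = - (\<Sum>j\<le>k. ((\<lambda>r. rat_deriv i r / emb (grad \<psi> i)) ^^ j) (fps_nth F (k - j) / emb (grad \<psi> i)))"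
proof -
  let ?T = "\<lambda>r. rat_deriv i r / emb (grad \<psi> i)"
  have e: "emb (mpderiv i \<phi>) = - emb (grad \<psi> i)" by (simp add: assms mpderiv_minus grad_def)
  have T: "additive ?T" by (simp add: additive_def rat_deriv_add add_divide_distrib)
  show ?thesis
  proof (induction k)
    case 0
    then show ?case by (simp add: e)
  next
    case (Suc k)
    have "inv_tw_coef \<phi> i F (Suc k) = - (fps_nth F (Suc k) / emb (grad \<psi> i)) + ?T (inv_tw_coef \<phi> i F k)"
      by (simp add: e diff_divide_distrib)
    also have "?T (inv_tw_coef \<phi> i F k) = - (\<Sum>j\<le>k. ?T ((?T ^^ j) (fps_nth F (k - j) / emb (grad \<psi> i))))"
      unfolding Suc.IH additive.minus[OF T] additive.sum[OF T] ..
    finally show ?case by (simp add: sum.atMost_Suc_shift del: sum.atMost_Suc)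
  qed
qed

abbreviation b_op :: "'n mpoly \<Rightarrow> 'n::linorder \<Rightarrow> nat \<Rightarrow> 'n ratfun \<Rightarrow> 'n ratfun" where
  "b_op \<psi> i m q \<equiv> ((\<lambda>r. rat_deriv i r / emb (grad \<psi> i)) ^^ m) (q / emb (grad \<psi> i))"

lemma b_op_additive: "additive (b_op \<psi> i m)"
proof -
  have "((\<lambda>r. rat_deriv i r / emb (grad \<psi> i)) ^^ m) (x + y) =
    ((\<lambda>r. rat_deriv i r / emb (grad \<psi> i)) ^^ m) x + ((\<lambda>r. rat_deriv i r / emb (grad \<psi> i)) ^^ m) y" for x y
    by (induction m) (simp_all add: rat_deriv_add add_divide_distrib)
  then show ?thesis by (simp add: additive_def add_divide_distrib)
qed

text \<open>Vanishing off \<open>A\<close> makes the exponent function determined by its values on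
  \<open>A\<close>, so that exponents can be split off one index at a time.\<close>

definition multi_exps :: "'n set \<Rightarrow> nat \<Rightarrow> ('n \<Rightarrow> nat) set" where
  "multi_exps A k = {a. (\<forall>i. i \<notin> A \<longrightarrow> a i = 0) \<and> sum a A = k}"

lemma finite_multi_exps:
  assumes "finite A"
  shows "finite (multi_exps A k)"
proof (rule finite_subset)
  have "a i \<le> k" if "sum a A = k" "i \<in> A" for a i
    using member_le_sum[of i A a] that assms by simp
  then show "multi_exps A k \<subseteq> {f. \<forall>x. (x \<in> A \<longrightarrow> f x \<in> {..k}) \<and> (x \<notin> A \<longrightarrow> f x = 0)}"
    by (auto simp: multi_exps_def)
  show "finite {f :: 'a \<Rightarrow> nat. \<forall>x. (x \<in> A \<longrightarrow> f x \<in> {..k}) \<and> (x \<notin> A \<longrightarrow> f x = 0)}"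
    using assms by (intro finite_set_of_finite_funs) auto
qed

lemma foldr_inv_tw_nth:
  fixes \<psi> :: "'n::linorder mpoly"
  assumes "\<phi> = - \<psi>" "distinct xs"
  shows "fps_nth (foldr (inv_tw \<phi>) xs (fps_const x)) k =
    (- 1) ^ length xs * (\<Sum>a\<in>multi_exps (set xs) k. foldr (\<lambda>i. b_op \<psi> i (a i)) xs x)"
  using assms(2)
proof (induction xs arbitrary: k)
  case Nil
  have "multi_exps ({} :: 'n set) k = (if k = 0 then {\<lambda>_. 0} else {})"
    by (auto simp: multi_exps_def)
  then show ?case unfolding list.set by simp
next
  case (Cons i xs)
  let ?E = "multi_exps (set xs)"
  have i: "i \<notin> set xs" using Cons.prems by simp
  have neg: "additive (\<lambda>y. b_op \<psi> i j y)" for j by (rule b_op_additive)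
  have sgn: "b_op \<psi> i j ((- 1) ^ m * y) = (- 1) ^ m * b_op \<psi> i j y" for j m y
  proof (cases "even m")
    case False
    then have "(- 1) ^ m = (- 1 :: 'n ratfun)" by simp
    then show ?thesis by (simp only: mult_minus1 additive.minus[OF neg])
  qed simp
  have "fps_nth (foldr (inv_tw \<phi>) (i # xs) (fps_const x)) k =
    - (\<Sum>j\<le>k. b_op \<psi> i j (fps_nth (foldr (inv_tw \<phi>) xs (fps_const x)) (k - j)))"
    by (simp add: inv_tw_def inv_tw_coef_eq[OF assms(1)])
  also have "\<dots> = - (\<Sum>j\<le>k. (- 1) ^ length xs * (\<Sum>a\<in>?E (k - j). b_op \<psi> i j (foldr (\<lambda>i. b_op \<psi> i (a i)) xs x)))"
    using Cons.prems by (simp only: Cons.IH distinct.simps sgn additive.sum[OF neg])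
  also have "\<dots> = (- 1) ^ length (i # xs) * (\<Sum>j\<le>k. \<Sum>a\<in>?E (k - j). b_op \<psi> i j (foldr (\<lambda>i. b_op \<psi> i (a i)) xs x))"
    by (simp add: sum_distrib_left sum_negf)
  also have "(\<Sum>j\<le>k. \<Sum>a\<in>?E (k - j). b_op \<psi> i j (foldr (\<lambda>i. b_op \<psi> i (a i)) xs x)) =
     (\<Sum>(j, a)\<in>Sigma {..k} (\<lambda>j. ?E (k - j)). b_op \<psi> i j (foldr (\<lambda>i. b_op \<psi> i (a i)) xs x))"
    by (subst sum.Sigma) (auto simp: finite_multi_exps)
  also have "\<dots> = (\<Sum>a\<in>multi_exps (set (i # xs)) k. foldr (\<lambda>i. b_op \<psi> i (a i)) (i # xs) x)"
  \<comment> \<open>\<open>j\<close> is the exponent of the head index \<open>i\<close>; the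
    remaining exponent function is zero at \<open>i\<close>.\<close>
  proof (rule sum.reindex_bij_witness[of _ "\<lambda>a. (a i, a(i := 0))" "\<lambda>(j, a). a(i := j)"])
    fix p assume "p \<in> Sigma {..k} (\<lambda>j. ?E (k - j))"
    then obtain j a where p: "p = (j, a)" and a: "j \<le> k" "a \<in> ?E (k - j)" by auto
    have "a i = 0" using a i by (simp add: multi_exps_def)
    then show "((case p of (j, a) \<Rightarrow> a(i := j)) i, (case p of (j, a) \<Rightarrow> a(i := j))(i := 0)) = p"
      by (auto simp: p)
    have "sum (a(i := j)) (set xs) = sum a (set xs)" by (rule sum.cong) (use i in auto)
    then show "(case p of (j, a) \<Rightarrow> a(i := j)) \<in> multi_exps (set (i # xs)) k"
      using a i by (auto simp: multi_exps_def p)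
    have "foldr (\<lambda>i'. b_op \<psi> i' ((a(i := j)) i')) xs x = foldr (\<lambda>i'. b_op \<psi> i' (a i')) xs x"
      by (rule foldr_cong) (use i in auto)
    then show "foldr (\<lambda>i'. b_op \<psi> i' ((case p of (j, a) \<Rightarrow> a(i := j)) i')) (i # xs) x =
        (case p of (j, a) \<Rightarrow> b_op \<psi> i j (foldr (\<lambda>i'. b_op \<psi> i' (a i')) xs x))" by (simp add: p)
  next
    fix a assume a: "a \<in> multi_exps (set (i # xs)) k"
    have "sum (a(i := 0)) (set xs) = sum a (set xs)" by (rule sum.cong) (use i in auto)
    then show "(a i, a(i := 0)) \<in> Sigma {..k} (\<lambda>j. ?E (k - j))"
      using a i by (auto simp: multi_exps_def)
    show "(case (a i, a(i := 0)) of (j, a) \<Rightarrow> a(i := j)) = a" by auto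
  qed
  finally show ?case .
qed

text \<open>The sign (-1)^n in \<open>b_coeff\<close> collects one minus sign from each of the n
  inverse operators.\<close>

lemma inv_tws_nth:
  fixes \<psi> :: "'n::{finite,linorder} mpoly"
  assumes "\<phi> = - \<psi>"
  shows "fps_nth (inv_tws \<phi> UNIV (fps_const (emb h))) k = b_coeff k \<psi> h"
proof -
  have "multi_exps (UNIV :: 'n set) k = {a. (\<Sum>i\<in>UNIV. a i) = k}" by (simp add: multi_exps_def)
  then show ?thesis
    unfolding inv_tws_def b_coeff_def
    by (subst foldr_inv_tw_nth[OF assms]) simp_all
qed

section \<open>The residue of a product, computed on either copy of the \<alpha>'s\<close>

section \<open>Comparison of the residues for different families\<close>

lemma restr_restr: "restr e (restr e' \<omega>) = restr (e' \<circ> e) \<omega>"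
  by (simp add: restr_def fun_eq_iff image_comp)

text \<open>A lift for the large family restricts to a lift for the subfamily and keeps its
  component over the variables, the only one that the residue reads.\<close>

lemma res_restr:
  fixes S :: "'k::{finite,linorder} \<Rightarrow> 'n::{finite,linorder} mpoly" and e :: "'i::{finite,linorder} \<Rightarrow> 'k"
  assumes S: "parameters S" and s: "parameters (\<lambda>i. S (e i))" and e: "strict_mono e"
    and z: "z \<in> cocycles (cech S 0) (2 * CARD('n))"
  shows "restr (map_sum e id) z \<in> cocycles (cech (\<lambda>i. S (e i)) 0) (2 * CARD('n))"
    and "res S (cls (cech S 0) (2 * CARD('n)) z) =
      res (\<lambda>i. S (e i)) (cls (cech (\<lambda>i. S (e i)) 0) (2 * CARD('n)) (restr (map_sum e id) z))"
proof -
  interpret S: parameters S by fact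
  interpret s: parameters "\<lambda>i. S (e i)" by fact
  let ?n2 = "2 * CARD('n)"
  let ?e = "map_sum e id :: 'i + 'n \<Rightarrow> 'k + 'n"
  let ?ee = "map_sum ?e id :: ('i + 'n) + 'n \<Rightarrow> ('k + 'n) + 'n"
  have c: "(\<lambda>x. case_sum S Var (?e x)) = case_sum (\<lambda>i. S (e i)) Var"
    by (auto simp: fun_eq_iff split: sum.splits)
  interpret A: coh_map "cech S 0" "cech (\<lambda>i. S (e i)) 0" ?n2 "restr ?e"
    by (rule coh_map_cech_restr[of S, OF S.nonzero e])
  interpret B: coh_map "cech (case_sum S Var) 0" "cech (case_sum (\<lambda>i. S (e i)) Var) 0" ?n2 "restr ?ee"
    using coh_map_cech_restr[of "case_sum S Var" ?e 0 ?n2, OF S.nonzero_Var strict_mono_map_sum[OF e]] unfolding c .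
  show rz: "restr ?e z \<in> cocycles (cech (\<lambda>i. S (e i)) 0) ?n2" by (rule A.cocycle[OF z])
  obtain Y where Y: "S.lifts Y z" using S.lift_exists[OF z] by blast
  have comp: "?ee \<circ> map_sum Inl id = map_sum Inl id \<circ> ?e" "?ee \<circ> map_sum Inr id = map_sum Inr id"
    by (auto simp: fun_eq_iff) (metis map_sum.simps old.sum.exhaust id_apply)+
  have "restr (map_sum Inl id) (restr ?ee Y) - restr ?e z = restr ?e (restr (map_sum Inl id) Y - z)"
    unfolding restr_restr comp(1) additive.diff[OF A.additive] ..
  moreover have "restr ?e (restr (map_sum Inl id) Y - z) \<in> coboundaries (cech (\<lambda>i. S (e i)) 0) ?n2"
    using Y by (intro A.coboundary) (simp add: S.lifts_def)
  moreover have "restr ?ee Y \<in> cocycles (cech (case_sum (\<lambda>i. S (e i)) Var) 0) ?n2"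
    using Y by (intro B.cocycle) (simp add: S.lifts_def)
  ultimately have lift: "s.lifts (restr ?ee Y) (restr ?e z)" by (simp add: s.lifts_def)
  have "restr ?ee Y (range (map_sum Inr id)) = Y (range (map_sum Inr id))"
    unfolding restr_def image_comp comp(2) ..
  then show "res S (cls (cech S 0) ?n2 z) =
      res (\<lambda>i. S (e i)) (cls (cech (\<lambda>i. S (e i)) 0) ?n2 (restr ?e z))"
    by (simp add: S.res_lift[OF z Y] s.res_lift[OF rz lift])
qed

text \<open>Degree count: the index set holds one copy of the \<alpha>'s and the n dx's; the factor
  owning the other copy has degree n and must use up all dx's. In the second case n dx's stand
  before n \<alpha>'s, which gives the sign.\<close>

lemma kprod_restr:
  fixes z w :: "('n::{finite,linorder} + 'n) set \<Rightarrow> 'n ratfun fps"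
  assumes z: "z \<in> forms M CARD('n)" and w: "w \<in> forms M CARD('n)"
  shows "kprod z w (range (map_sum Inl id)) = z (range Inl) * w (range Inr)"
    and "kprod z w (range (map_sum Inr id)) = (- 1) ^ (CARD('n) * CARD('n)) * (z (range Inr) * w (range Inl))"
proof -
  let ?a1 = "(\<lambda>i. Inl (Inl i)) ` UNIV :: (('n + 'n) + 'n) set"
  let ?a2 = "(\<lambda>i. Inl (Inr i)) ` UNIV :: (('n + 'n) + 'n) set"
  let ?x = "range Inr :: (('n + 'n) + 'n) set"
  have r: "range (inj1 :: 'n + 'n \<Rightarrow> ('n + 'n) + 'n) = ?a1 \<union> ?x" "range (inj2 :: 'n + 'n \<Rightarrow> ('n + 'n) + 'n) = ?a2 \<union> ?x"
  proof -
    have "range (h :: 'n + 'n \<Rightarrow> ('n + 'n) + 'n) = range (\<lambda>i. h (Inl i)) \<union> range (\<lambda>i. h (Inr i))" for h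
      by (auto simp: image_iff) (metis old.sum.exhaust)
    then show "range (inj1 :: 'n + 'n \<Rightarrow> ('n + 'n) + 'n) = ?a1 \<union> ?x" "range (inj2 :: 'n + 'n \<Rightarrow> ('n + 'n) + 'n) = ?a2 \<union> ?x"
      by simp_all
  qed
  have v: "inj1 -` ?a1 = (range Inl :: ('n + 'n) set)" "inj1 -` ?x = (range Inr :: ('n + 'n) set)"
    "inj2 -` ?a2 = (range Inl :: ('n + 'n) set)" "inj2 -` ?x = (range Inr :: ('n + 'n) set)"
  proof -
    have "inj1 y \<in> ?a1 \<longleftrightarrow> y \<in> range Inl" "inj1 y \<in> ?x \<longleftrightarrow> y \<in> range Inr"
      "inj2 y \<in> ?a2 \<longleftrightarrow> y \<in> range Inl" "inj2 y \<in> ?x \<longleftrightarrow> y \<in> range Inr" for y :: "'n + 'n"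
      by (cases y; auto)+
    then show "inj1 -` ?a1 = (range Inl :: ('n + 'n) set)" "inj1 -` ?x = (range Inr :: ('n + 'n) set)"
      "inj2 -` ?a2 = (range Inl :: ('n + 'n) set)" "inj2 -` ?x = (range Inr :: ('n + 'n) set)"
      by (auto simp: vimage_def)
  qed
  have ez: "extend inj1 z ?a1 = z (range Inl)" "extend inj1 z ?x = z (range Inr)"
    and ew: "extend inj2 w ?a2 = w (range Inl)" "extend inj2 w ?x = w (range Inr)"
    unfolding extend_def v r by auto
  have disj: "?a1 \<inter> ?a2 = {}" "?a1 \<inter> ?x = {}" "?a2 \<inter> ?x = {}" by auto
  have cx: "card ?x = CARD('n)" by (simp add: card_image)
  have z_supp: "A \<subseteq> ?a1 \<union> ?x \<and> card A = CARD('n)" if nz: "extend inj1 z A \<noteq> 0" for A :: "(('n + 'n) + 'n) set"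
  proof -
    have A: "A \<subseteq> range inj1" "z (inj1 -` A) \<noteq> 0" using nz by (auto simp: extend_def split: if_splits)
    have "card (inj1 -` A) = card A" by (rule card_vimage_inj[OF strict_mono_imp_inj_on[OF inj_inj1] A(1)])
    then show ?thesis using z A(1) A(2) unfolding r by (auto simp: forms_def)
  qed
  have w_supp: "A \<subseteq> ?a2 \<union> ?x \<and> card A = CARD('n)" if nz: "extend inj2 w A \<noteq> 0" for A :: "(('n + 'n) + 'n) set"
  proof -
    have A: "A \<subseteq> range inj2" "w (inj2 -` A) \<noteq> 0" using nz by (auto simp: extend_def split: if_splits)
    have "card (inj2 -` A) = card A" by (rule card_vimage_inj[OF strict_mono_imp_inj_on[OF inj_inj2] A(1)])
    then show ?thesis using w A(1) A(2) unfolding r by (auto simp: forms_def)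
  qed
  have sub_x: "A = ?x" if "A \<subseteq> ?x" "card A = CARD('n)" for A
    using that cx by (intro card_subset_eq) auto
  show "kprod z w (range inj1) = z (range Inl) * w (range Inr)"
  proof -
    let ?t = "\<lambda>A. shuffle_sign A (range inj1 - A) * extend inj1 z A * extend inj2 w (range inj1 - A)"
    have d: "range inj1 - ?a1 = ?x" unfolding r using disj by blast
    have "?t A = 0" if A: "A \<in> Pow (range inj1) - {?a1}" for A
    proof (rule ccontr)
      assume "?t A \<noteq> 0"
      then have "extend inj2 w (range inj1 - A) \<noteq> 0" by auto
      then have "range inj1 - A \<subseteq> ?a2 \<union> ?x" "card (range inj1 - A) = CARD('n)" using w_supp by blast+
      moreover have "range inj1 - A \<subseteq> ?x" using calculation(1) disj unfolding r by blast
      ultimately have Rx: "range inj1 - A = ?x" using sub_x by blast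
      have gen: "A = C" if "R - A = D" "R = C \<union> D" "C \<inter> D = {}" "A \<subseteq> R" for C D R :: "(('n + 'n) + 'n) set"
        using that by blast
      have "A \<subseteq> range inj1" using A by simp
      then have "A = ?a1" by (rule gen[OF Rx r(1) disj(2)])
      then show False using A by simp
    qed
    then have "kprod z w (range inj1) = (\<Sum>A\<in>{?a1}. ?t A)"
      unfolding kprod_def wedge_eq by (intro sum.mono_neutral_right) (auto simp: r)
    also have "\<dots> = shuffle_sign ?a1 ?x * (z (range Inl) * w (range Inr))"
      unfolding d ez ew by (simp add: d ez ew mult.assoc)
    also have "shuffle_sign ?a1 ?x = (1 :: 'n ratfun fps)"
    proof -
      have "{(a, b). a \<in> ?a1 \<and> b \<in> ?x \<and> b < a} = {}" by (auto simp: less_sum_def less_eq_sum_def)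
      then show ?thesis unfolding shuffle_sign_def by (simp only: card.empty power_0)
    qed
    finally show ?thesis unfolding mult_1_left .
  qed
  show "kprod z w (range inj2) = (- 1) ^ (CARD('n) * CARD('n)) * (z (range Inr) * w (range Inl))"
  proof -
    let ?t = "\<lambda>A. shuffle_sign A (range inj2 - A) * extend inj1 z A * extend inj2 w (range inj2 - A)"
    have d: "range inj2 - ?x = ?a2" unfolding r using disj by blast
    have "?t A = 0" if A: "A \<in> Pow (range inj2) - {?x}" for A
    proof (rule ccontr)
      assume "?t A \<noteq> 0"
      then have "extend inj1 z A \<noteq> 0" by auto
      then have "A \<subseteq> ?a1 \<union> ?x" "card A = CARD('n)" using z_supp by blast+
      moreover have "A \<subseteq> ?x" using calculation(1) A disj unfolding r by blast
      ultimately have "A = ?x" using sub_x by blast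
      then show False using A by simp
    qed
    then have "kprod z w (range inj2) = (\<Sum>A\<in>{?x}. ?t A)"
      unfolding kprod_def wedge_eq by (intro sum.mono_neutral_right) (auto simp: r)
    also have "\<dots> = shuffle_sign ?x ?a2 * (z (range Inr) * w (range Inl))"
      by (simp add: d ez ew mult.assoc)
    also have "shuffle_sign ?x ?a2 = ((- 1) ^ (CARD('n) * CARD('n)) :: 'n ratfun fps)"
    proof -
      have "{(a, b). a \<in> ?x \<and> b \<in> ?a2 \<and> b < a} = ?x \<times> ?a2" by (auto simp: less_sum_def less_eq_sum_def)
      moreover have "card ?a2 = CARD('n)" by (simp add: card_image inj_on_def)
      ultimately show ?thesis unfolding shuffle_sign_def by (simp add: card_cartesian_product cx)
    qed
    finally show ?thesis .
  qed
qed

section \<open>Conjugation, the two expressions for the pairing, and sesquilinearity\<close>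

section \<open>The pairing\<close>

lemma conj_form_nth: "fps_nth (conj_form \<omega> S :: 'n::{finite,linorder} ratfun fps) k = (- 1) ^ CARD('n) * (- 1) ^ k * fps_nth (\<omega> S) k"
proof -
  have "((- 1) ^ m :: 'n ratfun fps) = fps_const ((- 1) ^ m)" for m
    by (simp flip: fps_const_power fps_const_1_eq_1 fps_const_neg)
  then show ?thesis by (simp add: conj_form_def fps_compose_uminus' mult.assoc)
qed

lemma additive_conj_form: "additive conj_form"
  by (auto simp: additive_def fun_eq_iff fps_eq_iff conj_form_nth distrib_left)

lemma power_minus_one_cases: "(- 1) ^ m = (1 :: 'a::ring_1) \<or> (- 1) ^ m = (- 1 :: 'a)"
  using neg_one_even_power neg_one_odd_power by blast

lemma sign_mem:
  assumes "diff_ring R" "x \<in> R"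
  shows "(- 1) ^ m * x \<in> R"
  using power_minus_one_cases[of m, where 'a = "'a ratfun"] assms diff_ring.minus_mem by auto

text \<open>Substituting -u turns -d\<phi> + u d into -(d\<phi> + u d): conjugation respects the
  differentials up to sign, hence preserves coboundaries.\<close>

lemma conj_form_tw:
  "conj_form (ext_op (dtw (- \<phi>)) \<omega>) = ext_op (dtw \<phi>) (- conj_form \<omega>)"
proof -
  have sg: "rat_deriv g ((- 1) ^ m * x) = (- 1) ^ m * rat_deriv g x" for g :: 'a and m x
    using power_minus_one_cases[of m, where 'a = "'a ratfun"] by (auto simp: rat_deriv_minus)
  have tw: "fps_nth (dtw (- \<phi>) g F) k * ((- 1) ^ CARD('a) * (- 1) ^ k) =
      fps_nth (dtw \<phi> g (- (Abs_fps (\<lambda>k. (- 1) ^ CARD('a) * (- 1) ^ k * fps_nth F k)))) k" for g F k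
    by (cases k; simp add: mpderiv_minus mult.assoc sg rat_deriv_minus; simp add: algebra_simps)
  have cf: "conj_form \<omega> S = Abs_fps (\<lambda>k. (- 1) ^ CARD('a) * (- 1) ^ k * fps_nth (\<omega> S) k)" for S
    by (simp add: fps_eq_iff conj_form_nth)
  show ?thesis
  proof (intro ext fps_ext)
    fix S k
    have "fps_nth (conj_form (ext_op (dtw (- \<phi>)) \<omega>) S) k =
       (\<Sum>g\<in>S. es g S * (fps_nth (dtw (- \<phi>) g (\<omega> (S - {g}))) k * ((- 1) ^ CARD('a) * (- 1) ^ k)))"
      unfolding conj_form_nth ext_op_def fps_sum_nth es_fps fps_mult_left_const_nth sum_distrib_left
      by (intro sum.cong refl) (simp only: mult_ac)
    also have "\<dots> = fps_nth (ext_op (dtw \<phi>) (- conj_form \<omega>) S) k"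
      unfolding tw cf[symmetric] unfolding ext_op_def fps_sum_nth es_fps fps_mult_left_const_nth by simp
    finally show "fps_nth (conj_form (ext_op (dtw (- \<phi>)) \<omega>) S) k = fps_nth (ext_op (dtw \<phi>) (- conj_form \<omega>) S) k" .
  qed
qed

lemma conj_form_mem:
  assumes "diff_ring R" "\<omega> \<in> forms (\<lambda>_. R) k"
  shows "conj_form \<omega> \<in> forms (\<lambda>_. R) k"
proof -
  have "fps_nth (conj_form \<omega> S) j \<in> R" for S j
    unfolding conj_form_nth mult.assoc
    using assms(2) by (intro sign_mem[OF assms(1)]) (simp add: forms_def)
  moreover have "card S = k" if "conj_form \<omega> S \<noteq> 0" for S
  proof -
    have "\<omega> S \<noteq> 0" using that by (auto simp: fps_eq_iff conj_form_nth)
    then show ?thesis using assms(2) by (simp add: forms_def)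
  qed
  ultimately show ?thesis by (simp add: forms_def)
qed

text \<open>Above degree n there are no forms.\<close>

lemma top_degree_cocycle:
  fixes \<omega> :: "'n::{finite,linorder} set \<Rightarrow> 'n ratfun fps"
  assumes "diff_ring R" "\<omega> \<in> forms (\<lambda>_. R) CARD('n)"
  shows "\<omega> \<in> cocycles (deRham R \<phi>) CARD('n)"
proof -
  interpret form_cx "dR_lam \<phi>" rat_deriv "\<lambda>_. R" by (rule form_cx_dR[OF assms(1)])
  have "ext_op (dtw \<phi>) \<omega> S = 0" for S
  proof (rule ccontr)
    assume "ext_op (dtw \<phi>) \<omega> S \<noteq> 0"
    then have "card S = Suc CARD('n)"
      by (rule ext_op_card[OF additive_tw, rotated]) (use assms(2) in \<open>auto simp: forms_def\<close>)
    then show False using card_mono[of UNIV S] by simp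
  qed
  then show ?thesis using assms(2) by (auto simp: cocycles_def deRham_eq fcx_def fun_eq_iff)
qed

lemma top_form_cocycle:
  fixes s :: "'n::{finite,linorder} \<Rightarrow> 'n mpoly"
  assumes nz: "\<And>i. s i \<noteq> 0" and F: "\<And>k. fps_nth F k \<in> loc_at s UNIV"
  shows "top_form F \<in> cocycles (cech s 0) (2 * CARD('n))"
proof -
  interpret form_cx "cech_lam 0" cech_del "cech_mod s" by (rule form_cx_cech[of s, OF nz])
  have mem: "top_form F \<in> forms (cech_mod s) (2 * CARD('n))"
    using F M_zero by (auto simp: forms_def top_form_def cech_mod_UNIV card_sum_self)
  have "ext_op (tw (cech_lam 0) cech_del) (top_form F) S = 0" for S :: "('n + 'n) set"
  proof (rule ccontr)
    assume "ext_op (tw (cech_lam 0) cech_del) (top_form F) S \<noteq> 0"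
    then have "card S = Suc (2 * CARD('n))"
      by (rule ext_op_card[OF additive_tw, rotated]) (use mem in \<open>auto simp: forms_def\<close>)
    then show False using card_mono[of UNIV S] by (simp add: card_sum_self)
  qed
  then show ?thesis using mem by (auto simp: cocycles_def fst_cech snd_cech fun_eq_iff)
qed

lemma cst_fps_const: "cst_fps (fps_const c) = fps_const (cst c)"
  by (auto simp: cst_fps_def fps_eq_iff)

lemma cst_fps_X: "cst_fps fps_X = fps_X"
  by (auto simp: cst_fps_def fps_eq_iff fps_X_def)

context isolated_critical_point
begin

abbreviation s where "s \<equiv> grad f"

lemma parameters_grad: "parameters s"
  by (rule parameters.intro[OF grad_nonzero Var_nilpotent])

text \<open>Relations for one copy serve for the doubled family, with weight 0 on the second
  copy.\<close>

lemma parameters_grad2: "parameters (case_sum s s)"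
proof (rule parameters.intro)
  show "case_sum s s x \<noteq> 0" for x by (cases x) (simp_all add: grad_nonzero)
  fix j l
  obtain m q where mq: "Var j ^ m = (\<Sum>i\<in>UNIV. q i * s i ^ l)" using Var_nilpotent[of j l] by blast
  have "(\<Sum>i\<in>UNIV <+> UNIV. case_sum q (\<lambda>_. 0) i * case_sum s s i ^ l) = (\<Sum>i\<in>UNIV. q i * s i ^ l)"
    by (subst sum.Plus) simp_all
  then show "\<exists>m q. Var j ^ m = (\<Sum>i\<in>UNIV. q i * case_sum s s i ^ l)"
    using mq by (intro exI[of _ m] exI[of _ "case_sum q (\<lambda>_. 0)"]) simp
qed

lemma grad_pm: "\<phi> \<in> {f, - f} \<Longrightarrow> s i = mpderiv i \<phi> \<or> s i = - mpderiv i \<phi>"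
  by (auto simp: grad_def mpderiv_minus)

lemma mpderiv_nonzero: "\<phi> \<in> {f, - f} \<Longrightarrow> mpderiv i \<phi> \<noteq> 0"
  using grad_nonzero[of i] by (auto simp: grad_def mpderiv_minus)

lemma comaximal_pm:
  assumes "\<phi> \<in> {f, - f}" "lookup0 b \<noteq> 0"
  shows "\<exists>c q. 1 = c * b + (\<Sum>i\<in>UNIV. q i * mpderiv i \<phi>)"
proof -
  obtain c q where cq: "1 = c * b + (\<Sum>i\<in>UNIV. q i * grad f i)" using grad_comaximal[OF assms(2)] by blast
  show ?thesis
  proof (cases "\<phi> = f")
    case True
    then show ?thesis using cq unfolding grad_def by blast
  next
    case False
    then have "\<phi> = - f" using assms(1) by simp
    then have "1 = c * b + (\<Sum>i\<in>UNIV. (- q i) * mpderiv i \<phi>)" using cq by (simp add: grad_def mpderiv_minus)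
    then show ?thesis by (intro exI[of _ c] exI[of _ "\<lambda>i. - q i"])
  qed
qed

lemma bij_localize:
  assumes "\<phi> \<in> {f, - f}"
  shows "coh_map (deRham (range emb) \<phi>) (deRham Qm \<phi>) CARD('n) (\<lambda>\<omega>. \<omega>)"
    "bij_betw (localize_map \<phi>) (H_poly \<phi>) (H_loc \<phi>)"
  using bij_betw_localize[of \<phi>] comaximal_pm[OF assms] by blast+

lemma bij_can_map:
  assumes "\<phi> \<in> {f, - f}"
  shows "coh_map (cech s \<phi>) (deRham Qm \<phi>) CARD('n) (restr Inr)"
    "bij_betw (can_map \<phi>) (H_supp s \<phi>) (H_loc \<phi>)"
  using bij_betw_can_map[of s \<phi>, OF grad_nonzero grad_pm[OF assms]] by blast+

lemma emb_range_Qm: "x \<in> range emb \<Longrightarrow> x \<in> Qm"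
  using Qm.emb_mem by blast

text \<open>This makes the \<open>inv_into\<close> in \<open>pairing\<close> explicit: the Koszul
  cocycle is a preimage, and the canonical map is injective on classes.\<close>

lemma lift_class:
  assumes \<phi>: "\<phi> \<in> {f, - f}" and \<omega>: "\<omega> \<in> forms (\<lambda>_. range emb) CARD('n)"
  shows "koszul_cocycle \<phi> (\<omega> UNIV) \<in> cocycles (cech s \<phi>) CARD('n)"
    and "inv_into (H_supp s \<phi>) (can_map \<phi>) (localize_map \<phi> (cls_poly \<phi> \<omega>)) =
      cls (cech s \<phi>) CARD('n) (koszul_cocycle \<phi> (\<omega> UNIV))"
proof -
  let ?n = "CARD('n)" and ?Z = "koszul_cocycle \<phi> (\<omega> UNIV)"
  interpret L: coh_map "deRham (range emb) \<phi>" "deRham Qm \<phi>" ?n "\<lambda>\<omega>. \<omega>" by (rule bij_localize[OF \<phi>])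
  interpret K: coh_map "cech s \<phi>" "deRham Qm \<phi>" ?n "restr Inr" by (rule bij_can_map[OF \<phi>])
  have \<omega>c: "\<omega> \<in> cocycles (deRham (range emb) \<phi>) ?n" by (rule top_degree_cocycle[OF diff_ring_poly \<omega>])
  show Z: "?Z \<in> cocycles (cech s \<phi>) ?n"
    by (rule koszul_cocycle_mem[of s \<phi>, OF grad_nonzero grad_pm[OF \<phi>]])
      (rule emb_range_Qm, use \<omega> in \<open>simp add: forms_def\<close>)
  have "can_map \<phi> (cls (cech s \<phi>) ?n ?Z) = cls (deRham Qm \<phi>) ?n \<omega>"
    unfolding can_map_def K.hmap_cls[OF Z] koszul_cocycle_Inr using forms_subset_UNIV[OF \<omega> refl] by simp
  then have "localize_map \<phi> (cls_poly \<phi> \<omega>) = can_map \<phi> (cls (cech s \<phi>) ?n ?Z)"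
    unfolding localize_map_def cls_poly_def L.hmap_cls[OF \<omega>c] by simp
  then show "inv_into (H_supp s \<phi>) (can_map \<phi>) (localize_map \<phi> (cls_poly \<phi> \<omega>)) = cls (cech s \<phi>) ?n ?Z"
    using inv_into_f_f[OF bij_betw_imp_inj_on[OF bij_can_map(2)[OF \<phi>]] K.C.cls_mem[OF Z]] by simp
qed

text \<open>Since \<open>conj_form\<close> commutes with the differentials only up to sign,
  \<open>coh_map\<close> is verified directly on cocycles and coboundaries.\<close>

lemma conj_class:
  assumes \<omega>: "\<omega> \<in> forms (\<lambda>_. range emb) CARD('n)"
  shows "conj_map f (cls_poly (- f) \<omega>) = cls_poly f (conj_form \<omega>)"
proof -
  let ?n = "CARD('n)"
  note P = diff_ring_poly
  have "coh_map (deRham (range emb) (- f)) (deRham (range emb) f) ?n conj_form"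
  proof (intro coh_map.intro coh_map_axioms.intro cochain_deRham[OF P] additive_conj_form)
    show "conj_form z \<in> cocycles (deRham (range emb) f) ?n" if "z \<in> cocycles (deRham (range emb) (- f)) ?n" for z
      using that by (intro top_degree_cocycle[OF P] conj_form_mem[OF P]) (simp add: cocycles_def deRham_eq fcx_def)
    fix z assume z: "z \<in> coboundaries (deRham (range emb) (- f)) ?n"
    obtain m where m: "?n = Suc m" by (metis card_gt_0_iff finite UNIV_not_empty gr0_implies_Suc)
    obtain y where y: "y \<in> forms (\<lambda>_. range emb) m" "z = ext_op (dtw (- f)) y"
      using z by (auto simp: coboundaries_def m deRham_eq fcx_def)
    have "- conj_form y \<in> fst (deRham (range emb) f) m"
      using conj_form_mem[OF P y(1)] by (intro cochain.minus_mem[OF cochain_deRham[OF P]]) (simp add: deRham_eq fcx_def)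
    from cochain.coboundaryI[OF cochain_deRham[OF P] this] show "conj_form z \<in> coboundaries (deRham (range emb) f) ?n"
      unfolding m y(2) conj_form_tw by (simp add: deRham_eq fcx_def)
  qed
  then show ?thesis
    unfolding conj_map_def cls_poly_def by (rule coh_map.hmap_cls[OF _ top_degree_cocycle[OF P \<omega>]])
qed

definition Rs :: "'n ratfun fps \<Rightarrow> complex fps" where
  "Rs F = res s (cls (cech s 0) (2 * CARD('n)) (top_form F))"

lemma R_loc: "diff_ring (loc_at s A)"
  by (rule diff_ring_loc_at[OF grad_nonzero])

lemma Rs_add:
  assumes "\<And>k. fps_nth F k \<in> loc_at s UNIV" "\<And>k. fps_nth G k \<in> loc_at s UNIV"
  shows "Rs (F + G) = Rs F + Rs G"
proof -
  have e: "top_form (F + G) = top_form F + (top_form G :: ('n + 'n) set \<Rightarrow> _)" by (auto simp: top_form_def fun_eq_iff)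
  show ?thesis
    unfolding Rs_def e
    by (rule parameters.res_add[OF parameters_grad top_form_cocycle[OF grad_nonzero] top_form_cocycle[OF grad_nonzero]])
      (use assms in auto)
qed

lemma Rs_scale:
  assumes "\<And>k. fps_nth F k \<in> loc_at s UNIV"
  shows "Rs (cst_fps p * F) = p * Rs F"
proof -
  have e: "top_form (cst_fps p * F) = (\<lambda>S :: ('n + 'n) set. cst_fps p * top_form F S)" by (auto simp: top_form_def fun_eq_iff)
  show ?thesis
    unfolding Rs_def e
    by (rule parameters.res_scale[OF parameters_grad top_form_cocycle[OF grad_nonzero assms]])
qed

text \<open>One product cocycle, restricted to the first and to the second copy of the \<alpha>'s.
  Both expressions equal the pairing, hence the averaging in the formula; sesquilinearity is read
  off the first.\<close>

lemma pairing_eq: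
  assumes \<omega>: "\<omega> \<in> forms (\<lambda>_. range emb) CARD('n)" and \<eta>: "\<eta> \<in> forms (\<lambda>_. range emb) CARD('n)"
  shows "pairing f (cls_poly (- f) \<omega>) (cls_poly (- f) \<eta>) = Rs (inv_tws (- f) UNIV (\<omega> UNIV) * conj_form \<eta> UNIV)"
    and "pairing f (cls_poly (- f) \<omega>) (cls_poly (- f) \<eta>) =
      Rs ((- 1) ^ (CARD('n) * CARD('n)) * (\<omega> UNIV * inv_tws f UNIV (conj_form \<eta> UNIV)))"
proof -
  let ?n = "CARD('n)"
  have c\<eta>: "conj_form \<eta> \<in> forms (\<lambda>_. range emb) ?n" by (rule conj_form_mem[OF diff_ring_poly \<eta>])
  let ?Z = "koszul_cocycle (- f) (\<omega> UNIV)" and ?W = "koszul_cocycle f (conj_form \<eta> UNIV)"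
  have Z: "?Z \<in> cocycles (cech s (- f)) ?n" by (rule lift_class) (use \<omega> in auto)
  have W: "?W \<in> cocycles (cech s f) ?n" by (rule lift_class) (use c\<eta> in auto)
  have ZW: "?Z \<in> forms (cech_mod s) ?n" "?W \<in> forms (cech_mod s) ?n"
    using Z W by (simp_all add: cocycles_def fst_cech)
  let ?K = "kprod ?Z ?W"
  have K: "?K \<in> cocycles (cech (case_sum s s) 0) (2 * ?n)"
    by (rule kun_wedge_cls(1)[OF grad_nonzero grad_nonzero _ Z W]) simp
  have "pairing f (cls_poly (- f) \<omega>) (cls_poly (- f) \<eta>) =
      res (case_sum s s) (kun_wedge s s (cls (cech s (- f)) ?n ?Z) (cls (cech s f) ?n ?W))"
    unfolding pairing_def conj_class[OF \<eta>]
    using lift_class(2)[of "- f", OF _ \<omega>] lift_class(2)[of f, OF _ c\<eta>] by simp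
  also have "\<dots> = res (case_sum s s) (cls (cech (case_sum s s) 0) (2 * ?n) ?K)"
    by (subst kun_wedge_cls(2)[OF grad_nonzero grad_nonzero _ Z W]) simp_all
  finally have p: "pairing f (cls_poly (- f) \<omega>) (cls_poly (- f) \<eta>) =
      res (case_sum s s) (cls (cech (case_sum s s) 0) (2 * ?n) ?K)" .
  have top: "\<zeta> = top_form (\<zeta> UNIV)" if "\<zeta> \<in> cocycles (cech s 0) (2 * ?n)" for \<zeta>
    using that by (intro forms_subset_UNIV[where M = "cech_mod s" and k = "2 * ?n"])
      (simp_all add: cocycles_def fst_cech card_sum_self)
  have 1: "restr inj1 ?K \<in> cocycles (cech s 0) (2 * ?n)"
    "res (case_sum s s) (cls (cech (case_sum s s) 0) (2 * ?n) ?K) = res s (cls (cech s 0) (2 * ?n) (restr inj1 ?K))"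
    using res_restr[of "case_sum s s" Inl, OF parameters_grad2 _ strict_mono_Inl K] parameters_grad by simp_all
  have 2: "restr inj2 ?K \<in> cocycles (cech s 0) (2 * ?n)"
    "res (case_sum s s) (cls (cech (case_sum s s) 0) (2 * ?n) ?K) = res s (cls (cech s 0) (2 * ?n) (restr inj2 ?K))"
    using res_restr[of "case_sum s s" Inr, OF parameters_grad2 _ strict_mono_Inr K] parameters_grad by simp_all
  have "restr inj1 ?K = top_form (inv_tws (- f) UNIV (\<omega> UNIV) * conj_form \<eta> UNIV)"
    using top[OF 1(1)] kprod_restr(1)[OF ZW] by (simp add: restr_def koszul_cocycle_range)
  then show "pairing f (cls_poly (- f) \<omega>) (cls_poly (- f) \<eta>) = Rs (inv_tws (- f) UNIV (\<omega> UNIV) * conj_form \<eta> UNIV)"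
    unfolding p 1(2) Rs_def by simp
  have "restr inj2 ?K = top_form ((- 1) ^ (?n * ?n) * (\<omega> UNIV * inv_tws f UNIV (conj_form \<eta> UNIV)))"
    using top[OF 2(1)] kprod_restr(2)[OF ZW] by (simp add: restr_def koszul_cocycle_range)
  then show "pairing f (cls_poly (- f) \<omega>) (cls_poly (- f) \<eta>) =
      Rs ((- 1) ^ (?n * ?n) * (\<omega> UNIV * inv_tws f UNIV (conj_form \<eta> UNIV)))"
    unfolding p 2(2) Rs_def by simp
qed

lemma inv_tws_loc:
  assumes "\<phi> \<in> {f, - f}" "\<And>k. fps_nth q k \<in> range emb"
  shows "fps_nth (inv_tws \<phi> UNIV q) k \<in> loc_at s UNIV"
  by (rule inv_tws_mem[of s \<phi>, OF grad_nonzero grad_pm[OF assms(1)] emb_range_Qm[OF assms(2)]])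

lemma times_loc:
  assumes "\<And>k. fps_nth F k \<in> loc_at s UNIV" "\<And>k. fps_nth G k \<in> loc_at s UNIV"
  shows "fps_nth (F * G) k \<in> loc_at s UNIV"
  unfolding fps_mult_nth using assms by (intro diff_ring.sum_mem[OF R_loc] diff_ring.mult_mem[OF R_loc])

lemma emb_loc: "x \<in> range emb \<Longrightarrow> x \<in> loc_at s UNIV"
  using diff_ring.emb_mem[OF R_loc] by blast

text \<open>Linearity over power series in u takes the place of continuity: after N coefficients are
  split off, the tail is u^N times a residue and does not reach order m < N.\<close>

lemma Rs_partial_sum:
  assumes "\<And>k. fps_nth F k \<in> loc_at s UNIV" "m < N"
  shows "fps_nth (\<Sum>i<N. Rs (fps_const (fps_nth F i)) * fps_X ^ i) m = fps_nth (Rs F) m"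
proof -
  have "Rs F = (\<Sum>i<N. Rs (fps_const (fps_nth F i)) * fps_X ^ i) + fps_X ^ N * Rs (fps_shift N F)" for N
  proof (induction N)
    case (Suc N)
    have e: "fps_shift N F = fps_const (fps_nth F N) + cst_fps fps_X * fps_shift (Suc N) F"
      unfolding cst_fps_X by (rule fps_ext) (auto simp: fps_X_mult_nth)
    have l: "fps_nth (fps_const (fps_nth F N)) k \<in> loc_at s UNIV" "fps_nth (fps_shift (Suc N) F) k \<in> loc_at s UNIV" for k
      using assms(1) diff_ring.zero_mem[OF R_loc] by auto
    have "Rs (fps_shift N F) = Rs (fps_const (fps_nth F N)) + fps_X * Rs (fps_shift (Suc N) F)"
      by (subst e, subst Rs_add[OF l(1) cst_fps_mem[OF R_loc l(2)]], subst Rs_scale[OF l(2)]) simp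
    then show ?case using Suc.IH by (simp add: algebra_simps)
  qed simp
  from this[of N] show ?thesis using assms(2) by (simp add: fps_X_power_mult_nth)
qed

lemma form_nth:
  fixes \<omega> :: "'n set \<Rightarrow> 'n ratfun fps"
  shows "\<omega> \<in> forms (\<lambda>_. range emb) k \<Longrightarrow> fps_nth (\<omega> S) j \<in> range emb"
  by (simp add: forms_def)

lemma cst_sign: "cst ((- 1) ^ m) = ((- 1) ^ m :: 'n ratfun)"
  by (cases "even m") (simp_all add: cst_minus del: emb_minus)

lemma conj_loc:
  assumes "\<eta> \<in> forms (\<lambda>_. range emb) CARD('n)"
  shows "fps_nth (conj_form \<eta> UNIV) k \<in> loc_at s UNIV"
  by (rule emb_loc[OF form_nth[OF conj_form_mem[OF diff_ring_poly assms]]])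

lemma integrand_loc:
  fixes \<omega> \<eta> :: "'n set \<Rightarrow> 'n ratfun fps"
  assumes "\<omega> \<in> forms (\<lambda>_. range emb) CARD('n)" "\<eta> \<in> forms (\<lambda>_. range emb) CARD('n)"
  shows "fps_nth (inv_tws (- f) UNIV (\<omega> UNIV) * conj_form \<eta> UNIV) k \<in> loc_at s UNIV"
proof (rule times_loc)
  show "fps_nth (inv_tws (- f) UNIV (\<omega> UNIV)) k \<in> loc_at s UNIV" for k
    by (rule inv_tws_loc) (simp, rule form_nth[OF assms(1)])
qed (rule conj_loc[OF assms(2)])

lemma scale_form_eq: "scale_form p \<omega> S = cst_fps p * \<omega> S"
  by (simp add: scale_form_def cst_fps_def)

lemma scale_form_mem:
  fixes \<omega> :: "'n set \<Rightarrow> 'n ratfun fps"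
  assumes "\<omega> \<in> forms (\<lambda>_. range emb) k"
  shows "scale_form p \<omega> \<in> forms (\<lambda>_. range emb) k"
proof -
  have "fps_nth (scale_form p \<omega> S) j \<in> range emb" for S j
    unfolding scale_form_eq by (rule cst_fps_mem[OF diff_ring_poly form_nth[OF assms]])
  then show ?thesis using assms by (auto simp: forms_def scale_form_eq)
qed

lemma form_add_mem:
  fixes \<omega> \<omega>' :: "'n set \<Rightarrow> 'n ratfun fps"
  assumes "\<omega> \<in> forms (\<lambda>_. range emb) k" "\<omega>' \<in> forms (\<lambda>_. range emb) k"
  shows "\<omega> + \<omega>' \<in> forms (\<lambda>_. range emb) k"
  using cochain.add_mem[OF cochain_deRham[OF diff_ring_poly, where \<phi> = 0], of \<omega> k \<omega>'] assms
  by (simp add: deRham_eq fcx_def)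

text \<open>Substituting -u is multiplicative; this is the source of the conjugate linearity in the
  second argument.\<close>

lemma conj_form_scale:
  fixes \<eta> :: "'n set \<Rightarrow> 'n ratfun fps"
  shows "conj_form (scale_form p \<eta>) S = cst_fps (p oo (- fps_X)) * conj_form \<eta> S"
proof (rule fps_ext)
  fix k
  have key: "(- 1) ^ k * (cst (fps_nth p i) * fps_nth (\<eta> S) (k - i)) =
      cst ((- 1) ^ i * fps_nth p i) * ((- 1) ^ (k - i) * fps_nth (\<eta> S) (k - i))" if "i \<le> k" for i
  proof -
    have e: "(- 1) ^ k = ((- 1) ^ i * (- 1) ^ (k - i) :: 'n ratfun)" using that by (simp flip: power_add)
    show ?thesis unfolding e cst_mult cst_sign by (simp only: mult_ac)
  qed
  have "fps_nth (conj_form (scale_form p \<eta>) S) k =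
      (\<Sum>i=0..k. (- 1) ^ CARD('n) * ((- 1) ^ k * (cst (fps_nth p i) * fps_nth (\<eta> S) (k - i))))"
    unfolding conj_form_nth scale_form_eq by (simp add: fps_mult_nth cst_fps_def sum_distrib_left mult.assoc)
  also have "\<dots> = (\<Sum>i=0..k. (- 1) ^ CARD('n) *
      (cst ((- 1) ^ i * fps_nth p i) * ((- 1) ^ (k - i) * fps_nth (\<eta> S) (k - i))))"
    by (intro sum.cong refl arg_cong[where f = "\<lambda>x. (- 1) ^ CARD('n) * x"] key) simp
  also have "\<dots> = fps_nth (cst_fps (p oo (- fps_X)) * conj_form \<eta> S) k"
    unfolding fps_mult_nth cst_fps_def conj_form_nth fps_compose_uminus' fps_nth_Abs_fps
    by (simp only: mult_ac)
  finally show "fps_nth (conj_form (scale_form p \<eta>) S) k = fps_nth (cst_fps (p oo (- fps_X)) * conj_form \<eta> S) k" .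
qed

lemma pairing_add_left:
  assumes "\<omega> \<in> forms (\<lambda>_. range emb) CARD('n)" "\<omega>' \<in> forms (\<lambda>_. range emb) CARD('n)"
    "\<eta> \<in> forms (\<lambda>_. range emb) CARD('n)"
  shows "pairing f (cls_poly (- f) (\<omega> + \<omega>')) (cls_poly (- f) \<eta>) =
    pairing f (cls_poly (- f) \<omega>) (cls_poly (- f) \<eta>) + pairing f (cls_poly (- f) \<omega>') (cls_poly (- f) \<eta>)"
proof -
  have nz: "mpderiv i (- f) \<noteq> 0" for i by (rule mpderiv_nonzero) simp
  show ?thesis
    unfolding pairing_eq(1)[OF form_add_mem[OF assms(1,2)] assms(3)] pairing_eq(1)[OF assms(1,3)]
      pairing_eq(1)[OF assms(2,3)] plus_fun_apply inv_tws_add[OF nz] distrib_right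
    by (rule Rs_add[OF integrand_loc[OF assms(1,3)] integrand_loc[OF assms(2,3)]])
qed

lemma pairing_add_right:
  assumes "\<omega> \<in> forms (\<lambda>_. range emb) CARD('n)" "\<omega>' \<in> forms (\<lambda>_. range emb) CARD('n)"
    "\<eta> \<in> forms (\<lambda>_. range emb) CARD('n)"
  shows "pairing f (cls_poly (- f) \<eta>) (cls_poly (- f) (\<omega> + \<omega>')) =
    pairing f (cls_poly (- f) \<eta>) (cls_poly (- f) \<omega>) + pairing f (cls_poly (- f) \<eta>) (cls_poly (- f) \<omega>')"
  unfolding pairing_eq(1)[OF assms(3) form_add_mem[OF assms(1,2)]] pairing_eq(1)[OF assms(3,1)]
    pairing_eq(1)[OF assms(3,2)] additive.add[OF additive_conj_form] plus_fun_apply distrib_left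
  by (rule Rs_add[OF integrand_loc[OF assms(3,1)] integrand_loc[OF assms(3,2)]])

lemma pairing_scale_left:
  assumes "\<omega> \<in> forms (\<lambda>_. range emb) CARD('n)" "\<eta> \<in> forms (\<lambda>_. range emb) CARD('n)"
  shows "pairing f (cls_poly (- f) (scale_form p \<omega>)) (cls_poly (- f) \<eta>) =
    p * pairing f (cls_poly (- f) \<omega>) (cls_poly (- f) \<eta>)"
proof -
  have nz: "mpderiv i (- f) \<noteq> 0" for i by (rule mpderiv_nonzero) simp
  show ?thesis
    unfolding pairing_eq(1)[OF scale_form_mem[OF assms(1)] assms(2)] pairing_eq(1)[OF assms]
      scale_form_eq inv_tws_scale[OF nz] mult.assoc
    by (rule Rs_scale[OF integrand_loc[OF assms]])
qed

lemma pairing_scale_right: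
  assumes "\<omega> \<in> forms (\<lambda>_. range emb) CARD('n)" "\<eta> \<in> forms (\<lambda>_. range emb) CARD('n)"
  shows "pairing f (cls_poly (- f) \<omega>) (cls_poly (- f) (scale_form p \<eta>)) =
    (p oo (- fps_X)) * pairing f (cls_poly (- f) \<omega>) (cls_poly (- f) \<eta>)"
  unfolding pairing_eq(1)[OF assms(1) scale_form_mem[OF assms(2)]] pairing_eq(1)[OF assms]
    conj_form_scale mult.left_commute[of "inv_tws (- f) UNIV (\<omega> UNIV)"]
  by (rule Rs_scale[OF integrand_loc[OF assms]])

lemma poly_form_mem:
  fixes h :: "'n mpoly"
  shows "poly_form h \<in> forms (\<lambda>_. range emb) CARD('n)"
proof -
  have "fps_nth (poly_form h S) j \<in> range emb" for S :: "'n set" and j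
    using diff_ring.zero_mem[OF diff_ring_poly] by (simp add: poly_form_def top_form_def)
  then show ?thesis by (auto simp: forms_def poly_form_def top_form_def)
qed

lemma minus_one_power_fps: "((- 1) ^ m :: 'n ratfun fps) = fps_const ((- 1) ^ m)"
  by (simp flip: fps_const_power fps_const_1_eq_1 fps_const_neg)

lemma conj_poly_form: "conj_form (poly_form g) UNIV = (fps_const ((- 1) ^ CARD('n) * emb g) :: 'n ratfun fps)"
  by (rule fps_ext) (simp add: conj_form_nth poly_form_def top_form_def)

lemma integrand_first:
  "inv_tws (- f) UNIV (poly_form h UNIV) * conj_form (poly_form g) UNIV =
     Abs_fps (\<lambda>i. (- 1) ^ CARD('n) * b_coeff i f h * emb g)"
  unfolding conj_poly_form
  by (rule fps_ext) (simp add: inv_tws_nth[of "- f" f] poly_form_def top_form_def mult_ac)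

text \<open>The sign from passing n dx's by n \<alpha>'s and the sign (-1)^n of conjugation cancel
  because n*n + n is even. Hence the second residue in the formula carries no sign.\<close>

lemma integrand_second:
  "(- 1) ^ (CARD('n) * CARD('n)) * (poly_form h UNIV * inv_tws f UNIV (conj_form (poly_form g) UNIV)) =
     Abs_fps (\<lambda>i. b_coeff i (- f) g * emb h)"
proof (rule fps_ext)
  fix i
  let ?n = "CARD('n)"
  have nz: "mpderiv i f \<noteq> 0" for i by (rule mpderiv_nonzero) simp
  have s: "cst_fps (fps_const ((- 1) ^ ?n)) = ((- 1) ^ ?n :: 'n ratfun fps)"
    unfolding cst_fps_const cst_sign minus_one_power_fps ..
  have c: "fps_const ((- 1) ^ ?n * emb g) = cst_fps (fps_const ((- 1) ^ ?n)) * fps_const (emb g)"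
    unfolding s minus_one_power_fps by simp
  have "(- 1) ^ (?n * ?n) * (poly_form h UNIV * inv_tws f UNIV (conj_form (poly_form g) UNIV)) =
      ((- 1) ^ (?n * ?n) * (- 1) ^ ?n) * (fps_const (emb h) * inv_tws f UNIV (fps_const (emb g)))"
    unfolding conj_poly_form c unfolding inv_tws_scale[OF nz] unfolding s by (simp add: poly_form_def top_form_def mult_ac)
  also have "(- 1) ^ (?n * ?n) * (- 1) ^ ?n = (1 :: 'n ratfun fps)"
    by (cases "even ?n") simp_all
  finally show "fps_nth ((- 1) ^ (?n * ?n) * (poly_form h UNIV * inv_tws f UNIV (conj_form (poly_form g) UNIV))) i =
      fps_nth (Abs_fps (\<lambda>i. b_coeff i (- f) g * emb h)) i"
    by (simp add: inv_tws_nth[of f "- f"] mult_ac)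
qed

text \<open>Each of the two series of residues already sums to the pairing, so half of their sum
  does. Convergence is u-adic: the coefficient at u^m is constant once N > m.\<close>

theorem pairing_formula:
  "(\<lambda>i. fps_const (1 / 2) *
       (res_top f ((- 1) ^ CARD('n) * b_coeff i f h * emb g) +
        res_top f (b_coeff i (- f) g * emb h)) * fps_X ^ i)
     sums pairing f (cls_poly (- f) (poly_form h)) (cls_poly (- f) (poly_form g))"
proof -
  let ?p = "pairing f (cls_poly (- f) (poly_form h)) (cls_poly (- f) (poly_form g))"
  let ?F = "inv_tws (- f) UNIV (poly_form h UNIV) * conj_form (poly_form g) UNIV"
  let ?G = "(- 1) ^ (CARD('n) * CARD('n)) * (poly_form h UNIV * inv_tws f UNIV (conj_form (poly_form g) UNIV))"
  have F: "fps_nth ?F k \<in> loc_at s UNIV" for k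
    by (rule integrand_loc[OF poly_form_mem poly_form_mem])
  have G: "fps_nth ?G k \<in> loc_at s UNIV" for k
  proof -
    have "fps_nth (inv_tws f UNIV (conj_form (poly_form g) UNIV)) k \<in> loc_at s UNIV" for k
      by (rule inv_tws_loc) (simp, rule form_nth[OF conj_form_mem[OF diff_ring_poly poly_form_mem]])
    then have "fps_nth (poly_form h UNIV * inv_tws f UNIV (conj_form (poly_form g) UNIV)) k \<in> loc_at s UNIV"
      by (intro times_loc emb_loc[OF form_nth[OF poly_form_mem]])
    from sign_mem[OF R_loc this] show ?thesis by (simp add: minus_one_power_fps)
  qed
  have r: "res_top f c = Rs (fps_const c)" for c by (simp add: res_top_def Rs_def)
  have sum: "fps_nth (\<Sum>i<N. fps_const (1 / 2) *
       (res_top f ((- 1) ^ CARD('n) * b_coeff i f h * emb g) +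
        res_top f (b_coeff i (- f) g * emb h)) * fps_X ^ i) m = fps_nth ?p m" if "m < N" for m N
  proof -
    have "(\<Sum>i<N. fps_const (1 / 2) *
         (res_top f ((- 1) ^ CARD('n) * b_coeff i f h * emb g) +
          res_top f (b_coeff i (- f) g * emb h)) * fps_X ^ i) =
       fps_const (1 / 2) * ((\<Sum>i<N. Rs (fps_const (fps_nth ?F i)) * fps_X ^ i) +
         (\<Sum>i<N. Rs (fps_const (fps_nth ?G i)) * fps_X ^ i))"
      unfolding integrand_first integrand_second r fps_nth_Abs_fps
      by (simp add: sum_distrib_left sum.distrib distrib_left distrib_right mult.assoc)
    then show ?thesis
      unfolding fps_mult_left_const_nth fps_add_nth
      using Rs_partial_sum[of ?F m N, OF F that] Rs_partial_sum[of ?G m N, OF G that]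
        pairing_eq(1)[OF poly_form_mem poly_form_mem] pairing_eq(2)[OF poly_form_mem poly_form_mem]
      by simp
  qed
  show ?thesis
    unfolding sums_def
  proof (rule tendsto_fpsI)
    fix m
    show "eventually (\<lambda>N. fps_nth (\<Sum>i<N. fps_const (1 / 2) *
       (res_top f ((- 1) ^ CARD('n) * b_coeff i f h * emb g) +
        res_top f (b_coeff i (- f) g * emb h)) * fps_X ^ i) m = fps_nth ?p m) sequentially"
      using eventually_gt_at_top[of m] by eventually_elim (rule sum)
  qed
qed

end

text \<open>The bijections certify that the inverses inside \<open>pairing\<close> are genuine.
  Sesquilinearity is phrased on forms of degree n; all of them are cocycles, so every class is
  covered.\<close>

theorem mainTheorem4:
  fixes f :: "'n::{finite,linorder} mpoly"
  assumes "critical_points f = {max_ideal}"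
  shows
    "bij_betw (localize_map (- f)) (H_poly (- f)) (H_loc (- f)) \<and>
     bij_betw (localize_map f) (H_poly f) (H_loc f) \<and>
     bij_betw (can_map (- f)) (H_supp (grad f) (- f)) (H_loc (- f)) \<and>
     bij_betw (can_map f) (H_supp (grad f) f) (H_loc f) \<and>
     (\<forall>h g :: 'n mpoly.
        (\<lambda>i. fps_const (1 / 2) *
             (res_top f ((- 1) ^ CARD('n) * b_coeff i f h * emb g) +
              res_top f (b_coeff i (- f) g * emb h)) * fps_X ^ i)
        sums pairing f (cls_poly (- f) (poly_form h)) (cls_poly (- f) (poly_form g))) \<and>
     (\<forall>\<omega>\<in>fst (deRham (range emb) (- f)) CARD('n).
      \<forall>\<omega>'\<in>fst (deRham (range emb) (- f)) CARD('n).
      \<forall>\<eta>\<in>fst (deRham (range emb) (- f)) CARD('n). \<forall>p :: complex fps.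
        pairing f (cls_poly (- f) (\<omega> + \<omega>')) (cls_poly (- f) \<eta>) =
          pairing f (cls_poly (- f) \<omega>) (cls_poly (- f) \<eta>) +
          pairing f (cls_poly (- f) \<omega>') (cls_poly (- f) \<eta>) \<and>
        pairing f (cls_poly (- f) \<eta>) (cls_poly (- f) (\<omega> + \<omega>')) =
          pairing f (cls_poly (- f) \<eta>) (cls_poly (- f) \<omega>) +
          pairing f (cls_poly (- f) \<eta>) (cls_poly (- f) \<omega>') \<and>
        pairing f (cls_poly (- f) (scale_form p \<omega>)) (cls_poly (- f) \<eta>) =
          p * pairing f (cls_poly (- f) \<omega>) (cls_poly (- f) \<eta>) \<and>
        pairing f (cls_poly (- f) \<omega>) (cls_poly (- f) (scale_form p \<eta>)) =
          (p oo (- fps_X)) * pairing f (cls_poly (- f) \<omega>) (cls_poly (- f) \<eta>))"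
proof -
  interpret isolated_critical_point f by (rule isolated_critical_point.intro[OF assms])
  have forms: "fst (deRham (range emb) (- f)) CARD('n) = forms (\<lambda>_. range emb) CARD('n)"
    by (simp add: deRham_eq fcx_def)
  show ?thesis
    unfolding forms
    using bij_localize(2)[of "- f"] bij_localize(2)[of f] bij_can_map(2)[of "- f"] bij_can_map(2)[of f]
      pairing_formula pairing_add_left pairing_add_right pairing_scale_left pairing_scale_right
    by (intro conjI allI ballI) simp_all
qed

end
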